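(* In the setting described in the context, suppose that Assumptions 1, 2 and 3 (stated in full in the context) hold. Select $\rho_\Delta=1/\log(1/\Delta)$ and $c_\Delta=(B_2/B_1)\rho_\Delta^{-(1+1/(2\theta_*-\rho_\Delta))}$, with constants $0<B_1,B_2<\infty$ satisfying the selection conditions stated in the context. Then the estimator $L$ of $\phi(\Delta)$ produced by the state-dependent importance sampling algorithm described in the context has a coefficient of variation (standard deviation divided by mean, under the sampling distribution of the algorithm) of order $O(c_\Delta^{2\theta_*})$ as $\Delta\searrow0$. In particular, $L$ is asymptotically optimal: it is unbiased for $\phi(\Delta)$ and, for every $\varepsilon>0$, its second moment is $O(\phi(\Delta)^{2-\varepsilon})$ as $\Delta\searrow0$.
   Context: Model. $X=(X_n:n\ge 0)$ is a Markov chain with finite state space $\mathcal S$ and transition matrix $(K(x,y):x,y\in\mathcal S)$. $((\xi_n,\eta_n):n\ge1)$ is a sequence of i.i.d. two-dimensional random variables independent of $X$. $\gamma(x,z)$ and $\lambda(x,z)$ ($x\in\mathcal S$, $z\in\mathbb R$) are deterministic real-valued functions, with $\lambda\ge 0$. For $\Delta>0$ let $S_{k+1}=S_k+\gamma(X_{k+1},\xi_{k+1})$, $D_{k+1}=D_k+\Delta\,\lambda(X_{k+1},\eta_{k+1})e^{S_{k+1}}$, $T_\Delta=\inf\{n\ge0:D_n>1\}$, and $\phi(\Delta)=P(T_\Delta<\infty\mid S_0=0,D_0=0,X_0=x_0)$. These are the nominal dynamics. Notation. $E_x$ is expectation given $X_0=x$. Let $\exp(\chi(x,\theta))=E\exp(\theta\gamma(x,\xi_1))$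 and $Q_\theta(x,y)=K(x,y)\exp(\chi(y,\theta))$. For $\theta$ such that $\chi(\cdot,\theta)$ is finite, $\exp(\psi(\theta))$ denotes the Perron–Frobenius eigenvalue of $Q_\theta$, with strictly positive eigenvector $u_\theta$ (unique up to scaling): $Q_\theta u_\theta=e^{\psi(\theta)}u_\theta$. Otherwise $\psi(\theta)=\infty$. The scaling is chosen so that $\theta\mapsto u_\theta(x)$ is continuous on $(0,\theta_*]$ for each $x$. Assumption 1: $X$ is irreducible on the finite state space $\mathcal S$, and $\sup_{x\in\mathcal S,\theta\in\mathcal N}E\exp(\theta\gamma(x,\xi_1))<\infty$ for some neighborhood $\mathcal N$ of the origin. Assumption 2 (Cramér's condition): there exists $\theta_*>0$ with $\psi(\theta_* )=0$, and there exists $\theta>\theta_*$ with $\psi(\theta)<\infty$. Assumption 3: $\sup_{x\in\mathcal S}E_x[\lambda(X_1,\eta_1)^\alpha]<\infty$ for each $\alpha\in(0,\infty)$. Selection of $B_1,B_2$. Let $b_0<\infty$ satisfy $0<1/[\inf_{\theta\in(0,\theta_* ),x\in\mathcal S}u_\theta(x)]^2\le b_0$; let $\mu=\psi'(\theta_* )>0$ and $b_1>0$ be such that $\exp(\psi(\theta_*-\delta))\le1-\delta\mu+b_1\delta^2$ for each $\delta\in(0,\theta_* )$; let $b_2\in(0,\infty)$ satisfy $\sup_{x\in\mathcal S,\delta\in(0,\theta_* )}E_x[\lambda(X_1,\eta_1)^{2\theta_*-\delta}\exp((\theta_*-\delta)\gamma(X_1,\xi_1))]\le b_2$. The constants $B_1,B_2\in(0,\infty)$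 are such that, for all sufficiently small $\Delta$, $\rho_\Delta\in(0,\theta_* )$, $B_1\rho_\Delta<1$ and $$\frac{b_0b_2\rho_\Delta}{B_2^{2\theta_*-\rho_\Delta}}+\frac{1-\rho_\Delta\mu+b_1\rho_\Delta^2}{(1-B_1\rho_\Delta)^{2\theta_*-\rho_\Delta}}\le1 .$$ Algorithm. Let $$h_\Delta(s,d,x)=\min\Big\{c_\Delta^{2\theta_*-\rho_\Delta}e^{(2\theta_*-\rho_\Delta)s}\Big[\frac{\Delta}{(1-d)_+}\Big]^{2\theta_*-\rho_\Delta}u_{\theta_*}(x)u_{\theta_*-\rho_\Delta}(x),\,1\Big\}$$ (equal to $1$ if $d\ge1$) and $C=\{(s,d,x):h_\Delta(s,d,x)<1\}$. Start at $(s,d,x)=(0,0,x_0)$ with $L=1$. While at $(s,d,x)$: if $(s,d,x)\in C$, draw $y$ from $K_{\theta_*}(x,y)=K(x,y)\exp(\chi(y,\theta_* )-\psi(\theta_* ))u_{\theta_*}(y)/u_{\theta_*}(x)$; given $y$, draw $z$ from the law $e^{\theta_* z-\chi(y,\theta_* )}P(\gamma(y,\xi_1)\in dz)$; given $y,z$, draw $w$ from the nominal conditional law of $\lambda(y,\eta_1)$ given $\gamma(y,\xi_1)=z$; and replace $L$ by $L\,e^{-\theta_* z}u_{\theta_*}(x)/u_{\theta_*}(y)$. If $(s,d,x)\notin C$, draw $y$ from $K(x,\cdot)$ and then $(z,w)$ from the nominal law of $(\gamma(y,\xi_1),\lambda(y,\eta_1))$, leaving $L$ unchanged. In both cases update $(s,d,x)$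 to $(s+z,\,d+\Delta w e^{s+z},\,y)$; if the new $d$ exceeds $1$, stop and output $L$; otherwise repeat. (The output is $0$ if the procedure never stops, i.e. on $\{T_\Delta=\infty\}$.) *)

theory Defs
  imports "HOL-Probability.Probability" "HOL-Library.Landau_Symbols"
begin

text \<open>
  \<open>P x\<close> is the probability given \<open>X 0 = x\<close>, and \<open>\<nu>\<close> is the common law of the pairs
  \<open>(\<xi> n, \<eta> n)\<close> for \<open>n \<ge> 1\<close>; within a pair the two components may be dependent.
\<close>

locale nominal_model =
  fixes P :: "'s::finite \<Rightarrow> 'w measure"
    and X :: "nat \<Rightarrow> 'w \<Rightarrow> 's"
    and \<xi> \<eta> :: "nat \<Rightarrow> 'w \<Rightarrow> real"
    and K :: "'s \<Rightarrow> 's \<Rightarrow> real"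
    and \<nu> :: "(real \<times> real) measure"
    and \<gamma> lam :: "'s \<Rightarrow> real \<Rightarrow> real"
  assumes prob_space_P: "prob_space (P x)"
    and K_nonneg: "0 \<le> K x y"
    and K_stochastic: "(\<Sum>y\<in>UNIV. K x y) = 1"
    and markov: "measure (P x) {\<omega> \<in> space (P x). \<forall>i\<le>n. X i \<omega> = p i} =
          (if p 0 = x then \<Prod>i<n. K (p i) (p (Suc i)) else 0)"
    and noise_law: "1 \<le> n \<Longrightarrow> distr (P x) borel (\<lambda>\<omega>. (\<xi> n \<omega>, \<eta> n \<omega>)) = \<nu>"
    and noise_indep: "prob_space.indep_vars (P x) (\<lambda>_. borel) (\<lambda>n \<omega>. (\<xi> n \<omega>, \<eta> n \<omega>)) {1..}"
    and X_measurable: "X n \<in> P x \<rightarrow>\<^sub>M count_space UNIV"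
    and chain_noise_indep: "prob_space.indep_set (P x)
          (sets (vimage_algebra (space (P x)) (\<lambda>\<omega> n. X n \<omega>)
             (\<Pi>\<^sub>M n\<in>UNIV. count_space UNIV)))
          (sets (vimage_algebra (space (P x)) (\<lambda>\<omega>. \<lambda>n\<in>{1..}. (\<xi> n \<omega>, \<eta> n \<omega>))
             (\<Pi>\<^sub>M n\<in>{1..}. borel)))"
    and \<gamma>_measurable: "\<gamma> x \<in> borel_measurable borel"
    and lam_measurable: "lam x \<in> borel_measurable borel"
    and lam_nonneg: "0 \<le> lam x z"

primrec walk :: "('s \<Rightarrow> real \<Rightarrow> real) \<Rightarrow> (nat \<Rightarrow> 'w \<Rightarrow> 's) \<Rightarrow> (nat \<Rightarrow> 'w \<Rightarrow> real)
    \<Rightarrow> nat \<Rightarrow> 'w \<Rightarrow> real" where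
  "walk \<gamma> X \<xi> 0 \<omega> = 0"
| "walk \<gamma> X \<xi> (Suc k) \<omega> = walk \<gamma> X \<xi> k \<omega> + \<gamma> (X (Suc k) \<omega>) (\<xi> (Suc k) \<omega>)"

primrec perpetuity :: "('s \<Rightarrow> real \<Rightarrow> real) \<Rightarrow> ('s \<Rightarrow> real \<Rightarrow> real) \<Rightarrow> (nat \<Rightarrow> 'w \<Rightarrow> 's)
    \<Rightarrow> (nat \<Rightarrow> 'w \<Rightarrow> real) \<Rightarrow> (nat \<Rightarrow> 'w \<Rightarrow> real) \<Rightarrow> real \<Rightarrow> nat \<Rightarrow> 'w \<Rightarrow> real" where
  "perpetuity \<gamma> lam X \<xi> \<eta> \<Delta> 0 \<omega> = 0"
| "perpetuity \<gamma> lam X \<xi> \<eta> \<Delta> (Suc k) \<omega> = perpetuity \<gamma> lam X \<xi> \<eta> \<Delta> k \<omega>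
     + \<Delta> * lam (X (Suc k) \<omega>) (\<eta> (Suc k) \<omega>) * exp (walk \<gamma> X \<xi> (Suc k) \<omega>)"

definition passage_time :: "(nat \<Rightarrow> real) \<Rightarrow> enat" where
  "passage_time d = (INF n\<in>{n. d n > 1}. enat n)"

definition hit_prob :: "('s \<Rightarrow> 'w measure) \<Rightarrow> ('s \<Rightarrow> real \<Rightarrow> real) \<Rightarrow> ('s \<Rightarrow> real \<Rightarrow> real)
    \<Rightarrow> (nat \<Rightarrow> 'w \<Rightarrow> 's) \<Rightarrow> (nat \<Rightarrow> 'w \<Rightarrow> real) \<Rightarrow> (nat \<Rightarrow> 'w \<Rightarrow> real) \<Rightarrow> 's \<Rightarrow> real \<Rightarrow> real" where
  "hit_prob P \<gamma> lam X \<xi> \<eta> x0 \<Delta> =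
     measure (P x0) {\<omega> \<in> space (P x0).
       passage_time (\<lambda>n. perpetuity \<gamma> lam X \<xi> \<eta> \<Delta> n \<omega>) < \<infinity>}"

definition chi_finite :: "(real \<times> real) measure \<Rightarrow> ('s \<Rightarrow> real \<Rightarrow> real) \<Rightarrow> real \<Rightarrow> bool" where
  "chi_finite \<nu> \<gamma> \<theta> \<longleftrightarrow> (\<forall>x. integrable \<nu> (\<lambda>(a, b). exp (\<theta> * \<gamma> x a)))"

text \<open>Meaningful only where \<^const>\<open>chi_finite\<close> holds; elsewhere the Bochner integral is 0.\<close>

definition chi :: "(real \<times> real) measure \<Rightarrow> ('s \<Rightarrow> real \<Rightarrow> real) \<Rightarrow> 's \<Rightarrow> real \<Rightarrow> real" where
  "chi \<nu> \<gamma> x \<theta> = ln (\<integral>(a, b). exp (\<theta> * \<gamma> x a) \<partial>\<nu>)"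

definition Qmat :: "('s \<Rightarrow> 's \<Rightarrow> real) \<Rightarrow> (real \<times> real) measure \<Rightarrow> ('s \<Rightarrow> real \<Rightarrow> real)
    \<Rightarrow> real \<Rightarrow> 's \<Rightarrow> 's \<Rightarrow> real" where
  "Qmat K \<nu> \<gamma> \<theta> x y = K x y * exp (chi \<nu> \<gamma> y \<theta>)"

text \<open>
  The Perron--Frobenius eigenvalue of a nonnegative irreducible matrix, as the largest modulus
  of a complex eigenvalue (which is itself an eigenvalue).
\<close>

definition perron_root :: "('s::finite \<Rightarrow> 's \<Rightarrow> real) \<Rightarrow> real" where
  "perron_root A = (SUP z\<in>{z :: complex. \<exists>v. v \<noteq> (\<lambda>_. 0) \<and>
     (\<forall>x. (\<Sum>y\<in>UNIV. of_real (A x y) * v y) = z * v x)}. cmod z)"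

definition psi :: "('s::finite \<Rightarrow> 's \<Rightarrow> real) \<Rightarrow> (real \<times> real) measure \<Rightarrow> ('s \<Rightarrow> real \<Rightarrow> real)
    \<Rightarrow> real \<Rightarrow> ereal" where
  "psi K \<nu> \<gamma> \<theta> =
     (if chi_finite \<nu> \<gamma> \<theta> then ereal (ln (perron_root (Qmat K \<nu> \<gamma> \<theta>))) else \<infinity>)"

abbreviation psi_real :: "('s::finite \<Rightarrow> 's \<Rightarrow> real) \<Rightarrow> (real \<times> real) measure
    \<Rightarrow> ('s \<Rightarrow> real \<Rightarrow> real) \<Rightarrow> real \<Rightarrow> real" where
  "psi_real K \<nu> \<gamma> \<theta> \<equiv> real_of_ereal (psi K \<nu> \<gamma> \<theta>)"

definition perron_eigenvectors :: "('s::finite \<Rightarrow> 's \<Rightarrow> real) \<Rightarrow> (real \<times> real) measure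
    \<Rightarrow> ('s \<Rightarrow> real \<Rightarrow> real) \<Rightarrow> (real \<Rightarrow> 's \<Rightarrow> real) \<Rightarrow> bool" where
  "perron_eigenvectors K \<nu> \<gamma> u \<longleftrightarrow> (\<forall>\<theta>. chi_finite \<nu> \<gamma> \<theta> \<longrightarrow>
     (\<forall>x. 0 < u \<theta> x \<and>
       (\<Sum>y\<in>UNIV. Qmat K \<nu> \<gamma> \<theta> x y * u \<theta> y) = exp (psi_real K \<nu> \<gamma> \<theta>) * u \<theta> x))"

definition incr_law :: "(real \<times> real) measure \<Rightarrow> ('s \<Rightarrow> real \<Rightarrow> real) \<Rightarrow> 's \<Rightarrow> real measure" where
  "incr_law \<nu> \<gamma> y = distr \<nu> borel (\<lambda>(a, b). \<gamma> y a)"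

definition joint_law :: "(real \<times> real) measure \<Rightarrow> ('s \<Rightarrow> real \<Rightarrow> real) \<Rightarrow> ('s \<Rightarrow> real \<Rightarrow> real)
    \<Rightarrow> 's \<Rightarrow> (real \<times> real) measure" where
  "joint_law \<nu> \<gamma> lam y = distr \<nu> borel (\<lambda>(a, b). (\<gamma> y a, lam y b))"

definition tilted_incr_law :: "(real \<times> real) measure \<Rightarrow> ('s \<Rightarrow> real \<Rightarrow> real) \<Rightarrow> real \<Rightarrow> 's
    \<Rightarrow> real measure" where
  "tilted_incr_law \<nu> \<gamma> \<theta> y =
     density (incr_law \<nu> \<gamma> y) (\<lambda>z. ennreal (exp (\<theta> * z - chi \<nu> \<gamma> y \<theta>)))"

text \<open>
  \<open>W y\<close> is a version of the regular conditional law of \<open>lam y \<eta>\<close> given \<open>\<gamma> y \<xi> = z\<close>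
  when \<open>(\<xi>, \<eta>)\<close> has law \<open>\<nu>\<close>.
\<close>

definition regular_cond_law :: "(real \<times> real) measure \<Rightarrow> ('s \<Rightarrow> real \<Rightarrow> real)
    \<Rightarrow> ('s \<Rightarrow> real \<Rightarrow> real) \<Rightarrow> ('s \<Rightarrow> real \<Rightarrow> real measure) \<Rightarrow> bool" where
  "regular_cond_law \<nu> \<gamma> lam W \<longleftrightarrow> (\<forall>y. W y \<in> borel \<rightarrow>\<^sub>M prob_algebra borel \<and>
     joint_law \<nu> \<gamma> lam y =
       incr_law \<nu> \<gamma> y \<bind> (\<lambda>z. W y z \<bind> (\<lambda>w. return borel (z, w))))"

definition rho :: "real \<Rightarrow> real" where
  "rho \<Delta> = 1 / ln (1 / \<Delta>)"

definition cfun :: "real \<Rightarrow> real \<Rightarrow> real \<Rightarrow> real \<Rightarrow> real" where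
  "cfun \<theta>s B1 B2 \<Delta> = (B2 / B1) * rho \<Delta> powr (- (1 + 1 / (2 * \<theta>s - rho \<Delta>)))"

text \<open>The case \<open>d \<ge> 1\<close> is separate because division by zero yields zero.\<close>

definition hfun :: "(real \<Rightarrow> 's \<Rightarrow> real) \<Rightarrow> real \<Rightarrow> real \<Rightarrow> real \<Rightarrow> real
    \<Rightarrow> real \<times> real \<times> 's \<Rightarrow> real" where
  "hfun u \<theta>s B1 B2 \<Delta> = (\<lambda>(s, d, x).
     if d \<ge> 1 then 1
     else min (cfun \<theta>s B1 B2 \<Delta> powr (2 * \<theta>s - rho \<Delta>) * exp ((2 * \<theta>s - rho \<Delta>) * s)
                 * (\<Delta> / max (1 - d) 0) powr (2 * \<theta>s - rho \<Delta>)
                 * u \<theta>s x * u (\<theta>s - rho \<Delta>) x) 1)"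

definition tilt_region :: "(real \<Rightarrow> 's \<Rightarrow> real) \<Rightarrow> real \<Rightarrow> real \<Rightarrow> real \<Rightarrow> real
    \<Rightarrow> (real \<times> real \<times> 's) set" where
  "tilt_region u \<theta>s B1 B2 \<Delta> = {q. hfun u \<theta>s B1 B2 \<Delta> q < 1}"

definition tilted_K :: "('s::finite \<Rightarrow> 's \<Rightarrow> real) \<Rightarrow> (real \<times> real) measure
    \<Rightarrow> ('s \<Rightarrow> real \<Rightarrow> real) \<Rightarrow> (real \<Rightarrow> 's \<Rightarrow> real) \<Rightarrow> real \<Rightarrow> 's \<Rightarrow> 's \<Rightarrow> real" where
  "tilted_K K \<nu> \<gamma> u \<theta> x y =
     K x y * exp (chi \<nu> \<gamma> y \<theta> - psi_real K \<nu> \<gamma> \<theta>) * u \<theta> y / u \<theta> x"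

text \<open>States of the algorithm are tuples \<open>(s, d, x, L)\<close>.\<close>

type_synonym 's alg_state = "real \<times> real \<times> 's \<times> real"

definition state_space :: "'s alg_state measure" where
  "state_space = borel \<Otimes>\<^sub>M borel \<Otimes>\<^sub>M count_space UNIV \<Otimes>\<^sub>M borel"

definition alg_kernel :: "('s::finite \<Rightarrow> 's \<Rightarrow> real) \<Rightarrow> (real \<times> real) measure
    \<Rightarrow> ('s \<Rightarrow> real \<Rightarrow> real) \<Rightarrow> ('s \<Rightarrow> real \<Rightarrow> real) \<Rightarrow> ('s \<Rightarrow> real \<Rightarrow> real measure)
    \<Rightarrow> (real \<Rightarrow> 's \<Rightarrow> real) \<Rightarrow> real \<Rightarrow> real \<Rightarrow> real \<Rightarrow> real
    \<Rightarrow> 's alg_state \<Rightarrow> 's alg_state measure" where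
  "alg_kernel K \<nu> \<gamma> lam W u \<theta>s B1 B2 \<Delta> = (\<lambda>(s, d, x, L).
     if (s, d, x) \<in> tilt_region u \<theta>s B1 B2 \<Delta> then
       point_measure UNIV (\<lambda>y. ennreal (tilted_K K \<nu> \<gamma> u \<theta>s x y)) \<bind> (\<lambda>y.
       tilted_incr_law \<nu> \<gamma> \<theta>s y \<bind> (\<lambda>z.
       W y z \<bind> (\<lambda>w.
       return state_space (s + z, d + \<Delta> * w * exp (s + z), y,
         L * (exp (- \<theta>s * z) * u \<theta>s x / u \<theta>s y)))))
     else
       point_measure UNIV (\<lambda>y. ennreal (K x y)) \<bind> (\<lambda>y.
       joint_law \<nu> \<gamma> lam y \<bind> (\<lambda>(z, w).
       return state_space (s + z, d + \<Delta> * w * exp (s + z), y, L))))"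

text \<open>The law on trajectories of the Markov chain with kernel \<open>\<kappa>\<close> and initial state \<open>q\<close>.\<close>

definition chain_step :: "'a measure \<Rightarrow> ('a \<Rightarrow> 'a measure) \<Rightarrow> 'a \<Rightarrow> nat \<Rightarrow> (nat \<Rightarrow> 'a)
    \<Rightarrow> 'a measure" where
  "chain_step M \<kappa> q n \<omega> = (case n of 0 \<Rightarrow> return M q | Suc m \<Rightarrow> \<kappa> (\<omega> m))"

definition chain_law :: "'a measure \<Rightarrow> ('a \<Rightarrow> 'a measure) \<Rightarrow> 'a \<Rightarrow> (nat \<Rightarrow> 'a) measure" where
  "chain_law M \<kappa> q =
     projective_family.lim UNIV (Ionescu_Tulcea.CI (chain_step M \<kappa> q) (\<lambda>_. M)) (\<lambda>_. M)"

lemma Ionescu_Tulcea_chain_step: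
  assumes \<kappa>: "\<kappa> \<in> M \<rightarrow>\<^sub>M prob_algebra M" and q: "q \<in> space M"
  shows "Ionescu_Tulcea (chain_step M \<kappa> q) (\<lambda>_. M)"
proof (rule Ionescu_Tulcea.intro)
  fix i :: nat
  have \<kappa>': "\<kappa> \<in> M \<rightarrow>\<^sub>M subprob_algebra M"
    using \<kappa> by (rule measurable_prob_algebraD)
  show "chain_step M \<kappa> q i \<in> Pi\<^sub>M {0..<i} (\<lambda>_. M) \<rightarrow>\<^sub>M subprob_algebra M"
  proof (cases i)
    case 0
    then show ?thesis
      using q by (simp add: chain_step_def[abs_def] return_measurable[THEN measurable_space])
  next
    case (Suc m)
    have "(\<lambda>\<omega>. \<omega> m) \<in> Pi\<^sub>M {0..<Suc m} (\<lambda>_. M) \<rightarrow>\<^sub>M M"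
      by (rule measurable_component_singleton) simp
    from measurable_compose[OF this \<kappa>'] show ?thesis
      using Suc by (simp add: chain_step_def[abs_def])
  qed
next
  fix i :: nat and \<omega> assume \<omega>: "\<omega> \<in> space (Pi\<^sub>M {0..<i} (\<lambda>_. M))"
  show "prob_space (chain_step M \<kappa> q i \<omega>)"
  proof (cases i)
    case 0
    then show ?thesis using q by (simp add: chain_step_def prob_space_return)
  next
    case (Suc m)
    then have "\<omega> m \<in> space M" using \<omega> by (auto simp: space_PiM)
    then show ?thesis
      using Suc measurable_space[OF \<kappa>] by (simp add: chain_step_def space_prob_algebra)
  qed
qed

text \<open>
  The trajectory is continued after the stopping time; \<open>estimator\<close> reads off \<open>L\<close> at
  the stopping time, so the continuation has no effect on it.
\<close>

definition alg_law :: "('s::finite \<Rightarrow> 's \<Rightarrow> real) \<Rightarrow> (real \<times> real) measure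
    \<Rightarrow> ('s \<Rightarrow> real \<Rightarrow> real) \<Rightarrow> ('s \<Rightarrow> real \<Rightarrow> real) \<Rightarrow> ('s \<Rightarrow> real \<Rightarrow> real measure)
    \<Rightarrow> (real \<Rightarrow> 's \<Rightarrow> real) \<Rightarrow> real \<Rightarrow> real \<Rightarrow> real \<Rightarrow> 's \<Rightarrow> real
    \<Rightarrow> (nat \<Rightarrow> 's alg_state) measure" where
  "alg_law K \<nu> \<gamma> lam W u \<theta>s B1 B2 x0 \<Delta> =
     chain_law state_space (alg_kernel K \<nu> \<gamma> lam W u \<theta>s B1 B2 \<Delta>) (0, 0, x0, 1)"

definition estimator :: "(nat \<Rightarrow> 's alg_state) \<Rightarrow> real" where
  "estimator \<tau> =
     (case passage_time (\<lambda>n. case \<tau> n of (s, d, x, L) \<Rightarrow> d) of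
        enat n \<Rightarrow> (case \<tau> n of (s, d, x, L) \<Rightarrow> L)
      | \<infinity> \<Rightarrow> 0)"

definition coeff_of_variation :: "'a measure \<Rightarrow> ('a \<Rightarrow> real) \<Rightarrow> real" where
  "coeff_of_variation M Y = sqrt (prob_space.variance M Y) / prob_space.expectation M Y"

end

theory Submission
  imports Defs "HOL-Real_Asymp.Real_Asymp"
begin

text \<open>
The nominal chain and the sampler are compared through one operator: for a state
\<open>z = (s, d, x)\<close>, \<open>step \<Delta> f z\<close> is the nominal expectation of \<open>f\<close> after one transition from
\<open>z\<close>. The ruin probability from \<open>z\<close> is the limit \<open>hit \<Delta> z\<close> of the iterates of \<open>step \<Delta>\<close> on the
indicator of \<open>d > 1\<close> (\<open>hit_prob_eq_hit\<close>).

Unbiasedness: whichever region the sampler is in, multiplying the weight by the reciprocal of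
the density that was used turns the expectation of weight times \<open>f\<close> into weight times
\<open>step \<Delta> f\<close> (\<open>weighted_expectation_sampler\<close>). Along the stopped trajectory this reproduces the
iterates of \<open>step \<Delta>\<close>, hence \<open>hit\<close> (\<open>expectation_estimator\<close>).

Second moment: if \<open>h \<ge> 1\<close> after ruin and the squared weight times \<open>h\<close> is a supermartingale
under the sampler, then \<open>h\<close> at the starting point bounds the second moment
(\<open>second_moment_estimator_le\<close>). The function that defines the tilt region has this property
(\<open>second_moment_sampler_le_hfun\<close>): in the tilt region either the new jump uses up at most a
proportion \<open>B1 * rho \<Delta>\<close> of the remaining distance \<open>1 - d\<close>, and the eigenvector equation at
\<open>\<theta>s - rho \<Delta>\<close> gives the factor \<open>exp (psi (\<theta>s - rho \<Delta>)) / (1 - B1 * rho \<Delta>) powr \<dots>\<close>, or it does not,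
which by Markov's inequality with exponent \<open>2 * \<theta>s - rho \<Delta>\<close> contributes the term with \<open>b0 * b2\<close>.
With the quadratic bound for the eigenvalue, the selection condition on \<open>B1\<close> and \<open>B2\<close> says that
the two factors add up to at most 1.
So the second moment is at most a constant times \<open>(cfun \<dots> \<Delta> * \<Delta>) powr (2 * \<theta>s - rho \<Delta>)\<close>, and
\<open>\<Delta> powr (- rho \<Delta>)\<close> is the constant \<open>e\<close>.

Lower bound for the ruin probability: the function \<open>w (s, d, x) = exp (\<theta>s * s) * u \<theta>s x\<close> is
harmonic, and the associated change of measure gives \<open>s\<close> a positive drift. A renewal-type
estimate shows that the expected number of visits, weighted by \<open>w\<close>, to a band around the level
\<open>b = ln (1 / \<Delta>) + const\<close> is of the order of \<open>w\<close> at the starting point, from above for every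
start (\<open>potential_band_le\<close>) and from below for starts far below the band (\<open>potential_band_ge\<close>).
From the band, ruin occurs with probability bounded below, by irreducibility
(\<open>escapes_all\<close>). A maximum principle for potentials (\<open>potential_maximum_principle\<close>) combines the
three facts into \<open>hit \<ge> const * exp (- \<theta>s * b) = const' * \<Delta> powr \<theta>s\<close> (\<open>hit_ge_powr\<close>). If jumps
vanish almost surely, the ruin probability and the estimator are both zero.

Dividing the two estimates gives the coefficient of variation; since \<open>cfun \<dots> \<Delta>\<close> is only
polylogarithmic in \<open>1 / \<Delta>\<close>, it also gives asymptotic optimality.
\<close>

section \<open>The nominal transition operator\<close>

definition walk_space :: "(real \<times> real \<times> 's) measure" where
  "walk_space = borel \<Otimes>\<^sub>M borel \<Otimes>\<^sub>M count_space UNIV"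

lemma space_walk_space [simp]: "space walk_space = UNIV"
  by (simp add: walk_space_def space_pair_measure)

lemma measurable_walk_space_components [measurable]:
  "fst \<in> borel_measurable (walk_space :: (real \<times> real \<times> 's) measure)"
  "(\<lambda>z. fst (snd z)) \<in> borel_measurable (walk_space :: (real \<times> real \<times> 's) measure)"
  "(\<lambda>z. snd (snd z)) \<in> measurable (walk_space :: (real \<times> real \<times> 's) measure) (count_space UNIV)"
  unfolding walk_space_def by measurable

lemma measurable_walk_spaceI [measurable (raw)]:
  fixes h :: "'a \<Rightarrow> 's"
  assumes "f \<in> borel_measurable M" "g \<in> borel_measurable M" "h \<in> M \<rightarrow>\<^sub>M count_space UNIV"
  shows "(\<lambda>x. (f x, g x, h x)) \<in> M \<rightarrow>\<^sub>M walk_space"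
  unfolding walk_space_def using assms by (intro measurable_Pair)

locale nominal_kernel =
  fixes K :: "'s::finite \<Rightarrow> 's \<Rightarrow> real"
    and \<nu> :: "(real \<times> real) measure"
    and \<gamma> lam :: "'s \<Rightarrow> real \<Rightarrow> real"
  assumes prob_space_noise: "prob_space \<nu>"
    and sets_noise: "sets \<nu> = sets borel"
    and K_nonneg: "0 \<le> K x y"
    and K_stochastic: "(\<Sum>y\<in>UNIV. K x y) = 1"
    and \<gamma>_measurable: "\<gamma> x \<in> borel_measurable borel"
    and lam_measurable: "lam x \<in> borel_measurable borel"
    and lam_nonneg: "0 \<le> lam x z"
begin

sublocale noise: prob_space \<nu>
  by (rule prob_space_noise)

lemma space_noise [simp]: "space \<nu> = UNIV"
  using sets_eq_imp_space_eq[OF sets_noise] by simp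

lemma measurable_noise_components [measurable]:
  "fst \<in> borel_measurable \<nu>" "snd \<in> borel_measurable \<nu>"
  by (simp_all add: measurable_cong_sets[OF sets_noise refl] borel_prod[symmetric])

lemma measurable_increments [measurable]:
  "(\<lambda>p. \<gamma> y (fst p)) \<in> borel_measurable \<nu>" "(\<lambda>p. lam y (snd p)) \<in> borel_measurable \<nu>"
  using measurable_compose[OF measurable_noise_components(1) \<gamma>_measurable]
    measurable_compose[OF measurable_noise_components(2) lam_measurable] by auto

definition move :: "real \<Rightarrow> real \<times> real \<times> 's \<Rightarrow> 's \<Rightarrow> real \<times> real \<Rightarrow> real \<times> real \<times> 's" where
  "move \<Delta> z y p = (fst z + \<gamma> y (fst p),
     fst (snd z) + \<Delta> * lam y (snd p) * exp (fst z + \<gamma> y (fst p)), y)"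

text \<open>
Working with the operator on \<open>ennreal\<close>-valued functions avoids both integrability conditions
and a second probability space; the same operator describes the nominal chain and the
weighted sampler.
\<close>

definition step :: "real \<Rightarrow> (real \<times> real \<times> 's \<Rightarrow> ennreal) \<Rightarrow> real \<times> real \<times> 's \<Rightarrow> ennreal" where
  "step \<Delta> f z = (\<Sum>y\<in>UNIV. ennreal (K (snd (snd z)) y) * (\<integral>\<^sup>+p. f (move \<Delta> z y p) \<partial>\<nu>))"

lemma measurable_move_pair [measurable]:
  "(\<lambda>(z, p). move \<Delta> z y p) \<in> walk_space \<Otimes>\<^sub>M \<nu> \<rightarrow>\<^sub>M walk_space"
proof -
  have [measurable]: "(\<lambda>zp. \<gamma> y (fst (snd zp))) \<in> borel_measurable (walk_space \<Otimes>\<^sub>M \<nu>)"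
    "(\<lambda>zp. lam y (snd (snd zp))) \<in> borel_measurable (walk_space \<Otimes>\<^sub>M \<nu>)"
    using measurable_compose[OF measurable_snd measurable_increments(1)]
      measurable_compose[OF measurable_snd measurable_increments(2)] by auto
  have [measurable]: "(\<lambda>zp. fst (fst zp)) \<in> borel_measurable (walk_space \<Otimes>\<^sub>M \<nu>)"
    "(\<lambda>zp. fst (snd (fst zp))) \<in> borel_measurable (walk_space \<Otimes>\<^sub>M \<nu>)"
    using measurable_compose[OF measurable_fst measurable_walk_space_components(1)]
      measurable_compose[OF measurable_fst measurable_walk_space_components(2)] by auto
  show ?thesis
    unfolding move_def split_beta by measurable
qed

lemma measurable_move [measurable]: "move \<Delta> z y \<in> \<nu> \<rightarrow>\<^sub>M walk_space"
proof -
  have "(\<lambda>p. (z, p)) \<in> \<nu> \<rightarrow>\<^sub>M walk_space \<Otimes>\<^sub>M \<nu>" by (rule measurable_Pair1') simp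
  from measurable_compose[OF this measurable_move_pair] show ?thesis by simp
qed

lemma measurable_comp_move [measurable (raw)]:
  "f \<in> borel_measurable walk_space \<Longrightarrow> (\<lambda>p. f (move \<Delta> z y p)) \<in> borel_measurable \<nu>"
  using measurable_compose[OF measurable_move] .

lemma measurable_step [measurable (raw)]:
  assumes [measurable]: "f \<in> borel_measurable walk_space"
  shows "step \<Delta> f \<in> borel_measurable walk_space"
proof -
  have [measurable]: "(\<lambda>z. ennreal (K (snd (snd z)) y)) \<in> borel_measurable walk_space" for y
    by (rule measurable_compose[OF measurable_walk_space_components(3)]) simp
  have [measurable]: "(\<lambda>z. \<integral>\<^sup>+p. f (move \<Delta> z y p) \<partial>\<nu>) \<in> borel_measurable walk_space" for y
    using measurable_compose[OF measurable_move_pair assms, of \<Delta> y]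
    by (intro noise.borel_measurable_nn_integral) (simp add: split_beta)
  show ?thesis unfolding step_def[abs_def] by measurable
qed

lemma step_mono: "(\<And>y p. f (move \<Delta> z y p) \<le> g (move \<Delta> z y p)) \<Longrightarrow> step \<Delta> f z \<le> step \<Delta> g z"
  unfolding step_def by (intro sum_mono mult_left_mono nn_integral_mono) auto

lemma step_cong: "(\<And>y p. f (move \<Delta> z y p) = g (move \<Delta> z y p)) \<Longrightarrow> step \<Delta> f z = step \<Delta> g z"
  unfolding step_def by simp

lemma step_add:
  "f \<in> borel_measurable walk_space \<Longrightarrow> g \<in> borel_measurable walk_space \<Longrightarrow>
    step \<Delta> (\<lambda>z. f z + g z) z = step \<Delta> f z + step \<Delta> g z"
  unfolding step_def by (simp add: nn_integral_add distrib_left sum.distrib)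

lemma step_cmult:
  "f \<in> borel_measurable walk_space \<Longrightarrow> step \<Delta> (\<lambda>z. c * f z) z = c * step \<Delta> f z"
  unfolding step_def by (simp add: nn_integral_cmult sum_distrib_left mult.left_commute)

lemma step_const: "step \<Delta> (\<lambda>z. c) z = c"
proof -
  have "step \<Delta> (\<lambda>z. c) z = (\<Sum>y\<in>UNIV. ennreal (K (snd (snd z)) y)) * c"
    unfolding step_def by (simp add: noise.emeasure_space_1[simplified] sum_distrib_right)
  also have "(\<Sum>y\<in>UNIV. ennreal (K (snd (snd z)) y)) = ennreal (\<Sum>y\<in>UNIV. K (snd (snd z)) y)"
    by (rule sum_ennreal) (rule K_nonneg)
  finally show ?thesis by (simp add: K_stochastic)
qed

lemma step_SUP:
  assumes [measurable]: "\<And>n. f n \<in> borel_measurable walk_space" and inc: "incseq f"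
  shows "step \<Delta> (\<lambda>z. SUP n. f n z) z = (SUP n. step \<Delta> (f n) z)"
proof -
  have "(\<integral>\<^sup>+p. (SUP n. f n (move \<Delta> z y p)) \<partial>\<nu>) = (SUP n. \<integral>\<^sup>+p. f n (move \<Delta> z y p) \<partial>\<nu>)" for y
    using inc by (intro nn_integral_monotone_convergence_SUP) (auto simp: mono_def le_fun_def simp del: split_paired_All)
  then have "step \<Delta> (\<lambda>z. SUP n. f n z) z
      = (\<Sum>y\<in>UNIV. SUP n. ennreal (K (snd (snd z)) y) * (\<integral>\<^sup>+p. f n (move \<Delta> z y p) \<partial>\<nu>))"
    unfolding step_def by (simp add: SUP_mult_left_ennreal)
  also have "\<dots> = (SUP n. step \<Delta> (f n) z)"
    unfolding step_def using inc
    by (intro ennreal_SUP_sum[symmetric])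
       (auto simp: mono_def le_fun_def simp del: split_paired_All intro!: mult_left_mono nn_integral_mono)
  finally show ?thesis .
qed

lemma measurable_funpow_step [measurable (raw)]:
  "f \<in> borel_measurable walk_space \<Longrightarrow> (step \<Delta> ^^ n) f \<in> borel_measurable walk_space"
  by (induction n) auto

lemma funpow_step_mono: "(\<And>z. f z \<le> g z) \<Longrightarrow> (step \<Delta> ^^ n) f z \<le> (step \<Delta> ^^ n) g z"
proof (induction n arbitrary: z)
  case (Suc n)
  then show ?case by (simp add: step_mono del: split_paired_All)
qed simp

text \<open>
The logarithmic moment is defined by a Bochner integral and a logarithm; finiteness makes the
integral a positive number, so the exponential recovers it.
\<close>

lemma nn_integral_exp_increment:
  assumes fin: "chi_finite \<nu> \<gamma> \<theta>"
  shows "(\<integral>\<^sup>+p. ennreal (exp (\<theta> * \<gamma> y (fst p))) \<partial>\<nu>) = ennreal (exp (chi \<nu> \<gamma> y \<theta>))"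
proof -
  have int: "integrable \<nu> (\<lambda>p. exp (\<theta> * \<gamma> y (fst p)))"
    using fin unfolding chi_finite_def split_beta by blast
  have "0 < (\<integral>p. exp (\<theta> * \<gamma> y (fst p)) \<partial>\<nu>)"
    by (subst noise.integral_less_AE_space[of "\<lambda>_. 0", simplified])
      (use int in \<open>auto simp: noise.emeasure_space_1[simplified]\<close>)
  then have "exp (chi \<nu> \<gamma> y \<theta>) = (\<integral>p. exp (\<theta> * \<gamma> y (fst p)) \<partial>\<nu>)"
    unfolding chi_def split_beta by simp
  then show ?thesis by (simp add: nn_integral_eq_integral[OF int])
qed

end

section \<open>The nominal chain follows the transition operator\<close>

text \<open>
Freezing one of two independent variables. The hypothesis is the product rule for events,
because the two variables may take values in different types.
\<close>

lemma (in prob_space) nn_integral_independent: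
  assumes U [measurable]: "U \<in> M \<rightarrow>\<^sub>M S" and V [measurable]: "V \<in> M \<rightarrow>\<^sub>M T"
    and ind: "\<And>A B. A \<in> sets S \<Longrightarrow> B \<in> sets T \<Longrightarrow>
      prob (U -` A \<inter> space M \<inter> (V -` B \<inter> space M)) = prob (U -` A \<inter> space M) * prob (V -` B \<inter> space M)"
    and F [measurable]: "(\<lambda>(x, y). F x y) \<in> borel_measurable (S \<Otimes>\<^sub>M T)"
  shows "(\<integral>\<^sup>+\<omega>. F (U \<omega>) (V \<omega>) \<partial>M) = (\<integral>\<^sup>+\<omega>. (\<integral>\<^sup>+y. F (U \<omega>) y \<partial>distr M T V) \<partial>M)"
proof -
  interpret S: prob_space "distr M S U" by (rule prob_space_distr) fact
  interpret T: prob_space "distr M T V" by (rule prob_space_distr) fact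
  have eq: "distr M S U \<Otimes>\<^sub>M distr M T V = distr M (S \<Otimes>\<^sub>M T) (\<lambda>x. (U x, V x))"
  proof (rule pair_measure_eqI)
    fix A B assume "A \<in> sets (distr M S U)" "B \<in> sets (distr M T V)"
    then have [measurable]: "A \<in> sets S" "B \<in> sets T" by simp_all
    have "(\<lambda>x. (U x, V x)) -` (A \<times> B) \<inter> space M = U -` A \<inter> space M \<inter> (V -` B \<inter> space M)"
      by auto
    then show "emeasure (distr M S U) A * emeasure (distr M T V) B
        = emeasure (distr M (S \<Otimes>\<^sub>M T) (\<lambda>x. (U x, V x))) (A \<times> B)"
      using ind[of A B] by (simp add: emeasure_distr emeasure_eq_measure ennreal_mult)
  qed (simp_all add: S.sigma_finite_measure T.sigma_finite_measure)
  have [measurable]: "(\<lambda>x. \<integral>\<^sup>+y. F x y \<partial>distr M T V) \<in> borel_measurable S"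
    by (intro T.borel_measurable_nn_integral) simp
  have "(\<integral>\<^sup>+\<omega>. F (U \<omega>) (V \<omega>) \<partial>M) = (\<integral>\<^sup>+(x, y). F x y \<partial>distr M (S \<Otimes>\<^sub>M T) (\<lambda>x. (U x, V x)))"
    by (subst nn_integral_distr) simp_all
  also have "\<dots> = (\<integral>\<^sup>+x. (\<integral>\<^sup>+y. F x y \<partial>distr M T V) \<partial>distr M S U)"
    unfolding eq[symmetric] by (subst T.nn_integral_fst[symmetric]) simp_all
  also have "\<dots> = (\<integral>\<^sup>+\<omega>. (\<integral>\<^sup>+y. F (U \<omega>) y \<partial>distr M T V) \<partial>M)"
    by (subst nn_integral_distr) simp_all
  finally show ?thesis .
qed

context nominal_kernel begin

text \<open>
The chain as a deterministic function of a path of the modulating chain and of the noise: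
once the path is fixed, only the noise is random.
\<close>

primrec trajectory :: "real \<Rightarrow> (nat \<Rightarrow> 's) \<Rightarrow> (nat \<Rightarrow> real \<times> real) \<Rightarrow> nat \<Rightarrow> real \<times> real \<times> 's" where
  "trajectory \<Delta> p g 0 = (0, 0, p 0)"
| "trajectory \<Delta> p g (Suc n) = move \<Delta> (trajectory \<Delta> p g n) (p (Suc n)) (g (Suc n))"

lemma trajectory_position: "snd (snd (trajectory \<Delta> p g n)) = p n"
  by (cases n) (simp_all add: move_def)

lemma trajectory_cong:
  "(\<And>i. i \<le> n \<Longrightarrow> p i = p' i) \<Longrightarrow> (\<And>i. 1 \<le> i \<Longrightarrow> i \<le> n \<Longrightarrow> g i = g' i) \<Longrightarrow>
    trajectory \<Delta> p g n = trajectory \<Delta> p' g' n"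
  by (induction n) auto

lemma measurable_move_noise:
  "a \<in> M \<rightarrow>\<^sub>M walk_space \<Longrightarrow> b \<in> M \<rightarrow>\<^sub>M \<nu> \<Longrightarrow> (\<lambda>\<omega>. move \<Delta> (a \<omega>) y (b \<omega>)) \<in> M \<rightarrow>\<^sub>M walk_space"
  using measurable_compose[OF measurable_Pair measurable_move_pair, of a M b \<Delta> y] by simp

lemma measurable_trajectory:
  "{1..n} \<subseteq> J \<Longrightarrow> (\<lambda>g. trajectory \<Delta> p g n) \<in> (\<Pi>\<^sub>M i\<in>J. borel) \<rightarrow>\<^sub>M walk_space"
proof (induction n)
  case (Suc n)
  then have "(\<lambda>g. trajectory \<Delta> p g n) \<in> (\<Pi>\<^sub>M i\<in>J. borel) \<rightarrow>\<^sub>M walk_space"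
    by (auto simp: subset_iff)
  moreover have "(\<lambda>g. g (Suc n)) \<in> (\<Pi>\<^sub>M i\<in>J. borel) \<rightarrow>\<^sub>M \<nu>"
    using Suc.prems unfolding measurable_cong_sets[OF refl sets_noise]
    by (intro measurable_component_singleton) auto
  ultimately show ?case by (simp add: measurable_move_noise)
qed simp

end

context nominal_model begin

lemma noise_measurable: "1 \<le> n \<Longrightarrow> (\<lambda>\<omega>. (\<xi> n \<omega>, \<eta> n \<omega>)) \<in> P x \<rightarrow>\<^sub>M borel"
  using noise_indep[of x] unfolding prob_space.indep_vars_def[OF prob_space_P] by simp

lemma prob_space_\<nu>: "prob_space \<nu>"
proof -
  have "prob_space (distr (P undefined) borel (\<lambda>\<omega>. (\<xi> 1 \<omega>, \<eta> 1 \<omega>)))"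
    by (rule prob_space.prob_space_distr[OF prob_space_P noise_measurable]) simp
  then show ?thesis using noise_law[of 1 undefined] by simp
qed

lemma sets_\<nu>: "sets \<nu> = sets borel"
  using noise_law[of 1 undefined, symmetric] by simp

sublocale nominal_kernel K \<nu> \<gamma> lam
  by (rule nominal_kernel.intro)
    (rule prob_space_\<nu> sets_\<nu> K_nonneg K_stochastic \<gamma>_measurable lam_measurable lam_nonneg)+

definition chain_state :: "real \<Rightarrow> nat \<Rightarrow> 'w \<Rightarrow> real \<times> real \<times> 's" where
  "chain_state \<Delta> n \<omega> = (walk \<gamma> X \<xi> n \<omega>, perpetuity \<gamma> lam X \<xi> \<eta> \<Delta> n \<omega>, X n \<omega>)"

lemma chain_state_trajectory:
  "chain_state \<Delta> n \<omega> = trajectory \<Delta> (\<lambda>i. X i \<omega>) (\<lambda>i. (\<xi> i \<omega>, \<eta> i \<omega>)) n"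
  by (induction n) (auto simp: chain_state_def move_def prod_eq_iff)

lemma noise_sequence_measurable:
  "(\<lambda>\<omega>. \<lambda>n\<in>{1..}. (\<xi> n \<omega>, \<eta> n \<omega>)) \<in> P x \<rightarrow>\<^sub>M (\<Pi>\<^sub>M n\<in>{1..}. borel)"
  by (rule measurable_restrict) (simp add: noise_measurable)

lemma chain_sequence_measurable:
  "(\<lambda>\<omega> n. X n \<omega>) \<in> P x \<rightarrow>\<^sub>M (\<Pi>\<^sub>M n\<in>UNIV. count_space UNIV)"
  by (rule measurable_PiM_single') (auto simp: X_measurable)

text \<open>
The modulating chain takes finitely many paths up to time \<open>n\<close>, and it is independent of the
noise; conditioning on the path therefore splits an expectation into a finite sum in which the
path is deterministic.
\<close>

lemma nn_integral_path_sum: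
  fixes h :: "(nat \<Rightarrow> 's) \<Rightarrow> (nat \<Rightarrow> real \<times> real) \<Rightarrow> ennreal"
  assumes [measurable]: "\<And>p. h p \<in> borel_measurable (\<Pi>\<^sub>M i\<in>{1..}. borel)"
  shows "(\<integral>\<^sup>+\<omega>. h (\<lambda>i\<in>{..n}. X i \<omega>) (\<lambda>i\<in>{1..}. (\<xi> i \<omega>, \<eta> i \<omega>)) \<partial>P x)
    = (\<Sum>p\<in>PiE {..n} (\<lambda>_. UNIV). ennreal (if p 0 = x then \<Prod>i<n. K (p i) (p (Suc i)) else 0)
        * (\<integral>\<^sup>+\<omega>. h p (\<lambda>i\<in>{1..}. (\<xi> i \<omega>, \<eta> i \<omega>)) \<partial>P x))"
proof -
  interpret prob_space "P x" by (rule prob_space_P)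
  let ?PX = "\<Pi>\<^sub>M n\<in>(UNIV :: nat set). count_space (UNIV :: 's set)" and ?PN = "\<Pi>\<^sub>M i\<in>{1::nat..}. (borel :: (real \<times> real) measure)"
  let ?N = "\<lambda>\<omega>. \<lambda>i\<in>{1..}. (\<xi> i \<omega>, \<eta> i \<omega>)" and ?I = "PiE {..n} (\<lambda>_. UNIV :: 's set)"
  let ?A = "\<lambda>p. {q. \<forall>i\<le>n. q i = p i} :: (nat \<Rightarrow> 's) set"
  have fin: "finite ?I" by (simp add: finite_PiE)
  note noise_sequence_measurable [measurable]
  have "{q \<in> space ?PX. \<forall>i\<in>{..n}. q i = p i} \<in> sets ?PX" for p :: "nat \<Rightarrow> 's"
    by measurable
  then have A [measurable]: "?A p \<in> sets ?PX" for p by (simp add: space_PiM Ball_def)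
  have X_sets [measurable]: "{\<omega> \<in> space (P x). \<forall>i\<le>n. X i \<omega> = p i} \<in> sets (P x)" for p
  proof -
    have "{\<omega> \<in> space (P x). \<forall>i\<in>{..n}. X i \<omega> = p i} \<in> sets (P x)"
      using X_measurable by measurable
    then show ?thesis by (simp only: Ball_def atMost_iff)
  qed
  have split: "h (\<lambda>i\<in>{..n}. X i \<omega>) (?N \<omega>) = (\<Sum>p\<in>?I. indicator (?A p) (\<lambda>n. X n \<omega>) * h p (?N \<omega>))" for \<omega>
  proof -
    have "indicator (?A p) (\<lambda>n. X n \<omega>) = (if p = (\<lambda>i\<in>{..n}. X i \<omega>) then 1 else 0 :: ennreal)"
      if "p \<in> ?I" for p
      using that by (auto simp: indicator_def PiE_def extensional_def fun_eq_iff)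
    then have "(\<Sum>p\<in>?I. indicator (?A p) (\<lambda>n. X n \<omega>) * h p (?N \<omega>))
        = (\<Sum>p\<in>?I. if p = (\<lambda>i\<in>{..n}. X i \<omega>) then h p (?N \<omega>) else 0)"
      by (intro sum.cong) auto
    also have "\<dots> = h (\<lambda>i\<in>{..n}. X i \<omega>) (?N \<omega>)" using fin by (subst sum.delta) auto
    finally show ?thesis by simp
  qed
  have path_weight: "(\<integral>\<^sup>+\<omega>. indicator (?A p) (\<lambda>n. X n \<omega>) * h p (?N \<omega>) \<partial>P x)
      = ennreal (if p 0 = x then \<Prod>i<n. K (p i) (p (Suc i)) else 0) * (\<integral>\<^sup>+\<omega>. h p (?N \<omega>) \<partial>P x)" for p
  proof -
    have "(\<integral>\<^sup>+\<omega>. indicator (?A p) (\<lambda>n. X n \<omega>) * h p (?N \<omega>) \<partial>P x)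
        = (\<integral>\<^sup>+\<omega>. (\<integral>\<^sup>+g. indicator (?A p) (\<lambda>n. X n \<omega>) * h p g \<partial>distr (P x) ?PN ?N) \<partial>P x)"
    proof (rule nn_integral_independent[OF chain_sequence_measurable noise_sequence_measurable])
      fix A B assume "A \<in> sets ?PX" "B \<in> sets ?PN"
      then show "prob ((\<lambda>\<omega> n. X n \<omega>) -` A \<inter> space (P x) \<inter> (?N -` B \<inter> space (P x)))
          = prob ((\<lambda>\<omega> n. X n \<omega>) -` A \<inter> space (P x)) * prob (?N -` B \<inter> space (P x))"
        by (intro indep_setD[OF chain_noise_indep]) (auto simp: sets_vimage_algebra)
    qed measurable
    also have "\<dots> = (\<integral>\<^sup>+\<omega>. indicator {\<omega> \<in> space (P x). \<forall>i\<le>n. X i \<omega> = p i} \<omega> * (\<integral>\<^sup>+\<omega>. h p (?N \<omega>) \<partial>P x) \<partial>P x)"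
      by (intro nn_integral_cong) (simp add: nn_integral_cmult nn_integral_distr indicator_def del: One_nat_def)
    also have "\<dots> = emeasure (P x) {\<omega> \<in> space (P x). \<forall>i\<le>n. X i \<omega> = p i} * (\<integral>\<^sup>+\<omega>. h p (?N \<omega>) \<partial>P x)"
      by (subst nn_integral_multc[OF borel_measurable_indicator[OF X_sets]])
         (simp only: nn_integral_indicator[OF X_sets])
    finally show ?thesis unfolding emeasure_eq_measure markov .
  qed
  note chain_sequence_measurable [measurable]
  have "(\<integral>\<^sup>+\<omega>. h (\<lambda>i\<in>{..n}. X i \<omega>) (?N \<omega>) \<partial>P x)
      = (\<integral>\<^sup>+\<omega>. (\<Sum>p\<in>?I. indicator (?A p) (\<lambda>n. X n \<omega>) * h p (?N \<omega>)) \<partial>P x)"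
    by (simp only: split)
  also have "\<dots> = (\<Sum>p\<in>?I. \<integral>\<^sup>+\<omega>. indicator (?A p) (\<lambda>n. X n \<omega>) * h p (?N \<omega>) \<partial>P x)"
    by (rule nn_integral_sum) measurable
  finally show ?thesis by (simp only: path_weight)
qed

text \<open>
The last noise pair is independent of the earlier ones, so it can be integrated out first.
\<close>

lemma nn_integral_noise_step:
  assumes [measurable]: "f \<in> borel_measurable walk_space"
  shows "(\<integral>\<^sup>+\<omega>. f (trajectory \<Delta> p (\<lambda>i\<in>{1..}. (\<xi> i \<omega>, \<eta> i \<omega>)) (Suc n)) \<partial>P x)
    = (\<integral>\<^sup>+\<omega>. (\<integral>\<^sup>+q. f (move \<Delta> (trajectory \<Delta> p (\<lambda>i\<in>{1..}. (\<xi> i \<omega>, \<eta> i \<omega>)) n) (p (Suc n)) q) \<partial>\<nu>) \<partial>P x)"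
proof -
  interpret prob_space "P x" by (rule prob_space_P)
  let ?G = "\<lambda>i \<omega>. (\<xi> i \<omega>, \<eta> i \<omega>)"
  let ?N = "\<lambda>\<omega>. \<lambda>i\<in>{1..}. ?G i \<omega>" and ?U = "\<lambda>\<omega>. \<lambda>i\<in>{1..n}. ?G i \<omega>"
  let ?V = "\<lambda>\<omega>. \<lambda>i\<in>{Suc n}. ?G i \<omega>"
  let ?S = "\<Pi>\<^sub>M i\<in>{1..n}. (borel :: (real \<times> real) measure)"
    and ?T = "\<Pi>\<^sub>M i\<in>{Suc n}. (borel :: (real \<times> real) measure)"
  have iv: "indep_var ?S ?U ?T ?V"
    using indep_var_restrict[OF noise_indep, of "{1..n}" "{Suc n}"] by auto
  have U [measurable]: "?U \<in> P x \<rightarrow>\<^sub>M ?S" by (rule indep_var_rv1[OF iv])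
  have V [measurable]: "?V \<in> P x \<rightarrow>\<^sub>M ?T" by (rule indep_var_rv2[OF iv])
  have ind: "prob (?U -` A \<inter> space (P x) \<inter> (?V -` B \<inter> space (P x)))
      = prob (?U -` A \<inter> space (P x)) * prob (?V -` B \<inter> space (P x))"
    if "A \<in> sets ?S" "B \<in> sets ?T" for A B
  proof -
    have "?U -` A \<inter> space (P x) \<inter> (?V -` B \<inter> space (P x)) = (\<lambda>\<omega>. (?U \<omega>, ?V \<omega>)) -` (A \<times> B) \<inter> space (P x)"
      by auto
    then show ?thesis using indep_varD[OF iv that] by simp
  qed
  have last: "(\<lambda>g. g (Suc n)) \<in> ?T \<rightarrow>\<^sub>M \<nu>"
    using measurable_component_singleton[of "Suc n" "{Suc n}" "\<lambda>_. borel"]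
    by (simp add: measurable_cong_sets[OF refl sets_noise])
  have law: "distr (distr (P x) ?T ?V) \<nu> (\<lambda>g. g (Suc n)) = \<nu>"
    using noise_law[of "Suc n" x] sets_noise
    by (subst distr_distr[OF last V]) (simp add: o_def cong: distr_cong)
  have meas [measurable]: "(\<lambda>(g, v). f (move \<Delta> (trajectory \<Delta> p g n) (p (Suc n)) (v (Suc n))))
      \<in> borel_measurable (?S \<Otimes>\<^sub>M ?T)"
    unfolding split_beta
    by (rule measurable_compose[OF measurable_move_noise assms])
       (auto intro!: measurable_compose[OF measurable_fst measurable_trajectory]
         measurable_compose[OF measurable_snd last])
  have eq: "trajectory \<Delta> p (?N \<omega>) n = trajectory \<Delta> p (?U \<omega>) n" for \<omega>
    by (rule trajectory_cong) auto
  let ?F = "\<lambda>g v. f (move \<Delta> (trajectory \<Delta> p g n) (p (Suc n)) (v (Suc n)))"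
  have inner: "(\<integral>\<^sup>+v. ?F g v \<partial>distr (P x) ?T ?V) = (\<integral>\<^sup>+q. f (move \<Delta> (trajectory \<Delta> p g n) (p (Suc n)) q) \<partial>\<nu>)" for g
    by (subst law[symmetric], subst nn_integral_distr) (use last in simp_all)
  have "trajectory \<Delta> p (?N \<omega>) (Suc n) = move \<Delta> (trajectory \<Delta> p (?U \<omega>) n) (p (Suc n)) (?V \<omega> (Suc n))" for \<omega>
    unfolding trajectory.simps eq by simp
  then have "(\<integral>\<^sup>+\<omega>. f (trajectory \<Delta> p (?N \<omega>) (Suc n)) \<partial>P x) = (\<integral>\<^sup>+\<omega>. ?F (?U \<omega>) (?V \<omega>) \<partial>P x)"
    by (simp only:)
  also have "\<dots> = (\<integral>\<^sup>+\<omega>. (\<integral>\<^sup>+v. ?F (?U \<omega>) v \<partial>distr (P x) ?T ?V) \<partial>P x)"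
    by (rule nn_integral_independent[OF U V ind meas])
  finally show ?thesis unfolding inner eq .
qed

text \<open>
Both sides are expanded over paths. A path of length \<open>n + 1\<close> is a path of length \<open>n\<close> with one
more state, and its probability has exactly one more factor, the one that occurs in \<open>step\<close>.
\<close>

lemma nn_integral_chain_state_Suc:
  assumes [measurable]: "f \<in> borel_measurable walk_space"
  shows "(\<integral>\<^sup>+\<omega>. f (chain_state \<Delta> (Suc n) \<omega>) \<partial>P x) = (\<integral>\<^sup>+\<omega>. step \<Delta> f (chain_state \<Delta> n \<omega>) \<partial>P x)"
proof -
  let ?N = "\<lambda>\<omega>. \<lambda>i\<in>{1..}. (\<xi> i \<omega>, \<eta> i \<omega>)"
  let ?I = "\<lambda>n. PiE {..n} (\<lambda>_. UNIV :: 's set)"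
  define w where "w n p = ennreal (if p 0 = x then \<Prod>i<n. K (p i) (p (Suc i)) else 0)" for n p
  define H where "H p y = (\<integral>\<^sup>+\<omega>. (\<integral>\<^sup>+q. f (move \<Delta> (trajectory \<Delta> p (?N \<omega>) n) y q) \<partial>\<nu>) \<partial>P x)" for p y
  have traj: "chain_state \<Delta> m \<omega> = trajectory \<Delta> (\<lambda>i\<in>{..m}. X i \<omega>) (?N \<omega>) m" for m \<omega>
    unfolding chain_state_trajectory by (rule trajectory_cong) auto
  have meas_traj [measurable]: "(\<lambda>g. trajectory \<Delta> p g m) \<in> (\<Pi>\<^sub>M i\<in>{1..}. borel) \<rightarrow>\<^sub>M walk_space" for p m
    by (rule measurable_trajectory) auto
  have N [measurable]: "?N \<in> P x \<rightarrow>\<^sub>M (\<Pi>\<^sub>M i\<in>{1..}. borel)"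
    by (rule measurable_restrict) (simp add: noise_measurable)
  have inner: "(\<lambda>z. \<integral>\<^sup>+q. f (move \<Delta> z y q) \<partial>\<nu>) \<in> borel_measurable walk_space" for y
    using measurable_compose[OF measurable_move_pair assms, of \<Delta> y]
    by (intro noise.borel_measurable_nn_integral) (simp add: split_beta)
  have meas_inner [measurable]: "(\<lambda>\<omega>. \<integral>\<^sup>+q. f (move \<Delta> (trajectory \<Delta> p (?N \<omega>) n) y q) \<partial>\<nu>) \<in> borel_measurable (P x)"
    for p y
    using measurable_compose[OF measurable_compose[OF N meas_traj] inner] .
  have "(\<integral>\<^sup>+\<omega>. f (chain_state \<Delta> (Suc n) \<omega>) \<partial>P x)
      = (\<Sum>p\<in>?I (Suc n). w (Suc n) p * (\<integral>\<^sup>+\<omega>. f (trajectory \<Delta> p (?N \<omega>) (Suc n)) \<partial>P x))"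
    unfolding traj w_def by (rule nn_integral_path_sum) measurable
  also have "\<dots> = (\<Sum>p\<in>?I (Suc n). w (Suc n) p * H p (p (Suc n)))"
    unfolding H_def by (intro sum.cong refl arg_cong2[where f="(*)"] nn_integral_noise_step) simp
  also have "\<dots> = (\<Sum>(y, p)\<in>UNIV \<times> ?I n. w (Suc n) (p(Suc n := y)) * H (p(Suc n := y)) y)"
  proof -
    have "?I (Suc n) = (\<lambda>(y, p). p(Suc n := y)) ` (UNIV \<times> ?I n)"
      unfolding atMost_Suc by (rule PiE_insert_eq)
    moreover have "inj_on (\<lambda>(y, p). p(Suc n := y)) (UNIV \<times> ?I n)"
      by (rule inj_combinator) simp
    ultimately show ?thesis by (simp add: sum.reindex case_prod_unfold)
  qed
  also have "\<dots> = (\<Sum>(y, p)\<in>UNIV \<times> ?I n. w n p * (ennreal (K (p n) y) * H p y))"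
  proof (rule sum.cong, simp, safe)
    fix y p
    have "trajectory \<Delta> (p(Suc n := y)) g n = trajectory \<Delta> p g n" for g
      by (rule trajectory_cong) auto
    then have "H (p(Suc n := y)) y = H p y" unfolding H_def by simp
    moreover have "(\<Prod>i<n. K ((p(Suc n := y)) i) ((p(Suc n := y)) (Suc i))) = (\<Prod>i<n. K (p i) (p (Suc i)))"
      by (rule prod.cong) auto
    then have "w (Suc n) (p(Suc n := y)) = w n p * ennreal (K (p n) y)"
      unfolding w_def by (simp add: ennreal_mult K_nonneg prod_nonneg)
    ultimately show "w (Suc n) (p(Suc n := y)) * H (p(Suc n := y)) y = w n p * (ennreal (K (p n) y) * H p y)"
      by (simp add: mult.assoc)
  qed
  also have "\<dots> = (\<Sum>p\<in>?I n. w n p * (\<Sum>y\<in>UNIV. ennreal (K (p n) y) * H p y))"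
    by (subst sum.cartesian_product[symmetric], subst sum.swap) (simp add: sum_distrib_left)
  also have "\<dots> = (\<Sum>p\<in>?I n. w n p * (\<integral>\<^sup>+\<omega>. step \<Delta> f (trajectory \<Delta> p (?N \<omega>) n) \<partial>P x))"
  proof -
    have "(\<integral>\<^sup>+\<omega>. step \<Delta> f (trajectory \<Delta> p (?N \<omega>) n) \<partial>P x) = (\<Sum>y\<in>UNIV. ennreal (K (p n) y) * H p y)" for p
      unfolding step_def trajectory_position H_def
      by (subst nn_integral_sum) (simp_all add: nn_integral_cmult del: One_nat_def)
    then show ?thesis by simp
  qed
  also have "\<dots> = (\<integral>\<^sup>+\<omega>. step \<Delta> f (chain_state \<Delta> n \<omega>) \<partial>P x)"
    unfolding traj w_def
    by (rule nn_integral_path_sum[symmetric]) (rule measurable_compose[OF meas_traj measurable_step[OF assms]])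
  finally show ?thesis .
qed

lemma AE_initial_state: "AE \<omega> in P x. X 0 \<omega> = x"
proof -
  interpret prob_space "P x" by (rule prob_space_P)
  have "{\<omega> \<in> space (P x). X 0 \<omega> = x} \<in> events" using X_measurable by measurable
  then show ?thesis using markov[of x 0 "\<lambda>_. x"]
    by (subst prob_Collect_eq_1[symmetric]) auto
qed

theorem nn_integral_chain_state:
  assumes [measurable]: "f \<in> borel_measurable walk_space"
  shows "(\<integral>\<^sup>+\<omega>. f (chain_state \<Delta> n \<omega>) \<partial>P x) = (step \<Delta> ^^ n) f (0, 0, x)"
  using assms
proof (induction n arbitrary: f)
  case 0
  interpret prob_space "P x" by (rule prob_space_P)
  have "(\<integral>\<^sup>+\<omega>. f (chain_state \<Delta> 0 \<omega>) \<partial>P x) = (\<integral>\<^sup>+\<omega>. f (0, 0, x) \<partial>P x)"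
    using AE_initial_state[of x] by (intro nn_integral_cong_AE) (auto simp: chain_state_def)
  then show ?case by (simp add: emeasure_space_1)
next
  case (Suc n)
  then show ?case
    by (simp add: nn_integral_chain_state_Suc measurable_step funpow_Suc_right del: funpow.simps)
qed

end

section \<open>Trajectory laws of Markov kernels\<close>

context
  fixes M :: "'a measure" and \<kappa> :: "'a \<Rightarrow> 'a measure" and q :: 'a
  assumes \<kappa>: "\<kappa> \<in> M \<rightarrow>\<^sub>M prob_algebra M" and q: "q \<in> space M"
begin

interpretation IT: Ionescu_Tulcea "chain_step M \<kappa> q" "\<lambda>_. M"
  by (rule Ionescu_Tulcea_chain_step[OF \<kappa> q])

lemma sets_chain_law: "sets (chain_law M \<kappa> q) = sets (\<Pi>\<^sub>M i\<in>UNIV. M)"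
  unfolding chain_law_def by simp

lemma prob_space_chain_law: "prob_space (chain_law M \<kappa> q)"
proof (rule prob_space_distrD)
  show "(\<lambda>\<omega>. restrict \<omega> {}) \<in> chain_law M \<kappa> q \<rightarrow>\<^sub>M (\<Pi>\<^sub>M i\<in>{}. M)"
    unfolding measurable_cong_sets[OF sets_chain_law refl] by (rule measurable_restrict_subset) simp
  show "prob_space (distr (chain_law M \<kappa> q) (\<Pi>\<^sub>M i\<in>{}. M) (\<lambda>\<omega>. restrict \<omega> {}))"
    using IT.distr_lim[of "{}"] IT.PF.prob_space_P[of "{}"] unfolding chain_law_def by simp
qed

lemma measurable_chain_law_component: "(\<lambda>\<omega>. \<omega> n) \<in> chain_law M \<kappa> q \<rightarrow>\<^sub>M M"
  unfolding measurable_cong_sets[OF sets_chain_law refl] by (rule measurable_component_singleton) simp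

text \<open>
The trajectory law is a projective limit; on functions of finitely many coordinates it agrees
with the finite compositions of kernels from which it was built.
\<close>

lemma nn_integral_chain_law_past:
  assumes G [measurable]: "G \<in> borel_measurable (\<Pi>\<^sub>M i\<in>{0..<n}. M)"
  shows "(\<integral>\<^sup>+\<omega>. G (restrict \<omega> {0..<n}) \<partial>chain_law M \<kappa> q) = (\<integral>\<^sup>+\<omega>. G \<omega> \<partial>IT.C 0 n (\<lambda>_. undefined))"
proof -
  have und: "(\<lambda>_. undefined) \<in> space (\<Pi>\<^sub>M i\<in>{0..<0::nat}. M)" by simp
  have "IT.CI {0..<n} = IT.C 0 n (\<lambda>_. undefined)"
  proof (rule measure_eqI)
    show "sets (IT.CI {0..<n}) = sets (IT.C 0 n (\<lambda>_. undefined))"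
      using IT.sets_C[OF und, of n] by (simp add: IT.CI_def)
    fix A assume "A \<in> sets (IT.CI {0..<n})"
    then have A: "A \<in> sets (\<Pi>\<^sub>M i\<in>{0..<n}. M)" by (simp add: IT.CI_def)
    show "emeasure (IT.CI {0..<n}) A = emeasure (IT.C 0 n (\<lambda>_. undefined)) A"
      using IT.emeasure_CI[OF order_refl A] A prod_emb_id[of A "{0..<n}" "\<lambda>_. M"] sets.sets_into_space[OF A] by (simp add: space_PiM)
  qed
  then have *: "distr (chain_law M \<kappa> q) (\<Pi>\<^sub>M i\<in>{0..<n}. M) (\<lambda>\<omega>. restrict \<omega> {0..<n}) = IT.C 0 n (\<lambda>_. undefined)"
    using IT.distr_lim[of "{0..<n}"] unfolding chain_law_def by simp
  have "(\<lambda>\<omega>. restrict \<omega> {0..<n}) \<in> chain_law M \<kappa> q \<rightarrow>\<^sub>M (\<Pi>\<^sub>M i\<in>{0..<n}. M)"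
    unfolding measurable_cong_sets[OF sets_chain_law refl] by (rule measurable_restrict_subset) simp
  from nn_integral_distr[OF this, of G] show ?thesis using G by (simp add: *[symmetric])
qed

lemma nn_integral_chain_law_initial:
  assumes [measurable]: "f \<in> borel_measurable M"
  shows "(\<integral>\<^sup>+\<omega>. f (\<omega> 0) \<partial>chain_law M \<kappa> q) = f q"
proof -
  have und: "(\<lambda>_. undefined) \<in> space (\<Pi>\<^sub>M i\<in>{0..<0::nat}. M)" by simp
  have [measurable]: "(\<lambda>\<omega>. f (\<omega> 0)) \<in> borel_measurable (\<Pi>\<^sub>M i\<in>{0..<Suc 0}. M)"
    by (rule measurable_compose[OF _ assms], rule measurable_component_singleton) simp
  have "(\<integral>\<^sup>+\<omega>. f (\<omega> 0) \<partial>chain_law M \<kappa> q) = (\<integral>\<^sup>+\<omega>. f (\<omega> 0) \<partial>IT.C 0 (Suc 0) (\<lambda>_. undefined))"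
    using nn_integral_chain_law_past[of "\<lambda>\<omega>. f (\<omega> 0)" "Suc 0"] by simp
  also have "IT.C 0 (Suc 0) (\<lambda>_. undefined) = IT.eP 0 (\<lambda>_. undefined)"
    using bind_return[OF IT.measurable_eP[of 0] und] by simp
  also have "(\<integral>\<^sup>+\<omega>. f (\<omega> 0) \<partial>IT.eP 0 (\<lambda>_. undefined)) = f q"
    using q by (subst IT.nn_integral_eP[OF und]) (simp_all add: chain_step_def nn_integral_return)
  finally show ?thesis .
qed

text \<open>
The Markov property: given the past, the next state has the law prescribed by the kernel. The
condition \<open>past\<close> says that \<open>G\<close> depends on the coordinates up to \<open>n\<close> only, so \<open>G\<close> can be
evaluated at the whole trajectory.
\<close>

lemma nn_integral_chain_law_step:
  assumes G [measurable]: "G \<in> borel_measurable (\<Pi>\<^sub>M i\<in>{0..<Suc n}. M)"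
    and past: "\<And>\<omega>. G (restrict \<omega> {0..<Suc n}) = G \<omega>"
    and f [measurable]: "f \<in> borel_measurable M"
  shows "(\<integral>\<^sup>+\<omega>. G \<omega> * f (\<omega> (Suc n)) \<partial>chain_law M \<kappa> q)
    = (\<integral>\<^sup>+\<omega>. G \<omega> * (\<integral>\<^sup>+z. f z \<partial>\<kappa> (\<omega> n)) \<partial>chain_law M \<kappa> q)"
proof -
  let ?C = "\<lambda>n. IT.C 0 n (\<lambda>_. undefined)" and ?PI = "\<lambda>n. \<Pi>\<^sub>M i\<in>{0..<n}. M"
  have und: "(\<lambda>_. undefined) \<in> space (?PI (0::nat))" by simp
  have \<kappa>' [measurable]: "\<kappa> \<in> M \<rightarrow>\<^sub>M subprob_algebra M" using \<kappa> by (rule measurable_prob_algebraD)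
  have restr [measurable]: "(\<lambda>\<omega>. restrict \<omega> {0..<Suc n}) \<in> ?PI (Suc (Suc n)) \<rightarrow>\<^sub>M ?PI (Suc n)"
    by (rule measurable_restrict_subset) simp
  have G' [measurable]: "G \<in> borel_measurable (?PI (Suc (Suc n)))"
    using measurable_compose[OF restr G] by (simp only: past)
  have last [measurable]: "(\<lambda>\<omega>. \<omega> (Suc n)) \<in> ?PI (Suc (Suc n)) \<rightarrow>\<^sub>M M"
    "(\<lambda>\<omega>. \<omega> n) \<in> ?PI (Suc n) \<rightarrow>\<^sub>M M"
    by (rule measurable_component_singleton, simp)+
  have F [measurable]: "(\<lambda>\<omega>. G \<omega> * f (\<omega> (Suc n))) \<in> borel_measurable (?PI (Suc (Suc n)))"
    by measurable
  have E [measurable]: "(\<lambda>z. \<integral>\<^sup>+z. f z \<partial>\<kappa> z) \<in> borel_measurable M"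
    by (rule measurable_compose[OF \<kappa>' nn_integral_measurable_subprob_algebra[OF f]])
  have H: "(\<lambda>\<omega>. G \<omega> * (\<integral>\<^sup>+z. f z \<partial>\<kappa> (\<omega> n))) \<in> borel_measurable (?PI (Suc n))"
    using measurable_compose[OF last(2) E] by simp
  have past': "G \<omega>' = G \<omega>" if "\<And>i. i \<le> n \<Longrightarrow> \<omega>' i = \<omega> i" for \<omega> \<omega>'
  proof -
    have "restrict \<omega>' {0..<Suc n} = restrict \<omega> {0..<Suc n}" using that by (auto simp: restrict_def)
    then show ?thesis by (metis past)
  qed
  have "(\<integral>\<^sup>+\<omega>. G \<omega> * f (\<omega> (Suc n)) \<partial>chain_law M \<kappa> q) = (\<integral>\<^sup>+\<omega>. G \<omega> * f (\<omega> (Suc n)) \<partial>?C (Suc (Suc n)))"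
  proof -
    have "G (restrict \<omega> {0..<Suc (Suc n)}) = G \<omega>" for \<omega> by (rule past') simp
    then show ?thesis using nn_integral_chain_law_past[OF F] by simp
  qed
  also have "\<dots> = (\<integral>\<^sup>+\<omega>. (\<integral>\<^sup>+\<omega>'. G \<omega>' * f (\<omega>' (Suc n)) \<partial>IT.eP (Suc n) \<omega>) \<partial>?C (Suc n))"
  proof -
    have "IT.eP (Suc n) \<in> ?C (Suc n) \<rightarrow>\<^sub>M subprob_algebra (?PI (Suc (Suc n)))"
      using IT.measurable_eP[of "Suc n"] IT.sets_C[OF und, of "Suc n"] by (simp cong: measurable_cong_sets)
    then show ?thesis
      using IT.C.simps(2)[of 0 "Suc n" "\<lambda>_. undefined"] by (simp add: nn_integral_bind[OF F] del: IT.C.simps)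
  qed
  also have "\<dots> = (\<integral>\<^sup>+\<omega>. G \<omega> * (\<integral>\<^sup>+z. f z \<partial>\<kappa> (\<omega> n)) \<partial>?C (Suc n))"
  proof (rule nn_integral_cong)
    fix \<omega> assume "\<omega> \<in> space (?C (Suc n))"
    then have \<omega>: "\<omega> \<in> space (?PI (Suc n))" using IT.space_C[OF und, of "Suc n"] by simp
    have "\<omega> n \<in> space M" using measurable_space[OF last(2) \<omega>] .
    then have sets: "sets (\<kappa> (\<omega> n)) = sets M" by (rule subprob_measurableD(2)[OF \<kappa>'])
    have "(\<integral>\<^sup>+\<omega>'. G \<omega>' * f (\<omega>' (Suc n)) \<partial>IT.eP (Suc n) \<omega>)
        = (\<integral>\<^sup>+z. G (fun_upd \<omega> (Suc n) z) * f z \<partial>\<kappa> (\<omega> n))"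
      by (subst IT.nn_integral_eP[OF \<omega> F]) (simp add: chain_step_def)
    also have "\<dots> = (\<integral>\<^sup>+z. G \<omega> * f z \<partial>\<kappa> (\<omega> n))"
      by (intro nn_integral_cong arg_cong2[where f="(*)"] past') auto
    also have "\<dots> = G \<omega> * (\<integral>\<^sup>+z. f z \<partial>\<kappa> (\<omega> n))"
      using sets by (intro nn_integral_cmult) (simp cong: measurable_cong_sets)
    finally show "(\<integral>\<^sup>+\<omega>'. G \<omega>' * f (\<omega>' (Suc n)) \<partial>IT.eP (Suc n) \<omega>) = G \<omega> * (\<integral>\<^sup>+z. f z \<partial>\<kappa> (\<omega> n))" .
  qed
  also have "\<dots> = (\<integral>\<^sup>+\<omega>. G \<omega> * (\<integral>\<^sup>+z. f z \<partial>\<kappa> (\<omega> n)) \<partial>chain_law M \<kappa> q)"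
    using nn_integral_chain_law_past[OF H] past by simp
  finally show ?thesis .
qed

end

section \<open>One transition of the sampler\<close>

lemma space_state_space [simp]: "space (state_space :: 's alg_state measure) = UNIV"
  by (simp add: state_space_def space_pair_measure)

lemma measurable_state_space_components [measurable]:
  "fst \<in> borel_measurable (state_space :: 's alg_state measure)"
  "(\<lambda>q. fst (snd q)) \<in> borel_measurable (state_space :: 's alg_state measure)"
  "(\<lambda>q. fst (snd (snd q))) \<in> (state_space :: 's alg_state measure) \<rightarrow>\<^sub>M count_space UNIV"
  "(\<lambda>q. snd (snd (snd q))) \<in> borel_measurable (state_space :: 's alg_state measure)"
  unfolding state_space_def by measurable

lemma measurable_state_spaceI:
  fixes h :: "'a \<Rightarrow> 's"
  assumes "f \<in> borel_measurable M" "g \<in> borel_measurable M" "h \<in> M \<rightarrow>\<^sub>M count_space UNIV" "l \<in> borel_measurable M"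
  shows "(\<lambda>x. (f x, g x, h x, l x)) \<in> M \<rightarrow>\<^sub>M state_space"
  unfolding state_space_def using assms by (intro measurable_Pair)

definition walk_part :: "'s alg_state \<Rightarrow> real \<times> real \<times> 's" where
  "walk_part q = (fst q, fst (snd q), fst (snd (snd q)))"

definition weight :: "'s alg_state \<Rightarrow> real" where
  "weight q = snd (snd (snd q))"

lemma measurable_walk_part [measurable]: "walk_part \<in> state_space \<rightarrow>\<^sub>M walk_space"
  unfolding walk_part_def[abs_def] by measurable

lemma measurable_weight [measurable]: "weight \<in> borel_measurable state_space"
  unfolding weight_def[abs_def] by measurable

locale tilted_sampler = nominal_kernel K \<nu> \<gamma> lam
  for K :: "'s::finite \<Rightarrow> 's \<Rightarrow> real" and \<nu> \<gamma> lam +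
  fixes W :: "'s \<Rightarrow> real \<Rightarrow> real measure"
    and u :: "real \<Rightarrow> 's \<Rightarrow> real"
    and \<theta>s :: real
  assumes cond_law: "regular_cond_law \<nu> \<gamma> lam W"
    and chi_finite_\<theta>s: "chi_finite \<nu> \<gamma> \<theta>s"
    and psi_\<theta>s: "psi_real K \<nu> \<gamma> \<theta>s = 0"
    and u_\<theta>s_pos: "0 < u \<theta>s x"
    and eigenvector_\<theta>s: "(\<Sum>y\<in>UNIV. Qmat K \<nu> \<gamma> \<theta>s x y * u \<theta>s y) = u \<theta>s x"
begin

lemma nn_integral_incr_law:
  assumes [measurable]: "f \<in> borel_measurable borel"
  shows "(\<integral>\<^sup>+z. f z \<partial>incr_law \<nu> \<gamma> y) = (\<integral>\<^sup>+p. f (\<gamma> y (fst p)) \<partial>\<nu>)"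
  unfolding incr_law_def split_beta by (subst nn_integral_distr) simp_all

lemma measurable_joint_pair: "(\<lambda>p. (\<gamma> y (fst p), lam y (snd p))) \<in> \<nu> \<rightarrow>\<^sub>M borel"
  unfolding borel_prod[symmetric] by measurable

lemma nn_integral_joint_law:
  assumes [measurable]: "f \<in> borel_measurable borel"
  shows "(\<integral>\<^sup>+q. f q \<partial>joint_law \<nu> \<gamma> lam y) = (\<integral>\<^sup>+p. f (\<gamma> y (fst p), lam y (snd p)) \<partial>\<nu>)"
  unfolding joint_law_def split_beta using measurable_joint_pair by (subst nn_integral_distr) simp_all

lemma measurable_W: "W y \<in> borel \<rightarrow>\<^sub>M prob_algebra borel"
  using cond_law unfolding regular_cond_law_def by blast

lemma sets_W: "sets (W y z) = sets borel"
  using measurable_space[OF measurable_W, of z y] by (simp add: space_prob_algebra)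

lemma measurable_nn_integral_W:
  assumes H: "H \<in> borel_measurable (borel \<Otimes>\<^sub>M borel)"
  shows "(\<lambda>z. \<integral>\<^sup>+w. H (z, w) \<partial>W y z) \<in> borel_measurable borel"
  using H measurable_prob_algebraD[OF measurable_W]
  by (intro nn_integral_measurable_subprob_algebra2[where N=borel]) (simp_all add: split_beta)

text \<open>
Drawing the increment from its marginal and then the jump from the conditional law reproduces
the joint nominal law.
\<close>

lemma nn_integral_cond_law:
  assumes H: "H \<in> borel_measurable (borel \<Otimes>\<^sub>M borel)"
  shows "(\<integral>\<^sup>+z. (\<integral>\<^sup>+w. H (z, w) \<partial>W y z) \<partial>incr_law \<nu> \<gamma> y) = (\<integral>\<^sup>+p. H (\<gamma> y (fst p), lam y (snd p)) \<partial>\<nu>)"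
proof -
  have H' [measurable]: "H \<in> borel_measurable borel" using H by (simp add: borel_prod)
  have W' [measurable]: "W y \<in> borel \<rightarrow>\<^sub>M subprob_algebra borel"
    by (rule measurable_prob_algebraD[OF measurable_W])
  have ret: "(\<lambda>w :: real. return borel (z, w)) \<in> borel \<rightarrow>\<^sub>M subprob_algebra borel" for z :: real
    using measurable_Pair1'[of z "borel :: real measure" "borel :: real measure"]
    by (intro measurable_compose[OF _ return_measurable]) (simp add: borel_prod)
  have inner: "(\<integral>\<^sup>+q. H q \<partial>(W y z \<bind> (\<lambda>w. return borel (z, w)))) = (\<integral>\<^sup>+w. H (z, w) \<partial>W y z)" for z
    using ret[of z] sets_W[of y z] by (subst nn_integral_bind[OF H']) (simp_all add: nn_integral_return cong: measurable_cong_sets)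
  have "(\<lambda>(z, w). return borel (z, w)) \<in> borel \<Otimes>\<^sub>M borel \<rightarrow>\<^sub>M subprob_algebra (borel :: (real \<times> real) measure)"
    by (simp add: borel_prod)
  then have outer: "(\<lambda>z. W y z \<bind> (\<lambda>w. return borel (z, w))) \<in> borel \<rightarrow>\<^sub>M subprob_algebra borel"
    by (intro measurable_bind[OF W']) (simp add: split_beta)
  have "(\<integral>\<^sup>+p. H (\<gamma> y (fst p), lam y (snd p)) \<partial>\<nu>) = (\<integral>\<^sup>+q. H q \<partial>joint_law \<nu> \<gamma> lam y)"
    by (rule nn_integral_joint_law[symmetric]) simp
  also have "joint_law \<nu> \<gamma> lam y = incr_law \<nu> \<gamma> y \<bind> (\<lambda>z. W y z \<bind> (\<lambda>w. return borel (z, w)))"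
    using cond_law unfolding regular_cond_law_def by blast
  also have "(\<integral>\<^sup>+q. H q \<partial>\<dots>) = (\<integral>\<^sup>+z. (\<integral>\<^sup>+w. H (z, w) \<partial>W y z) \<partial>incr_law \<nu> \<gamma> y)"
    using outer by (subst nn_integral_bind[OF H']) (simp_all add: inner incr_law_def cong: measurable_cong_sets)
  finally show ?thesis by simp
qed

end

lemma measurable_hfun: "hfun u \<theta>s B1 B2 \<Delta> \<in> borel_measurable (walk_space :: (real \<times> real \<times> 's::finite) measure)"
proof -
  have [measurable]: "(\<lambda>z. u t (snd (snd z))) \<in> borel_measurable (walk_space :: (real \<times> real \<times> 's) measure)" for t
    by (rule measurable_compose[OF measurable_walk_space_components(3)]) simp
  show ?thesis unfolding hfun_def split_beta by measurable
qed

lemma sets_tilt_region: "tilt_region u \<theta>s B1 B2 \<Delta> \<in> sets (walk_space :: (real \<times> real \<times> 's::finite) measure)"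
proof -
  note measurable_hfun [measurable]
  have "{q \<in> space walk_space. hfun u \<theta>s B1 B2 \<Delta> q < 1} \<in> sets (walk_space :: (real \<times> real \<times> 's) measure)"
    by measurable
  then show ?thesis by (simp add: tilt_region_def)
qed

context tilted_sampler begin

text \<open>
The density of one tilted transition relative to the nominal one; the weight is divided by it.
\<close>

definition tilt :: "'s \<Rightarrow> 's \<Rightarrow> real \<Rightarrow> real" where
  "tilt x y z = exp (\<theta>s * z) * u \<theta>s y / u \<theta>s x"

lemma tilt_pos: "0 < tilt x y z"
  unfolding tilt_def using u_\<theta>s_pos by simp

lemma sets_tilted_incr_law: "sets (tilted_incr_law \<nu> \<gamma> \<theta>s y) = sets borel"
  by (simp add: tilted_incr_law_def incr_law_def)

lemma nn_integral_tilted_incr_law: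
  assumes [measurable]: "f \<in> borel_measurable borel"
  shows "(\<integral>\<^sup>+z. f z \<partial>tilted_incr_law \<nu> \<gamma> \<theta>s y)
    = (\<integral>\<^sup>+z. ennreal (exp (\<theta>s * z - chi \<nu> \<gamma> y \<theta>s)) * f z \<partial>incr_law \<nu> \<gamma> y)"
  unfolding tilted_incr_law_def incr_law_def by (subst nn_integral_density) simp_all

text \<open>
Exponential tilting is normalised by the moment generating function at \<open>\<theta>s\<close>.
\<close>

lemma prob_space_tilted_incr_law: "prob_space (tilted_incr_law \<nu> \<gamma> \<theta>s y)"
proof (rule prob_spaceI)
  have "emeasure (tilted_incr_law \<nu> \<gamma> \<theta>s y) (space (tilted_incr_law \<nu> \<gamma> \<theta>s y))
      = (\<integral>\<^sup>+z. 1 \<partial>tilted_incr_law \<nu> \<gamma> \<theta>s y)" by simp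
  also have "\<dots> = (\<integral>\<^sup>+p. ennreal (exp (\<theta>s * \<gamma> y (fst p) - chi \<nu> \<gamma> y \<theta>s)) \<partial>\<nu>)"
    by (subst nn_integral_tilted_incr_law) (simp_all add: nn_integral_incr_law)
  also have "\<dots> = (\<integral>\<^sup>+p. ennreal (exp (- chi \<nu> \<gamma> y \<theta>s)) * ennreal (exp (\<theta>s * \<gamma> y (fst p))) \<partial>\<nu>)"
    by (simp add: ennreal_mult[symmetric] exp_diff exp_minus field_simps)
  also have "\<dots> = ennreal (exp (- chi \<nu> \<gamma> y \<theta>s)) * ennreal (exp (chi \<nu> \<gamma> y \<theta>s))"
    by (subst nn_integral_cmult) (simp_all add: nn_integral_exp_increment[OF chi_finite_\<theta>s])
  also have "\<dots> = 1" by (simp add: ennreal_mult[symmetric] exp_minus)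
  finally show "emeasure (tilted_incr_law \<nu> \<gamma> \<theta>s y) (space (tilted_incr_law \<nu> \<gamma> \<theta>s y)) = 1" .
qed

lemma tilted_K_eq: "tilted_K K \<nu> \<gamma> u \<theta>s x y = K x y * exp (chi \<nu> \<gamma> y \<theta>s) * u \<theta>s y / u \<theta>s x"
  unfolding tilted_K_def psi_\<theta>s by simp

lemma tilted_K_nonneg: "0 \<le> tilted_K K \<nu> \<gamma> u \<theta>s x y"
  unfolding tilted_K_eq using K_nonneg u_\<theta>s_pos by (simp add: less_imp_le)

text \<open>
This is the eigenvector equation at \<open>\<theta>s\<close>, where the eigenvalue is 1.
\<close>

lemma tilted_K_stochastic: "(\<Sum>y\<in>UNIV. tilted_K K \<nu> \<gamma> u \<theta>s x y) = 1"
  using eigenvector_\<theta>s[of x] u_\<theta>s_pos[of x] unfolding tilted_K_eq Qmat_def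
  by (simp add: sum_divide_distrib[symmetric])

lemma prob_space_point_measure_stochastic:
  fixes k :: "'s \<Rightarrow> real"
  assumes "\<And>y. 0 \<le> k y" "(\<Sum>y\<in>UNIV. k y) = 1"
  shows "point_measure UNIV (\<lambda>y. ennreal (k y)) \<in> space (prob_algebra (count_space UNIV))"
  unfolding space_prob_algebra using assms
  by (auto simp: sets_point_measure sum_ennreal intro!: prob_space_point_measure)

abbreviation sampler_kernel :: "real \<Rightarrow> real \<Rightarrow> real \<Rightarrow> 's alg_state \<Rightarrow> 's alg_state measure" where
  "sampler_kernel B1 B2 \<Delta> \<equiv> alg_kernel K \<nu> \<gamma> lam W u \<theta>s B1 B2 \<Delta>"

lemma measurable_finite_state:
  fixes g :: "'a \<Rightarrow> 's"
  assumes "\<And>y. f y \<in> M \<rightarrow>\<^sub>M N" "g \<in> M \<rightarrow>\<^sub>M count_space UNIV"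
  shows "(\<lambda>x. f (g x) x) \<in> M \<rightarrow>\<^sub>M N"
  using measurable_compose_countable[of f M N g] assms by simp

lemma sets_joint_law: "joint_law \<nu> \<gamma> lam y \<in> space (prob_algebra (borel \<Otimes>\<^sub>M borel))"
  unfolding space_prob_algebra borel_prod
  using noise.prob_space_distr[OF measurable_joint_pair[of y]]
  by (simp add: joint_law_def case_prod_unfold)

lemma measurable_sampler_kernel:
  "sampler_kernel B1 B2 \<Delta> \<in> state_space \<rightarrow>\<^sub>M prob_algebra state_space"
proof -
  let ?S = "state_space :: 's alg_state measure"
  let ?x = "\<lambda>q :: 's alg_state. fst (snd (snd q))"
  define tilted where "tilted q = point_measure UNIV (\<lambda>y. ennreal (tilted_K K \<nu> \<gamma> u \<theta>s (?x q) y)) \<bind> (\<lambda>y.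
       tilted_incr_law \<nu> \<gamma> \<theta>s y \<bind> (\<lambda>z.
       W y z \<bind> (\<lambda>w.
       return ?S (fst q + z, fst (snd q) + \<Delta> * w * exp (fst q + z), y,
         weight q * (exp (- \<theta>s * z) * u \<theta>s (?x q) / u \<theta>s y)))))" for q
  define nominal where "nominal q = point_measure UNIV (\<lambda>y. ennreal (K (?x q) y)) \<bind> (\<lambda>y.
       joint_law \<nu> \<gamma> lam y \<bind> (\<lambda>p.
       return ?S (fst q + fst p, fst (snd q) + \<Delta> * snd p * exp (fst q + fst p), y, weight q)))" for q
  have ret [measurable]: "return ?S \<in> ?S \<rightarrow>\<^sub>M prob_algebra ?S" by (rule measurable_return_prob_space)
  have u [measurable (raw)]: "f \<in> M \<rightarrow>\<^sub>M count_space UNIV \<Longrightarrow> (\<lambda>a. u \<theta>s (f a)) \<in> borel_measurable M"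
    for f and M :: "'b measure"
    by (rule measurable_compose) auto
  have "tilted \<in> ?S \<rightarrow>\<^sub>M prob_algebra ?S"
    unfolding tilted_def[abs_def]
  proof (rule measurable_bind_prob_space2)
    show "(\<lambda>q. point_measure UNIV (\<lambda>y. ennreal (tilted_K K \<nu> \<gamma> u \<theta>s (?x q) y))) \<in> ?S \<rightarrow>\<^sub>M prob_algebra (count_space UNIV)"
      by (rule measurable_finite_state[OF measurable_const])
        (auto intro!: prob_space_point_measure_stochastic tilted_K_nonneg tilted_K_stochastic)
    show "(\<lambda>(q, y). tilted_incr_law \<nu> \<gamma> \<theta>s y \<bind> (\<lambda>z. W y z \<bind> (\<lambda>w.
       return ?S (fst q + z, fst (snd q) + \<Delta> * w * exp (fst q + z), y,
         weight q * (exp (- \<theta>s * z) * u \<theta>s (?x q) / u \<theta>s y))))) \<in> ?S \<Otimes>\<^sub>M count_space UNIV \<rightarrow>\<^sub>M prob_algebra ?S"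
      unfolding split_beta
    proof (rule measurable_bind_prob_space2)
      show "(\<lambda>a. tilted_incr_law \<nu> \<gamma> \<theta>s (snd a)) \<in> ?S \<Otimes>\<^sub>M count_space UNIV \<rightarrow>\<^sub>M prob_algebra borel"
        by (rule measurable_finite_state[OF measurable_const])
          (auto simp: space_prob_algebra prob_space_tilted_incr_law sets_tilted_incr_law)
      show "(\<lambda>(a, z). W (snd a) z \<bind> (\<lambda>w. return ?S (fst (fst a) + z,
           fst (snd (fst a)) + \<Delta> * w * exp (fst (fst a) + z), snd a,
           weight (fst a) * (exp (- \<theta>s * z) * u \<theta>s (?x (fst a)) / u \<theta>s (snd a)))))
          \<in> (?S \<Otimes>\<^sub>M count_space UNIV) \<Otimes>\<^sub>M borel \<rightarrow>\<^sub>M prob_algebra ?S"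
        unfolding split_beta
      proof (rule measurable_bind_prob_space2)
        show "(\<lambda>a. W (snd (fst a)) (snd a)) \<in> (?S \<Otimes>\<^sub>M count_space UNIV) \<Otimes>\<^sub>M borel \<rightarrow>\<^sub>M prob_algebra borel"
          by (rule measurable_finite_state[where g="\<lambda>a. snd (fst a)"])
            (auto intro!: measurable_compose[OF measurable_snd measurable_W])
        show "(\<lambda>(a, w). return ?S (fst (fst (fst a)) + snd a,
             fst (snd (fst (fst a))) + \<Delta> * w * exp (fst (fst (fst a)) + snd a), snd (fst a),
             weight (fst (fst a)) * (exp (- \<theta>s * snd a) * u \<theta>s (?x (fst (fst a))) / u \<theta>s (snd (fst a)))))
            \<in> ((?S \<Otimes>\<^sub>M count_space UNIV) \<Otimes>\<^sub>M borel) \<Otimes>\<^sub>M borel \<rightarrow>\<^sub>M prob_algebra ?S"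
          unfolding split_beta
          by (intro measurable_compose[OF measurable_state_spaceI ret]) measurable
      qed
    qed
  qed
  moreover have "nominal \<in> ?S \<rightarrow>\<^sub>M prob_algebra ?S"
    unfolding nominal_def[abs_def]
  proof (rule measurable_bind_prob_space2)
    show "(\<lambda>q. point_measure UNIV (\<lambda>y. ennreal (K (?x q) y))) \<in> ?S \<rightarrow>\<^sub>M prob_algebra (count_space UNIV)"
      by (rule measurable_finite_state[OF measurable_const])
        (auto intro!: prob_space_point_measure_stochastic K_nonneg K_stochastic)
    show "(\<lambda>(q, y). joint_law \<nu> \<gamma> lam y \<bind> (\<lambda>p.
       return ?S (fst q + fst p, fst (snd q) + \<Delta> * snd p * exp (fst q + fst p), y, weight q)))
       \<in> ?S \<Otimes>\<^sub>M count_space UNIV \<rightarrow>\<^sub>M prob_algebra ?S"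
      unfolding split_beta
    proof (rule measurable_bind_prob_space2)
      show "(\<lambda>a. joint_law \<nu> \<gamma> lam (snd a)) \<in> ?S \<Otimes>\<^sub>M count_space UNIV \<rightarrow>\<^sub>M prob_algebra (borel \<Otimes>\<^sub>M borel)"
        by (rule measurable_finite_state[OF measurable_const]) (auto simp: sets_joint_law)
      show "(\<lambda>(a, p). return ?S (fst (fst a) + fst p,
           fst (snd (fst a)) + \<Delta> * snd p * exp (fst (fst a) + fst p), snd a, weight (fst a)))
          \<in> (?S \<Otimes>\<^sub>M count_space UNIV) \<Otimes>\<^sub>M (borel \<Otimes>\<^sub>M borel) \<rightarrow>\<^sub>M prob_algebra ?S"
        unfolding split_beta
        by (intro measurable_compose[OF measurable_state_spaceI ret]) measurable
    qed
  qed
  moreover have "sampler_kernel B1 B2 \<Delta> = (\<lambda>q. if walk_part q \<in> tilt_region u \<theta>s B1 B2 \<Delta> then tilted q else nominal q)"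
    by (auto simp: fun_eq_iff alg_kernel_def walk_part_def tilted_def nominal_def case_prod_unfold weight_def)
  moreover have "{q \<in> space ?S. walk_part q \<in> tilt_region u \<theta>s B1 B2 \<Delta>} \<in> sets ?S"
    using measurable_sets[OF measurable_walk_part sets_tilt_region[of u \<theta>s B1 B2 \<Delta>]]
    by (simp add: vimage_def Int_def conj_commute)
  ultimately show ?thesis by (simp add: measurable_If)
qed

end

context tilted_sampler begin

definition extend :: "real \<times> real \<times> 's \<Rightarrow> real \<Rightarrow> 's alg_state" where
  "extend z L = (fst z, fst (snd z), snd (snd z), L)"

lemma extend_simps [simp]: "walk_part (extend z L) = z" "weight (extend z L) = L"
  "extend (walk_part q) (weight q) = q"
  by (simp_all add: extend_def walk_part_def weight_def)

text \<open>
The normalising factors \<open>exp (chi \<dots>)\<close> of the tilted chain and of the tilted increment cancel,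
so that only \<open>tilt\<close> remains as density with respect to the nominal transition.
\<close>

lemma nn_integral_sampler_kernel_tilted:
  assumes F: "F \<in> borel_measurable state_space" and q: "walk_part q \<in> tilt_region u \<theta>s B1 B2 \<Delta>"
  shows "(\<integral>\<^sup>+q'. F q' \<partial>sampler_kernel B1 B2 \<Delta> q)
    = (\<Sum>y\<in>UNIV. ennreal (K (snd (snd (walk_part q))) y) *
        (\<integral>\<^sup>+p. ennreal (tilt (snd (snd (walk_part q))) y (\<gamma> y (fst p))) *
          F (extend (move \<Delta> (walk_part q) y p) (weight q / tilt (snd (snd (walk_part q))) y (\<gamma> y (fst p)))) \<partial>\<nu>))"
proof -
  obtain s d x L where q_eq: "q = (s, d, x, L)" by (cases q) auto
  let ?S = "state_space :: 's alg_state measure"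
  define g where "g y z w = (s + z, d + \<Delta> * w * exp (s + z), y, L * (exp (- \<theta>s * z) * u \<theta>s x / u \<theta>s y))" for y z w
  define Tz where "Tz y = (\<lambda>z. W y z \<bind> (\<lambda>w. return ?S (g y z w)))" for y
  have kernel: "sampler_kernel B1 B2 \<Delta> q = point_measure UNIV (\<lambda>y. ennreal (tilted_K K \<nu> \<gamma> u \<theta>s x y)) \<bind>
      (\<lambda>y. tilted_incr_law \<nu> \<gamma> \<theta>s y \<bind> Tz y)"
    using q unfolding q_eq by (simp add: alg_kernel_def walk_part_def g_def Tz_def)
  have ret: "return ?S \<in> ?S \<rightarrow>\<^sub>M prob_algebra ?S" by (rule measurable_return_prob_space)
  have g_pair: "(\<lambda>a. g y (fst a) (snd a)) \<in> borel \<Otimes>\<^sub>M borel \<rightarrow>\<^sub>M ?S" for y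
    unfolding g_def by (intro measurable_state_spaceI) measurable
  have g_snd: "(\<lambda>w. g y z w) \<in> borel \<rightarrow>\<^sub>M ?S" for y z
    unfolding g_def by (intro measurable_state_spaceI) measurable
  have g_noise: "(\<lambda>p. g y (\<gamma> y (fst p)) (lam y (snd p))) \<in> \<nu> \<rightarrow>\<^sub>M ?S" for y
    unfolding g_def by (intro measurable_state_spaceI) measurable
  have w_meas: "(\<lambda>w. return ?S (g y z w)) \<in> borel \<rightarrow>\<^sub>M prob_algebra ?S" for y z
    by (rule measurable_compose[OF g_snd ret])
  have Tz_meas: "Tz y \<in> borel \<rightarrow>\<^sub>M prob_algebra ?S" for y
    unfolding Tz_def by (rule measurable_bind_prob_space2[OF measurable_W])
      (use measurable_compose[OF g_pair[of y] ret] in \<open>simp add: case_prod_unfold\<close>)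
  have y_meas: "(\<lambda>y. tilted_incr_law \<nu> \<gamma> \<theta>s y \<bind> Tz y) \<in> point_measure UNIV (\<lambda>y. ennreal (tilted_K K \<nu> \<gamma> u \<theta>s x y)) \<rightarrow>\<^sub>M subprob_algebra ?S"
  proof -
    have "tilted_incr_law \<nu> \<gamma> \<theta>s y \<bind> Tz y \<in> space (subprob_algebra ?S)" for y
    proof -
      have "(\<lambda>_. tilted_incr_law \<nu> \<gamma> \<theta>s y \<bind> Tz y) \<in> (count_space UNIV :: unit measure) \<rightarrow>\<^sub>M prob_algebra ?S"
        by (rule measurable_bind_prob_space[OF _ Tz_meas])
          (simp add: space_prob_algebra prob_space_tilted_incr_law sets_tilted_incr_law)
      from measurable_space[OF measurable_prob_algebraD[OF this]] show ?thesis by simp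
    qed
    then show ?thesis by simp
  qed
  have inner: "(\<integral>\<^sup>+q'. F q' \<partial>Tz y z) = (\<integral>\<^sup>+w. F (g y z w) \<partial>W y z)" for y z
    unfolding Tz_def using measurable_prob_algebraD[OF w_meas[of y z]] sets_W[of y z]
    by (subst nn_integral_bind[OF F]) (simp_all add: nn_integral_return F cong: measurable_cong_sets)
  have Fg: "(\<lambda>(z, w). F (g y z w)) \<in> borel_measurable (borel \<Otimes>\<^sub>M borel)" for y
    using measurable_compose[OF g_pair[of y] F] by (simp add: case_prod_unfold)
  have "(\<integral>\<^sup>+q'. F q' \<partial>(tilted_incr_law \<nu> \<gamma> \<theta>s y \<bind> Tz y))
      = (\<integral>\<^sup>+p. ennreal (exp (\<theta>s * \<gamma> y (fst p) - chi \<nu> \<gamma> y \<theta>s)) * F (g y (\<gamma> y (fst p)) (lam y (snd p))) \<partial>\<nu>)" for y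
  proof -
    have "(\<integral>\<^sup>+q'. F q' \<partial>(tilted_incr_law \<nu> \<gamma> \<theta>s y \<bind> Tz y))
        = (\<integral>\<^sup>+z. (\<integral>\<^sup>+w. F (g y z w) \<partial>W y z) \<partial>tilted_incr_law \<nu> \<gamma> \<theta>s y)"
      using measurable_prob_algebraD[OF Tz_meas[of y]]
      by (subst nn_integral_bind[OF F]) (simp_all add: inner sets_tilted_incr_law cong: measurable_cong_sets)
    also have "\<dots> = (\<integral>\<^sup>+z. ennreal (exp (\<theta>s * z - chi \<nu> \<gamma> y \<theta>s)) * (\<integral>\<^sup>+w. F (g y z w) \<partial>W y z) \<partial>incr_law \<nu> \<gamma> y)"
      using measurable_nn_integral_W[OF Fg] by (intro nn_integral_tilted_incr_law) simp
    also have "\<dots> = (\<integral>\<^sup>+z. (\<integral>\<^sup>+w. (case (z, w) of (z, w) \<Rightarrow> ennreal (exp (\<theta>s * z - chi \<nu> \<gamma> y \<theta>s)) * F (g y z w)) \<partial>W y z) \<partial>incr_law \<nu> \<gamma> y)"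
    proof (intro nn_integral_cong)
      fix z :: real
      have "(\<lambda>w. F (g y z w)) \<in> borel_measurable (W y z)"
        using measurable_compose[OF g_snd F, of y z] sets_W[of y z]
        by (simp cong: measurable_cong_sets)
      then show "ennreal (exp (\<theta>s * z - chi \<nu> \<gamma> y \<theta>s)) * (\<integral>\<^sup>+w. F (g y z w) \<partial>W y z)
        = (\<integral>\<^sup>+w. (case (z, w) of (z, w) \<Rightarrow> ennreal (exp (\<theta>s * z - chi \<nu> \<gamma> y \<theta>s)) * F (g y z w)) \<partial>W y z)"
        by (simp add: nn_integral_cmult)
    qed
    also have "\<dots> = (\<integral>\<^sup>+p. ennreal (exp (\<theta>s * \<gamma> y (fst p) - chi \<nu> \<gamma> y \<theta>s)) * F (g y (\<gamma> y (fst p)) (lam y (snd p))) \<partial>\<nu>)"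
    proof -
      have [measurable]: "(\<lambda>a. F (g y (fst a) (snd a))) \<in> borel_measurable (borel \<Otimes>\<^sub>M borel)"
        using Fg by (simp add: split_beta)
      have "(\<lambda>(z, w). ennreal (exp (\<theta>s * z - chi \<nu> \<gamma> y \<theta>s)) * F (g y z w)) \<in> borel_measurable (borel \<Otimes>\<^sub>M borel)"
        unfolding split_beta by measurable
      from nn_integral_cond_law[OF this, of y] show ?thesis by simp
    qed
    finally show ?thesis .
  qed
  then have "(\<integral>\<^sup>+q'. F q' \<partial>sampler_kernel B1 B2 \<Delta> q) = (\<Sum>y\<in>UNIV. ennreal (tilted_K K \<nu> \<gamma> u \<theta>s x y) *
      (\<integral>\<^sup>+p. ennreal (exp (\<theta>s * \<gamma> y (fst p) - chi \<nu> \<gamma> y \<theta>s)) * F (g y (\<gamma> y (fst p)) (lam y (snd p))) \<partial>\<nu>))"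
    unfolding kernel by (subst nn_integral_bind[OF F y_meas]) (simp add: nn_integral_point_measure_finite)
  also have "\<dots> = (\<Sum>y\<in>UNIV. ennreal (K x y) *
        (\<integral>\<^sup>+p. ennreal (tilt x y (\<gamma> y (fst p))) *
          F (extend (move \<Delta> (s, d, x) y p) (L / tilt x y (\<gamma> y (fst p)))) \<partial>\<nu>))"
  proof (rule sum.cong[OF refl])
    fix y
    have "g y (\<gamma> y (fst p)) (lam y (snd p)) = extend (move \<Delta> (s, d, x) y p) (L / tilt x y (\<gamma> y (fst p)))" for p
      by (simp add: g_def extend_def move_def tilt_def exp_minus field_simps)
    then have [measurable]: "(\<lambda>p. F (g y (\<gamma> y (fst p)) (lam y (snd p)))) \<in> borel_measurable \<nu>"
      and g_eq: "g y (\<gamma> y (fst p)) (lam y (snd p)) = extend (move \<Delta> (s, d, x) y p) (L / tilt x y (\<gamma> y (fst p)))" for p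
      using measurable_compose[OF g_noise[of y] F] by simp_all
    have [measurable]: "(\<lambda>p. tilt x y (\<gamma> y (fst p))) \<in> borel_measurable \<nu>" unfolding tilt_def by measurable
    have t: "tilted_K K \<nu> \<gamma> u \<theta>s x y * exp (\<theta>s * z - chi \<nu> \<gamma> y \<theta>s) = K x y * tilt x y z" for z
      by (simp add: tilted_K_eq tilt_def exp_diff)
    have "ennreal (tilted_K K \<nu> \<gamma> u \<theta>s x y) * (\<integral>\<^sup>+p. ennreal (exp (\<theta>s * \<gamma> y (fst p) - chi \<nu> \<gamma> y \<theta>s)) * F (g y (\<gamma> y (fst p)) (lam y (snd p))) \<partial>\<nu>)
        = (\<integral>\<^sup>+p. ennreal (tilted_K K \<nu> \<gamma> u \<theta>s x y * exp (\<theta>s * \<gamma> y (fst p) - chi \<nu> \<gamma> y \<theta>s)) * F (g y (\<gamma> y (fst p)) (lam y (snd p))) \<partial>\<nu>)"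
      by (subst nn_integral_cmult[symmetric]) (simp_all add: ennreal_mult tilted_K_nonneg mult.assoc)
    also have "\<dots> = ennreal (K x y) * (\<integral>\<^sup>+p. ennreal (tilt x y (\<gamma> y (fst p))) * F (g y (\<gamma> y (fst p)) (lam y (snd p))) \<partial>\<nu>)"
      unfolding t
      by (subst nn_integral_cmult[symmetric]) (simp_all add: ennreal_mult K_nonneg tilt_pos less_imp_le mult.assoc)
    finally show "ennreal (tilted_K K \<nu> \<gamma> u \<theta>s x y) *
      (\<integral>\<^sup>+p. ennreal (exp (\<theta>s * \<gamma> y (fst p) - chi \<nu> \<gamma> y \<theta>s)) * F (g y (\<gamma> y (fst p)) (lam y (snd p))) \<partial>\<nu>) =
      ennreal (K x y) * (\<integral>\<^sup>+p. ennreal (tilt x y (\<gamma> y (fst p))) *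
          F (extend (move \<Delta> (s, d, x) y p) (L / tilt x y (\<gamma> y (fst p)))) \<partial>\<nu>)"
      by (simp add: g_eq)
  qed
  finally show ?thesis by (simp add: q_eq walk_part_def weight_def)
qed

lemma nn_integral_sampler_kernel_nominal:
  assumes F: "F \<in> borel_measurable state_space" and q: "walk_part q \<notin> tilt_region u \<theta>s B1 B2 \<Delta>"
  shows "(\<integral>\<^sup>+q'. F q' \<partial>sampler_kernel B1 B2 \<Delta> q)
    = (\<Sum>y\<in>UNIV. ennreal (K (snd (snd (walk_part q))) y) *
        (\<integral>\<^sup>+p. F (extend (move \<Delta> (walk_part q) y p) (weight q)) \<partial>\<nu>))"
proof -
  obtain s d x L where q_eq: "q = (s, d, x, L)" by (cases q) auto
  let ?S = "state_space :: 's alg_state measure"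
  define g where "g y = (\<lambda>(z, w). (s + z, d + \<Delta> * w * exp (s + z), y, L))" for y :: 's
  have kernel: "sampler_kernel B1 B2 \<Delta> q = point_measure UNIV (\<lambda>y. ennreal (K x y)) \<bind>
      (\<lambda>y. joint_law \<nu> \<gamma> lam y \<bind> (\<lambda>p. return ?S (g y p)))"
    using q unfolding q_eq by (simp add: alg_kernel_def walk_part_def g_def case_prod_unfold)
  have ret: "return ?S \<in> ?S \<rightarrow>\<^sub>M prob_algebra ?S" by (rule measurable_return_prob_space)
  have "g y \<in> borel \<Otimes>\<^sub>M borel \<rightarrow>\<^sub>M ?S" for y
    unfolding g_def split_beta by (intro measurable_state_spaceI) measurable
  then have g_meas: "g y \<in> borel \<rightarrow>\<^sub>M ?S" for y by (simp add: borel_prod)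
  have p_meas: "(\<lambda>p. return ?S (g y p)) \<in> borel \<rightarrow>\<^sub>M prob_algebra ?S" for y
    by (rule measurable_compose[OF g_meas ret])
  have y_meas: "(\<lambda>y. joint_law \<nu> \<gamma> lam y \<bind> (\<lambda>p. return ?S (g y p))) \<in> point_measure UNIV (\<lambda>y. ennreal (K x y)) \<rightarrow>\<^sub>M subprob_algebra ?S"
  proof -
    have "joint_law \<nu> \<gamma> lam y \<bind> (\<lambda>p. return ?S (g y p)) \<in> space (subprob_algebra ?S)" for y
    proof -
      have "(\<lambda>_. joint_law \<nu> \<gamma> lam y \<bind> (\<lambda>p. return ?S (g y p))) \<in> (count_space UNIV :: unit measure) \<rightarrow>\<^sub>M prob_algebra ?S"
        using sets_joint_law[of y] by (intro measurable_bind_prob_space[OF _ p_meas]) (simp add: borel_prod)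
      from measurable_space[OF measurable_prob_algebraD[OF this]] show ?thesis by simp
    qed
    then show ?thesis by simp
  qed
  have "(\<integral>\<^sup>+q'. F q' \<partial>(joint_law \<nu> \<gamma> lam y \<bind> (\<lambda>p. return ?S (g y p))))
      = (\<integral>\<^sup>+p. F (extend (move \<Delta> (s, d, x) y p) L) \<partial>\<nu>)" for y
  proof -
    have "(\<integral>\<^sup>+q'. F q' \<partial>(joint_law \<nu> \<gamma> lam y \<bind> (\<lambda>p. return ?S (g y p)))) = (\<integral>\<^sup>+p. F (g y p) \<partial>joint_law \<nu> \<gamma> lam y)"
      using measurable_prob_algebraD[OF p_meas[of y]]
      by (subst nn_integral_bind[OF F]) (simp_all add: nn_integral_return F joint_law_def cong: measurable_cong_sets)
    also have "\<dots> = (\<integral>\<^sup>+p. F (g y (\<gamma> y (fst p), lam y (snd p))) \<partial>\<nu>)"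
      by (rule nn_integral_joint_law[OF measurable_compose[OF g_meas F]])
    finally show ?thesis by (simp add: g_def extend_def move_def)
  qed
  then show ?thesis
    unfolding kernel by (subst nn_integral_bind[OF F y_meas])
      (simp add: nn_integral_point_measure_finite q_eq walk_part_def weight_def)
qed

text \<open>
The density \<open>tilt\<close> is the ratio of this function at the new and the old state: the tilted
dynamics is the Doob transform of the nominal one by it.
\<close>

definition harmonic :: "real \<times> real \<times> 's \<Rightarrow> real" where
  "harmonic z = exp (\<theta>s * fst z) * u \<theta>s (snd (snd z))"

lemma harmonic_pos: "0 < harmonic z"
  unfolding harmonic_def using u_\<theta>s_pos by simp

lemma measurable_harmonic [measurable]: "harmonic \<in> borel_measurable walk_space"
proof -
  have [measurable]: "(\<lambda>z. u \<theta>s (snd (snd z))) \<in> borel_measurable walk_space"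
    by (rule measurable_compose[OF measurable_walk_space_components(3)]) simp
  show ?thesis unfolding harmonic_def[abs_def] by measurable
qed

lemma tilt_harmonic: "tilt (snd (snd z)) y (\<gamma> y (fst p)) = harmonic (move \<Delta> z y p) / harmonic z"
  by (simp add: tilt_def harmonic_def move_def exp_add distrib_left)

text \<open>
The key to unbiasedness: in the tilt region the new weight carries the factor \<open>1 / tilt\<close>, which
cancels the density of the tilted transition; outside nothing is changed.
\<close>

lemma weighted_expectation_sampler:
  assumes f [measurable]: "f \<in> borel_measurable walk_space"
  shows "(\<integral>\<^sup>+q'. ennreal (weight q') * f (walk_part q') \<partial>sampler_kernel B1 B2 \<Delta> q)
    = ennreal (weight q) * step \<Delta> f (walk_part q)"
proof -
  have F: "(\<lambda>q'. ennreal (weight q') * f (walk_part q')) \<in> borel_measurable state_space" by measurable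
  show ?thesis
  proof (cases "walk_part q \<in> tilt_region u \<theta>s B1 B2 \<Delta>")
    case True
    have "ennreal (tilt x y z) * (ennreal (weight q / tilt x y z) * c) = ennreal (weight q) * c" for x y z c
      using tilt_pos[of x y z] by (simp add: mult.assoc[symmetric] ennreal_mult'[symmetric])
    then show ?thesis
      unfolding nn_integral_sampler_kernel_tilted[OF F True] step_def
      by (simp add: nn_integral_cmult sum_distrib_left mult.left_commute)
  next
    case False
    then show ?thesis
      unfolding nn_integral_sampler_kernel_nominal[OF F False] step_def
      by (simp add: nn_integral_cmult sum_distrib_left mult.left_commute)
  qed
qed

end

context tilted_sampler begin

lemma squared_weight_expectation_sampler_nominal:
  assumes f [measurable]: "f \<in> borel_measurable walk_space" and q: "walk_part q \<notin> tilt_region u \<theta>s B1 B2 \<Delta>"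
  shows "(\<integral>\<^sup>+q'. ennreal ((weight q')\<^sup>2) * f (walk_part q') \<partial>sampler_kernel B1 B2 \<Delta> q)
    = ennreal ((weight q)\<^sup>2) * step \<Delta> f (walk_part q)"
proof -
  have F: "(\<lambda>q'. ennreal ((weight q')\<^sup>2) * f (walk_part q')) \<in> borel_measurable state_space" by measurable
  show ?thesis
    unfolding nn_integral_sampler_kernel_nominal[OF F q] step_def
    by (simp add: nn_integral_cmult sum_distrib_left mult.left_commute)
qed

text \<open>
For the squared weight only one of the two factors \<open>1 / tilt\<close> is cancelled by the density; the
other one appears as a Doob transform by \<open>harmonic\<close> in the opposite direction.
\<close>

lemma squared_weight_expectation_sampler_tilted:
  assumes f [measurable]: "f \<in> borel_measurable walk_space" and q: "walk_part q \<in> tilt_region u \<theta>s B1 B2 \<Delta>"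
  shows "(\<integral>\<^sup>+q'. ennreal ((weight q')\<^sup>2) * f (walk_part q') \<partial>sampler_kernel B1 B2 \<Delta> q)
    = ennreal ((weight q)\<^sup>2) * (ennreal (harmonic (walk_part q)) * step \<Delta> (\<lambda>z. ennreal (1 / harmonic z) * f z) (walk_part q))"
proof -
  have F: "(\<lambda>q'. ennreal ((weight q')\<^sup>2) * f (walk_part q')) \<in> borel_measurable state_space" by measurable
  let ?z = "walk_part q"
  have eq: "ennreal (tilt (snd (snd ?z)) y (\<gamma> y (fst p))) * (ennreal ((weight q / tilt (snd (snd ?z)) y (\<gamma> y (fst p)))\<^sup>2) * c)
      = ennreal ((weight q)\<^sup>2 * harmonic ?z) * (ennreal (1 / harmonic (move \<Delta> ?z y p)) * c)" for y p c
  proof -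
    have "ennreal (tilt (snd (snd ?z)) y (\<gamma> y (fst p))) * ennreal ((weight q / tilt (snd (snd ?z)) y (\<gamma> y (fst p)))\<^sup>2)
      = ennreal ((weight q)\<^sup>2 * harmonic ?z) * ennreal (1 / harmonic (move \<Delta> ?z y p))"
    proof -
      have real: "b / a * (w / (b / a))\<^sup>2 = w\<^sup>2 * a * (1 / b)" if "0 < a" "0 < b" for a b w :: real
        using that by (simp add: power2_eq_square field_simps)
      show ?thesis
        unfolding tilt_harmonic[of _ _ _ \<Delta>] using harmonic_pos[of ?z] harmonic_pos[of "move \<Delta> ?z y p"]
        by (subst (1 2) ennreal_mult[symmetric]) (simp_all only: real, simp_all add: less_imp_le)
    qed
    then show ?thesis by (simp add: mult.assoc[symmetric])
  qed
  have "(\<integral>\<^sup>+q'. ennreal ((weight q')\<^sup>2) * f (walk_part q') \<partial>sampler_kernel B1 B2 \<Delta> q)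
      = ennreal ((weight q)\<^sup>2 * harmonic ?z) * step \<Delta> (\<lambda>z. ennreal (1 / harmonic z) * f z) ?z"
    unfolding nn_integral_sampler_kernel_tilted[OF F q] step_def extend_simps eq
    by (simp add: nn_integral_cmult sum_distrib_left mult.left_commute)
  then show ?thesis using harmonic_pos[of ?z] by (simp add: ennreal_mult less_imp_le mult.assoc)
qed

text \<open>
A weight that is not negative stays so, because each transition multiplies it by a positive number.
\<close>

lemma weight_nonneg_sampler:
  assumes "0 \<le> weight q"
  shows "(\<integral>\<^sup>+q'. indicator {q. weight q < 0} q' \<partial>sampler_kernel B1 B2 \<Delta> q) = 0"
proof -
  have "{q \<in> space state_space. weight q < 0} \<in> sets (state_space :: 's alg_state measure)" by measurable
  then have F: "indicator {q. weight q < 0} \<in> borel_measurable (state_space :: 's alg_state measure)" by simp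
  have "\<not> weight q / tilt x y z < 0" for x y z
    using assms tilt_pos[of x y z] by (simp add: not_less)
  note 1 = this
  show ?thesis
  proof (cases "walk_part q \<in> tilt_region u \<theta>s B1 B2 \<Delta>")
    case True
    show ?thesis unfolding nn_integral_sampler_kernel_tilted[OF F True] by (simp add: indicator_def 1)
  next
    case False
    show ?thesis unfolding nn_integral_sampler_kernel_nominal[OF F False] using assms by (simp add: indicator_def not_less)
  qed
qed

end

section \<open>Stopping at ruin\<close>

definition ruin :: "real \<times> real \<times> 's \<Rightarrow> ennreal" where
  "ruin z = (if fst (snd z) > 1 then 1 else 0)"

definition safe :: "real \<times> real \<times> 's \<Rightarrow> ennreal" where
  "safe z = (if fst (snd z) > 1 then 0 else 1)"

lemma measurable_ruin [measurable]: "ruin \<in> borel_measurable walk_space"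
  unfolding ruin_def[abs_def] by measurable

lemma measurable_safe [measurable]: "safe \<in> borel_measurable walk_space"
  unfolding safe_def[abs_def] by measurable

text \<open>
The event that the passage time exceeds \<open>n\<close>, as a function of the states up to time \<open>n\<close>.
\<close>

definition alive :: "nat \<Rightarrow> (nat \<Rightarrow> 's alg_state) \<Rightarrow> ennreal" where
  "alive n \<tau> = (\<Prod>i\<le>n. safe (walk_part (\<tau> i)))"

lemma alive_eq: "alive n \<tau> = (if \<forall>i\<le>n. fst (snd (\<tau> i)) \<le> 1 then 1 else 0)"
proof (induction n)
  case (Suc n)
  then show ?case by (auto simp: alive_def safe_def walk_part_def not_le le_Suc_eq)
qed (simp add: alive_def safe_def walk_part_def)

lemma passage_time_eq_enat_iff:
  "passage_time d = enat n \<longleftrightarrow> d n > 1 \<and> (\<forall>i<n. d i \<le> 1)"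
proof
  assume *: "passage_time d = enat n"
  have ne: "enat ` {n. d n > 1} \<noteq> {}"
  proof
    assume "enat ` {n. d n > 1} = {}"
    then have "passage_time d = \<infinity>" unfolding passage_time_def by (simp add: top_enat_def)
    then show False using * by simp
  qed
  then have "passage_time d \<in> enat ` {n. d n > 1}"
    unfolding passage_time_def Inf_enat_def by (simp only: if_False) (rule LeastI_ex, blast)
  moreover have "\<not> d i > 1" if "i < n" for i
  proof
    assume "d i > 1"
    then have "passage_time d \<le> enat i" unfolding passage_time_def by (intro INF_lower) simp
    then show False using * that by simp
  qed
  ultimately show "d n > 1 \<and> (\<forall>i<n. d i \<le> 1)" using * by (auto simp: not_less)
next
  assume *: "d n > 1 \<and> (\<forall>i<n. d i \<le> 1)"
  show "passage_time d = enat n"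
  proof (rule antisym)
    show "passage_time d \<le> enat n" unfolding passage_time_def using * by (intro INF_lower) simp
    show "enat n \<le> passage_time d" unfolding passage_time_def using *
      by (intro INF_greatest) (auto simp: not_less[symmetric])
  qed
qed

lemma passage_time_less_top_iff: "passage_time d < \<infinity> \<longleftrightarrow> (\<exists>n. d n > 1)"
proof
  assume "passage_time d < \<infinity>"
  then obtain n where "passage_time d = enat n" by (auto simp: less_infinityE)
  then show "\<exists>n. d n > 1" by (auto simp: passage_time_eq_enat_iff)
next
  assume "\<exists>n. d n > 1"
  then obtain n where "d n > 1" ..
  then have "passage_time d \<le> enat n" unfolding passage_time_def by (intro INF_lower) simp
  also have "enat n < \<infinity>" by simp
  finally show "passage_time d < \<infinity>" .
qed

text \<open>
Decomposition according to the passage time. A passage time 0 is excluded by the start, and the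
condition \<open>g 0 = 0\<close> matches the convention that the estimator is 0 without ruin.
\<close>

lemma estimator_expansion:
  fixes g :: "real \<Rightarrow> ennreal"
  assumes g0: "g 0 = 0" and start: "fst (snd (\<tau> 0)) \<le> 1"
  shows "g (estimator \<tau>) = (\<Sum>n. alive n \<tau> * (ruin (walk_part (\<tau> (Suc n))) * g (weight (\<tau> (Suc n)))))"
proof -
  let ?d = "\<lambda>n. fst (snd (\<tau> n))"
  have est: "estimator \<tau> = (case passage_time ?d of enat n \<Rightarrow> weight (\<tau> n) | \<infinity> \<Rightarrow> 0)"
    by (simp add: estimator_def weight_def case_prod_unfold cong: enat.case_cong)
  show ?thesis
  proof (cases "passage_time ?d")
    case (enat N)
    then have N: "?d N > 1" "\<And>i. i < N \<Longrightarrow> ?d i \<le> 1" by (auto simp: passage_time_eq_enat_iff)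
    then obtain m where m: "N = Suc m" using start by (cases N) auto
    have "(\<Sum>n. alive n \<tau> * (ruin (walk_part (\<tau> (Suc n))) * g (weight (\<tau> (Suc n)))))
        = (\<Sum>n\<in>{m}. alive n \<tau> * (ruin (walk_part (\<tau> (Suc n))) * g (weight (\<tau> (Suc n)))))"
    proof (rule suminf_finite)
      fix n assume "n \<notin> {m}"
      then consider "n < m" | "n > m" by force
      then show "alive n \<tau> * (ruin (walk_part (\<tau> (Suc n))) * g (weight (\<tau> (Suc n)))) = 0"
      proof cases
        case 1
        then have "?d (Suc n) \<le> 1" using N(2)[of "Suc n"] m by simp
        then show ?thesis by (simp add: ruin_def walk_part_def)
      next
        case 2
        then have "N \<le> n" using m by simp
        then have "alive n \<tau> = 0" using N(1) by (auto simp: alive_eq not_le)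
        then show ?thesis by simp
      qed
    qed simp
    also have "\<dots> = g (weight (\<tau> N))"
      using N m by (auto simp: alive_eq ruin_def walk_part_def less_Suc_eq_le)
    finally show ?thesis by (simp add: est enat)
  next
    case infinity
    then have "\<not> 1 < ?d n" for n using passage_time_less_top_iff[of ?d] by auto
    then show ?thesis by (simp add: est infinity g0 ruin_def walk_part_def)
  qed
qed

lemma measurable_estimator:
  "estimator \<in> borel_measurable (\<Pi>\<^sub>M i\<in>UNIV. state_space)"
proof -
  let ?M = "\<Pi>\<^sub>M i\<in>(UNIV :: nat set). (state_space :: 's alg_state measure)"
  have comp [measurable]: "(\<lambda>\<tau>. \<tau> n) \<in> ?M \<rightarrow>\<^sub>M state_space" for n by (rule measurable_component_singleton) simp
  have w [measurable]: "(\<lambda>\<tau>. weight (\<tau> n)) \<in> borel_measurable ?M" for n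
    by (rule measurable_compose[OF comp measurable_weight])
  have d [measurable]: "(\<lambda>\<tau>. fst (snd (\<tau> n))) \<in> borel_measurable ?M" for n
    by (rule measurable_compose[OF comp measurable_state_space_components(2)])
  have "{\<tau> \<in> space ?M. passage_time (\<lambda>n. fst (snd (\<tau> n))) = enat n} \<in> sets ?M" for n
  proof -
    have "{\<tau> \<in> space ?M. fst (snd (\<tau> n)) > 1 \<and> (\<forall>i\<in>{..<n}. fst (snd (\<tau> i)) \<le> 1)} \<in> sets ?M" by measurable
    then show ?thesis by (simp only: passage_time_eq_enat_iff Ball_def lessThan_iff)
  qed
  moreover have "{\<tau> \<in> space ?M. passage_time (\<lambda>n. fst (snd (\<tau> n))) = \<infinity>} \<in> sets ?M"
  proof -
    have "{\<tau> \<in> space ?M. \<forall>n. \<not> fst (snd (\<tau> n)) > 1} \<in> sets ?M" by measurable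
    moreover have "passage_time d = \<infinity> \<longleftrightarrow> (\<forall>n. \<not> d n > 1)" for d
      using passage_time_less_top_iff[of d] by (metis enat_ord_simps(4) )
    ultimately show ?thesis by simp
  qed
  ultimately have "{\<tau> \<in> space ?M. passage_time (\<lambda>n. fst (snd (\<tau> n))) = t} \<in> sets ?M" for t
    by (cases t) simp_all
  then have "(\<lambda>\<tau>. passage_time (\<lambda>n. fst (snd (\<tau> n)))) \<in> ?M \<rightarrow>\<^sub>M count_space UNIV"
    unfolding measurable_count_space_eq2_countable
    by (auto simp: vimage_def Int_def conj_commute)
  then show ?thesis
    unfolding estimator_def case_prod_unfold weight_def[symmetric]
    by (rule measurable_compose_countable[rotated]) (simp split: enat.split)
qed

context nominal_kernel begin

lemma move_distance:
  "0 \<le> \<Delta> \<Longrightarrow> fst (snd z) \<le> fst (snd (move \<Delta> z y p))"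
  by (simp add: move_def lam_nonneg)

lemma ruin_le_step: "0 \<le> \<Delta> \<Longrightarrow> ruin z \<le> step \<Delta> ruin z"
proof -
  assume "0 \<le> \<Delta>"
  then have "step \<Delta> (\<lambda>_. ruin z) z \<le> step \<Delta> ruin z"
    using move_distance[of \<Delta> z] by (intro step_mono) (auto simp: ruin_def intro: less_le_trans)
  then show ?thesis by (simp add: step_const)
qed

text \<open>
Jumps are nonnegative, so a ruined state stays ruined; this is what makes the first-passage
decomposition below telescope.
\<close>

lemma safe_step_ruin: "0 \<le> \<Delta> \<Longrightarrow> safe z * step \<Delta> ruin z + ruin z = step \<Delta> ruin z"
proof (cases "fst (snd z) > 1")
  case True
  assume "0 \<le> \<Delta>"
  then have "step \<Delta> ruin z = step \<Delta> (\<lambda>_. 1) z"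
    using move_distance[of \<Delta> z] True by (intro step_cong) (auto simp: ruin_def intro: less_le_trans)
  then show ?thesis using True by (simp add: step_const ruin_def safe_def)
qed (simp add: ruin_def safe_def)

lemma safe_step_safe: "0 \<le> \<Delta> \<Longrightarrow> safe z * step \<Delta> (\<lambda>z. safe z * f z) z = step \<Delta> (\<lambda>z. safe z * f z) z"
proof (cases "fst (snd z) > 1")
  case True
  assume "0 \<le> \<Delta>"
  then have "step \<Delta> (\<lambda>z. safe z * f z) z = step \<Delta> (\<lambda>_. 0) z"
    using move_distance[of \<Delta> z] True by (intro step_cong) (auto simp: safe_def dest: less_le_trans)
  then show ?thesis using True by (simp add: step_const safe_def)
qed (simp add: safe_def)

definition hit :: "real \<Rightarrow> real \<times> real \<times> 's \<Rightarrow> ennreal" where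
  "hit \<Delta> z = (SUP n. (step \<Delta> ^^ n) ruin z)"

lemma funpow_step_Suc: "(step \<Delta> ^^ Suc n) f = (step \<Delta> ^^ n) (step \<Delta> f)"
  by (simp add: funpow_swap1)

lemma funpow_step_add:
  "f \<in> borel_measurable walk_space \<Longrightarrow> g \<in> borel_measurable walk_space \<Longrightarrow>
    (step \<Delta> ^^ n) (\<lambda>z. f z + g z) z = (step \<Delta> ^^ n) f z + (step \<Delta> ^^ n) g z"
proof (induction n arbitrary: z)
  case (Suc n)
  have "(step \<Delta> ^^ Suc n) (\<lambda>z. f z + g z) z = step \<Delta> (\<lambda>z. (step \<Delta> ^^ n) f z + (step \<Delta> ^^ n) g z) z"
    using Suc by (simp del: split_paired_All) (rule step_cong, simp)
  then show ?case using Suc.prems by (simp add: step_add measurable_funpow_step)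
qed simp

end

section \<open>Mean and second moment of the estimator\<close>

context tilted_sampler begin

abbreviation sampler_law :: "real \<Rightarrow> real \<Rightarrow> 's \<Rightarrow> real \<Rightarrow> (nat \<Rightarrow> 's alg_state) measure" where
  "sampler_law B1 B2 x0 \<Delta> \<equiv> alg_law K \<nu> \<gamma> lam W u \<theta>s B1 B2 x0 \<Delta>"

lemmas sets_sampler_law = sets_chain_law[OF measurable_sampler_kernel, of "(0, 0, x0, 1)" for x0,
    simplified, folded alg_law_def]
lemmas prob_space_sampler_law = prob_space_chain_law[OF measurable_sampler_kernel, of "(0, 0, x0, 1)" for x0,
    simplified, folded alg_law_def]
lemmas measurable_sampler_component = measurable_chain_law_component[OF measurable_sampler_kernel, of "(0, 0, x0, 1)" for x0,
    simplified, folded alg_law_def]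
lemmas nn_integral_sampler_initial = nn_integral_chain_law_initial[OF measurable_sampler_kernel, of "(0, 0, x0, 1)" for x0,
    simplified, folded alg_law_def]
lemmas nn_integral_sampler_step = nn_integral_chain_law_step[OF measurable_sampler_kernel, of "(0, 0, x0, 1)" for x0,
    simplified, folded alg_law_def]

lemma measurable_sampler_compose:
  "F \<in> borel_measurable state_space \<Longrightarrow> (\<lambda>\<tau>. F (\<tau> n)) \<in> borel_measurable (sampler_law B1 B2 x0 \<Delta>)"
  by (rule measurable_compose[OF measurable_sampler_component])

lemma measurable_alive_past: "alive n \<in> borel_measurable (\<Pi>\<^sub>M i\<in>{0..<Suc n}. state_space)"
proof -
  have "(\<lambda>\<tau>. safe (walk_part (\<tau> i))) \<in> borel_measurable (\<Pi>\<^sub>M i\<in>{0..<Suc n}. state_space)" if "i \<le> n" for i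
    using that by (intro measurable_compose[OF _ measurable_compose[OF measurable_walk_part measurable_safe]]
      measurable_component_singleton) auto
  then show ?thesis unfolding alive_def[abs_def] by (intro borel_measurable_prod_ennreal) auto
qed

lemma measurable_alive: "alive n \<in> borel_measurable (sampler_law B1 B2 x0 \<Delta>)"
  unfolding alive_def[abs_def]
  by (intro borel_measurable_prod_ennreal measurable_sampler_compose
    measurable_compose[OF measurable_walk_part measurable_safe])

lemma nn_integral_alive_step:
  assumes F: "F \<in> borel_measurable state_space"
  shows "(\<integral>\<^sup>+\<tau>. alive n \<tau> * F (\<tau> (Suc n)) \<partial>sampler_law B1 B2 x0 \<Delta>)
    = (\<integral>\<^sup>+\<tau>. alive n \<tau> * (\<integral>\<^sup>+q. F q \<partial>sampler_kernel B1 B2 \<Delta> (\<tau> n)) \<partial>sampler_law B1 B2 x0 \<Delta>)"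
proof -
  have "alive n (restrict \<tau> {0..<Suc n}) = alive n \<tau>" for \<tau> by (simp add: alive_eq)
  then show ?thesis by (intro nn_integral_sampler_step measurable_alive_past F)
qed

lemma AE_sampler_start: "AE \<tau> in sampler_law B1 B2 x0 \<Delta>. fst (snd (\<tau> 0)) \<le> 1"
proof -
  have "{q \<in> space state_space. fst (snd q) > 1} \<in> sets (state_space :: 's alg_state measure)"
    by measurable
  then have F: "indicator {q. fst (snd q) > 1} \<in> borel_measurable (state_space :: 's alg_state measure)" by simp
  have "(\<integral>\<^sup>+\<tau>. indicator {q. fst (snd q) > 1} (\<tau> 0) \<partial>sampler_law B1 B2 x0 \<Delta>) = 0"
    by (subst nn_integral_sampler_initial[OF F]) simp
  then have "AE \<tau> in sampler_law B1 B2 x0 \<Delta>. indicator {q. fst (snd q) > 1} (\<tau> 0) = (0 :: ennreal)"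
    by (subst (asm) nn_integral_0_iff_AE) (simp_all add: measurable_sampler_compose[OF F])
  then show ?thesis by eventually_elim (auto simp: indicator_def split: if_splits)
qed

lemma nn_integral_estimator:
  fixes g :: "real \<Rightarrow> ennreal"
  assumes g0: "g 0 = 0" and g: "g \<in> borel_measurable borel"
  shows "(\<integral>\<^sup>+\<tau>. g (estimator \<tau>) \<partial>sampler_law B1 B2 x0 \<Delta>)
    = (\<Sum>n. \<integral>\<^sup>+\<tau>. alive n \<tau> * (ruin (walk_part (\<tau> (Suc n))) * g (weight (\<tau> (Suc n)))) \<partial>sampler_law B1 B2 x0 \<Delta>)"
proof -
  let ?R = "sampler_law B1 B2 x0 \<Delta>"
  have F: "(\<lambda>q. ruin (walk_part q) * g (weight q)) \<in> borel_measurable (state_space :: 's alg_state measure)"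
    using measurable_compose[OF measurable_weight g] by measurable
  have "(\<lambda>\<tau>. alive n \<tau> * (ruin (walk_part (\<tau> (Suc n))) * g (weight (\<tau> (Suc n))))) \<in> borel_measurable ?R" for n
    by (intro borel_measurable_times_ennreal measurable_alive measurable_sampler_compose[OF F])
  moreover have "(\<integral>\<^sup>+\<tau>. g (estimator \<tau>) \<partial>?R)
      = (\<integral>\<^sup>+\<tau>. (\<Sum>n. alive n \<tau> * (ruin (walk_part (\<tau> (Suc n))) * g (weight (\<tau> (Suc n))))) \<partial>?R)"
    by (intro nn_integral_cong_AE eventually_mono[OF AE_sampler_start] estimator_expansion g0)
  ultimately show ?thesis by (simp add: nn_integral_suminf)
qed

text \<open>
The killed chain: survival has to be recorded only at the last time, since a state with
\<open>d > 1\<close> cannot return to \<open>d \<le> 1\<close> under the nominal dynamics.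
\<close>

lemma nn_integral_alive_weight:
  assumes \<Delta>: "0 \<le> \<Delta>" and f: "f \<in> borel_measurable walk_space"
  shows "(\<integral>\<^sup>+\<tau>. alive n \<tau> * (ennreal (weight (\<tau> n)) * f (walk_part (\<tau> n))) \<partial>sampler_law B1 B2 x0 \<Delta>)
    = (step \<Delta> ^^ n) (\<lambda>z. safe z * f z) (0, 0, x0)"
  using f
proof (induction n arbitrary: f)
  case 0
  note 0 [measurable]
  have F: "(\<lambda>q. safe (walk_part q) * (ennreal (weight q) * f (walk_part q))) \<in> borel_measurable state_space"
    by measurable
  show ?case
    using nn_integral_sampler_initial[OF F] by (simp add: alive_def walk_part_def weight_def)
next
  case (Suc n)
  note Suc.prems [measurable]
  have F: "(\<lambda>q. ennreal (weight q) * (safe (walk_part q) * f (walk_part q))) \<in> borel_measurable state_space"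
    by measurable
  have sf [measurable]: "(\<lambda>z. safe z * f z) \<in> borel_measurable walk_space" by measurable
  have "(\<integral>\<^sup>+\<tau>. alive (Suc n) \<tau> * (ennreal (weight (\<tau> (Suc n))) * f (walk_part (\<tau> (Suc n)))) \<partial>sampler_law B1 B2 x0 \<Delta>)
      = (\<integral>\<^sup>+\<tau>. alive n \<tau> * (ennreal (weight (\<tau> (Suc n))) * (safe (walk_part (\<tau> (Suc n))) * f (walk_part (\<tau> (Suc n))))) \<partial>sampler_law B1 B2 x0 \<Delta>)"
    by (simp add: alive_def ac_simps)
  also have "\<dots> = (\<integral>\<^sup>+\<tau>. alive n \<tau> * (ennreal (weight (\<tau> n)) * step \<Delta> (\<lambda>z. safe z * f z) (walk_part (\<tau> n))) \<partial>sampler_law B1 B2 x0 \<Delta>)"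
    unfolding nn_integral_alive_step[OF F] weighted_expectation_sampler[OF sf] ..
  also have "\<dots> = (step \<Delta> ^^ n) (\<lambda>z. safe z * step \<Delta> (\<lambda>z. safe z * f z) z) (0, 0, x0)"
    by (rule Suc.IH) measurable
  finally show ?case by (simp only: safe_step_safe[OF \<Delta>] funpow_step_Suc)
qed

text \<open>
The contribution of passage at time \<open>n + 1\<close> is the increment of the \<open>n\<close>-step ruin probability,
so the contributions telescope to \<open>hit\<close>.
\<close>

theorem expectation_estimator:
  assumes \<Delta>: "0 \<le> \<Delta>"
  shows "(\<integral>\<^sup>+\<tau>. ennreal (estimator \<tau>) \<partial>sampler_law B1 B2 x0 \<Delta>) = hit \<Delta> (0, 0, x0)"
proof -
  let ?R = "sampler_law B1 B2 x0 \<Delta>"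
  let ?c = "\<lambda>n. \<integral>\<^sup>+\<tau>. alive n \<tau> * (ruin (walk_part (\<tau> (Suc n))) * ennreal (weight (\<tau> (Suc n)))) \<partial>?R"
  have F: "(\<lambda>q. ennreal (weight q) * ruin (walk_part q)) \<in> borel_measurable (state_space :: 's alg_state measure)"
    by measurable
  have c: "?c n = (step \<Delta> ^^ n) (\<lambda>z. safe z * step \<Delta> ruin z) (0, 0, x0)" for n
  proof -
    have "?c n = (\<integral>\<^sup>+\<tau>. alive n \<tau> * (ennreal (weight (\<tau> n)) * step \<Delta> ruin (walk_part (\<tau> n))) \<partial>?R)"
      using nn_integral_alive_step[OF F, where n=n and ?B1.0=B1 and ?B2.0=B2 and ?x0.0=x0 and \<Delta>=\<Delta>]
      by (simp only: weighted_expectation_sampler[OF measurable_ruin] mult.commute[of "ruin _"])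
    also have "\<dots> = (step \<Delta> ^^ n) (\<lambda>z. safe z * step \<Delta> ruin z) (0, 0, x0)"
      by (rule nn_integral_alive_weight[OF \<Delta>]) measurable
    finally show ?thesis .
  qed
  have "(\<Sum>i<n. ?c i) = (step \<Delta> ^^ n) ruin (0, 0, x0)" for n
  proof (induction n)
    case (Suc n)
    have "(\<Sum>i<Suc n. ?c i) = (step \<Delta> ^^ n) (\<lambda>z. safe z * step \<Delta> ruin z + ruin z) (0, 0, x0)"
      unfolding sum.lessThan_Suc unfolding Suc unfolding c by (subst funpow_step_add) (simp_all add: add.commute)
    then show ?case by (simp only: safe_step_ruin[OF \<Delta>] funpow_step_Suc)
  qed (simp add: ruin_def)
  then have "(\<Sum>n. ?c n) = hit \<Delta> (0, 0, x0)"
    by (simp add: suminf_eq_SUP hit_def)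
  then show ?thesis
    by (subst nn_integral_estimator) simp_all
qed

lemma AE_weight_nonneg: "AE \<tau> in sampler_law B1 B2 x0 \<Delta>. 0 \<le> weight (\<tau> n)"
proof (induction n)
  case 0
  have "{q \<in> space state_space. weight q < 0} \<in> sets (state_space :: 's alg_state measure)" by measurable
  then have F: "indicator {q. weight q < 0} \<in> borel_measurable (state_space :: 's alg_state measure)" by simp
  have "(\<integral>\<^sup>+\<tau>. indicator {q. weight q < 0} (\<tau> 0) \<partial>sampler_law B1 B2 x0 \<Delta>) = 0"
    by (subst nn_integral_sampler_initial[OF F]) (simp add: weight_def)
  then have "AE \<tau> in sampler_law B1 B2 x0 \<Delta>. indicator {q. weight q < 0} (\<tau> 0) = (0 :: ennreal)"
    by (subst (asm) nn_integral_0_iff_AE) (simp_all add: measurable_sampler_compose[OF F])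
  then show ?case by eventually_elim (auto simp: indicator_def split: if_splits)
next
  case (Suc n)
  have "{q \<in> space state_space. weight q < 0} \<in> sets (state_space :: 's alg_state measure)" by measurable
  then have F: "indicator {q. weight q < 0} \<in> borel_measurable (state_space :: 's alg_state measure)" by simp
  have "(\<integral>\<^sup>+\<tau>. 1 * indicator {q. weight q < 0} (\<tau> (Suc n)) \<partial>sampler_law B1 B2 x0 \<Delta>)
      = (\<integral>\<^sup>+\<tau>. 1 * (\<integral>\<^sup>+q. indicator {q. weight q < 0} q \<partial>sampler_kernel B1 B2 \<Delta> (\<tau> n)) \<partial>sampler_law B1 B2 x0 \<Delta>)"
    by (rule nn_integral_sampler_step) (simp_all add: F)
  also have "\<dots> = (\<integral>\<^sup>+\<tau>. 0 \<partial>sampler_law B1 B2 x0 \<Delta>)"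
    using Suc by (intro nn_integral_cong_AE) (auto elim!: eventually_mono simp: weight_nonneg_sampler)
  finally have "AE \<tau> in sampler_law B1 B2 x0 \<Delta>. indicator {q. weight q < 0} (\<tau> (Suc n)) = (0 :: ennreal)"
    by (simp add: nn_integral_0_iff_AE measurable_sampler_compose[OF F])
  then show ?case by eventually_elim (auto simp: indicator_def split: if_splits)
qed

lemma AE_estimator_nonneg: "AE \<tau> in sampler_law B1 B2 x0 \<Delta>. 0 \<le> estimator \<tau>"
proof -
  have "AE \<tau> in sampler_law B1 B2 x0 \<Delta>. \<forall>n. 0 \<le> weight (\<tau> n)"
    by (simp add: AE_all_countable AE_weight_nonneg)
  then show ?thesis
    by eventually_elim (auto simp: estimator_def weight_def case_prod_unfold split: enat.split)
qed

text \<open>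
A Lyapunov bound. By the two kernel inequalities the expectation of squared weight times \<open>h\<close> on
survival does not increase, and at ruin, where \<open>h \<ge> 1\<close>, the squared weight is paid out of it.
\<close>

theorem second_moment_estimator_le:
  assumes h: "h \<in> borel_measurable walk_space"
    and exit: "\<And>z. 1 < fst (snd z) \<Longrightarrow> 1 \<le> h z"
    and tilted: "\<And>z. z \<in> tilt_region u \<theta>s B1 B2 \<Delta> \<Longrightarrow>
      ennreal (harmonic z) * step \<Delta> (\<lambda>z. ennreal (1 / harmonic z) * h z) z \<le> h z"
    and nominal: "\<And>z. z \<notin> tilt_region u \<theta>s B1 B2 \<Delta> \<Longrightarrow> step \<Delta> h z \<le> h z"
  shows "(\<integral>\<^sup>+\<tau>. ennreal ((estimator \<tau>)\<^sup>2) \<partial>sampler_law B1 B2 x0 \<Delta>) \<le> h (0, 0, x0)"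
proof -
  note h [measurable]
  let ?R = "sampler_law B1 B2 x0 \<Delta>"
  let ?c = "\<lambda>n. \<integral>\<^sup>+\<tau>. alive n \<tau> * (ruin (walk_part (\<tau> (Suc n))) * ennreal ((weight (\<tau> (Suc n)))\<^sup>2)) \<partial>?R"
  let ?F = "\<lambda>q. ennreal ((weight q)\<^sup>2) * h (walk_part q)"
  let ?b = "\<lambda>n. \<integral>\<^sup>+\<tau>. alive n \<tau> * ?F (\<tau> n) \<partial>?R"
  have F: "?F \<in> borel_measurable state_space" by measurable
  have kernel: "(\<integral>\<^sup>+q'. ?F q' \<partial>sampler_kernel B1 B2 \<Delta> q) \<le> ?F q" for q
  proof (cases "walk_part q \<in> tilt_region u \<theta>s B1 B2 \<Delta>")
    case True
    show ?thesis unfolding squared_weight_expectation_sampler_tilted[OF h True]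
      by (rule mult_left_mono[OF tilted[OF True]]) simp
  next
    case False
    show ?thesis unfolding squared_weight_expectation_sampler_nominal[OF h False]
      by (rule mult_left_mono[OF nominal[OF False]]) simp
  qed
  have G: "(\<lambda>q. ruin (walk_part q) * ennreal ((weight q)\<^sup>2)) \<in> borel_measurable (state_space :: 's alg_state measure)"
    "(\<lambda>q. safe (walk_part q) * ?F q) \<in> borel_measurable (state_space :: 's alg_state measure)"
    by measurable
  have decrease: "?c n + ?b (Suc n) \<le> ?b n" for n
  proof -
    have "?b (Suc n) = (\<integral>\<^sup>+\<tau>. alive n \<tau> * (safe (walk_part (\<tau> (Suc n))) * ?F (\<tau> (Suc n))) \<partial>?R)"
      by (simp add: alive_def ac_simps)
    then have "?c n + ?b (Suc n) = (\<integral>\<^sup>+\<tau>. alive n \<tau> * (ruin (walk_part (\<tau> (Suc n))) * ennreal ((weight (\<tau> (Suc n)))\<^sup>2))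
        + alive n \<tau> * (safe (walk_part (\<tau> (Suc n))) * ?F (\<tau> (Suc n))) \<partial>?R)"
      by (subst nn_integral_add) (auto intro!: borel_measurable_times_ennreal measurable_alive
          measurable_sampler_compose[OF G(1)] measurable_sampler_compose[OF G(2)])
    also have "\<dots> \<le> (\<integral>\<^sup>+\<tau>. alive n \<tau> * ?F (\<tau> (Suc n)) \<partial>?R)"
    proof (rule nn_integral_mono)
      fix \<tau> :: "nat \<Rightarrow> 's alg_state"
      let ?q = "\<tau> (Suc n)"
      have "ruin (walk_part ?q) * ennreal ((weight ?q)\<^sup>2) + safe (walk_part ?q) * ?F ?q \<le> ?F ?q"
      proof (cases "1 < fst (snd (walk_part ?q))")
        case True
        then show ?thesis using mult_left_mono[OF exit[OF True], of "ennreal ((weight ?q)\<^sup>2)"]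
          by (simp add: ruin_def safe_def)
      qed (simp add: ruin_def safe_def)
      then show "alive n \<tau> * (ruin (walk_part ?q) * ennreal ((weight ?q)\<^sup>2)) + alive n \<tau> * (safe (walk_part ?q) * ?F ?q)
          \<le> alive n \<tau> * ?F ?q"
        by (simp add: distrib_left[symmetric] mult_left_mono)
    qed
    also have "\<dots> = (\<integral>\<^sup>+\<tau>. alive n \<tau> * (\<integral>\<^sup>+q'. ?F q' \<partial>sampler_kernel B1 B2 \<Delta> (\<tau> n)) \<partial>?R)"
      by (rule nn_integral_alive_step[OF F])
    also have "\<dots> \<le> ?b n"
      by (intro nn_integral_mono mult_left_mono kernel) simp
    finally show ?thesis .
  qed
  have "(\<Sum>i<n. ?c i) + ?b n \<le> h (0, 0, x0)" for n
  proof (induction n)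
    case 0
    have F0: "(\<lambda>q. safe (walk_part q) * ?F q) \<in> borel_measurable (state_space :: 's alg_state measure)"
      by measurable
    show ?case using nn_integral_sampler_initial[OF F0, where ?x0.0=x0]
      by (simp add: alive_def safe_def walk_part_def weight_def)
  next
    case (Suc n)
    have "(\<Sum>i<Suc n. ?c i) + ?b (Suc n) = (\<Sum>i<n. ?c i) + (?c n + ?b (Suc n))" by (simp add: add.assoc)
    also have "\<dots> \<le> (\<Sum>i<n. ?c i) + ?b n" by (rule add_left_mono[OF decrease])
    finally show ?case using Suc by (rule order_trans)
  qed
  then have "(\<Sum>n. ?c n) \<le> h (0, 0, x0)"
    unfolding suminf_eq_SUP by (intro SUP_least) (meson add_increasing2 order_trans zero_le le_iff_add)
  then show ?thesis
    by (subst nn_integral_estimator[where g="\<lambda>x. ennreal (x\<^sup>2)"]) simp_all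
qed

end

section \<open>The Lyapunov function of the sampler\<close>

context nominal_kernel begin

lemma measurable_fun_state: "(\<lambda>z. (f :: 's \<Rightarrow> real) (snd (snd z))) \<in> borel_measurable walk_space"
  by (rule measurable_compose[OF measurable_walk_space_components(3)]) simp

text \<open>
An eigenvector of the tilted matrix turns into an eigenfunction \<open>exp (\<theta> * s) * v x\<close> of the
transition operator with the same eigenvalue.
\<close>

lemma step_exponential:
  assumes fin: "chi_finite \<nu> \<gamma> \<theta>" and v: "\<And>x. 0 \<le> v x"
    and eig: "\<And>x. (\<Sum>y\<in>UNIV. Qmat K \<nu> \<gamma> \<theta> x y * v y) = r * v x"
  shows "(\<Sum>y\<in>UNIV. ennreal (K x y) * (\<integral>\<^sup>+p. ennreal (exp (\<theta> * \<gamma> y (fst p)) * v y) \<partial>\<nu>)) = ennreal (r * v x)"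
proof -
  have "(\<integral>\<^sup>+p. ennreal (exp (\<theta> * \<gamma> y (fst p)) * v y) \<partial>\<nu>) = ennreal (exp (chi \<nu> \<gamma> y \<theta>)) * ennreal (v y)" for y
    using v by (simp add: ennreal_mult nn_integral_multc nn_integral_exp_increment[OF fin])
  then have "(\<Sum>y\<in>UNIV. ennreal (K x y) * (\<integral>\<^sup>+p. ennreal (exp (\<theta> * \<gamma> y (fst p)) * v y) \<partial>\<nu>))
      = (\<Sum>y\<in>UNIV. ennreal (Qmat K \<nu> \<gamma> \<theta> x y * v y))"
    using v K_nonneg by (simp add: ennreal_mult[symmetric] Qmat_def mult.assoc)
  also have "\<dots> = ennreal (\<Sum>y\<in>UNIV. Qmat K \<nu> \<gamma> \<theta> x y * v y)"
    using v K_nonneg by (intro sum_ennreal) (simp add: Qmat_def)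
  finally show ?thesis by (simp add: eig)
qed

end

text \<open>
The choice of \<open>cfun\<close> is made for this identity: Markov's inequality for a jump larger than the
proportion \<open>B1 * rho \<Delta>\<close> then costs a factor \<open>rho \<Delta>\<close>, the order of the gain
\<open>1 - exp (psi (\<theta>s - rho \<Delta>))\<close> that has to pay for it.
\<close>

lemma cfun_rho_powr:
  assumes "0 < B1" "0 < B2" "0 < rho \<Delta>" "rho \<Delta> < \<theta>s"
  shows "(cfun \<theta>s B1 B2 \<Delta> * (B1 * rho \<Delta>)) powr (2 * \<theta>s - rho \<Delta>) = B2 powr (2 * \<theta>s - rho \<Delta>) / rho \<Delta>"
proof -
  let ?r = "rho \<Delta>" and ?a = "2 * \<theta>s - rho \<Delta>"
  have a: "0 < ?a" using assms by simp
  have "?r powr (- (1 + 1 / ?a)) * ?r = ?r powr (- (1 + 1 / ?a) + 1)"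
    unfolding powr_add[of ?r _ 1] using assms by simp
  also have "\<dots> = ?r powr (- (1 / ?a))" by simp
  finally have "cfun \<theta>s B1 B2 \<Delta> * (B1 * ?r) = B2 * ?r powr (- (1 / ?a))"
    using assms unfolding cfun_def by (simp add: field_simps)
  then have "(cfun \<theta>s B1 B2 \<Delta> * (B1 * ?r)) powr ?a = B2 powr ?a * ?r powr (- (1 / ?a) * ?a)"
    using assms by (simp add: powr_mult powr_powr)
  also have "- (1 / ?a) * ?a = - 1" using a by simp
  finally show ?thesis using assms by (simp add: powr_minus divide_inverse)
qed

context tilted_sampler begin

text \<open>
The function \<open>hfun\<close> is a Lyapunov function for the squared weight. Outside the tilt region it
equals 1, its maximum, so the inequality is trivial. Inside, it equals its unbounded
expression, and the constant \<open>m\<close>, a lower bound of the eigenvectors, turns \<open>1 / u\<close> into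
\<open>u / m^2\<close> so that both contributions are multiples of \<open>hfun\<close> itself.
\<close>

lemma second_moment_sampler_le_hfun:
  assumes \<Delta>: "0 < \<Delta>" and \<rho>: "0 < rho \<Delta>" "rho \<Delta> < \<theta>s" and B: "0 < B1" "0 < B2" "B1 * rho \<Delta> < 1"
    and fin: "chi_finite \<nu> \<gamma> (\<theta>s - rho \<Delta>)"
    and eig: "\<And>x. (\<Sum>y\<in>UNIV. Qmat K \<nu> \<gamma> (\<theta>s - rho \<Delta>) x y * u (\<theta>s - rho \<Delta>) y) = r * u (\<theta>s - rho \<Delta>) x"
    and m: "0 < m" "\<And>x. m \<le> u \<theta>s x" "\<And>x. m \<le> u (\<theta>s - rho \<Delta>) x"
    and b2: "0 \<le> b2" "\<And>x. (\<Sum>y\<in>UNIV. ennreal (K x y) * (\<integral>\<^sup>+p. ennreal (lam y (snd p) powr (2 * \<theta>s - rho \<Delta>)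
        * exp ((\<theta>s - rho \<Delta>) * \<gamma> y (fst p))) \<partial>\<nu>)) \<le> ennreal b2"
    and r: "0 \<le> r"
    and selection: "1 / m\<^sup>2 * b2 * rho \<Delta> / B2 powr (2 * \<theta>s - rho \<Delta>) + r / (1 - B1 * rho \<Delta>) powr (2 * \<theta>s - rho \<Delta>) \<le> 1"
  shows "(\<integral>\<^sup>+\<tau>. ennreal ((estimator \<tau>)\<^sup>2) \<partial>sampler_law B1 B2 x0 \<Delta>) \<le> ennreal (hfun u \<theta>s B1 B2 \<Delta> (0, 0, x0))"
proof (rule second_moment_estimator_le)
  let ?\<rho> = "rho \<Delta>" and ?h = "hfun u \<theta>s B1 B2 \<Delta>" and ?c = "cfun \<theta>s B1 B2 \<Delta>"
  let ?v = "u (\<theta>s - rho \<Delta>)"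
  define a where "a = 2 * \<theta>s - ?\<rho>"
  define e where "e = B1 * ?\<rho>"
  have a: "0 < a" and a_\<theta>: "a = \<theta>s + (\<theta>s - ?\<rho>)" using \<rho> unfolding a_def by simp_all
  have e: "0 < e" "e < 1" using B \<rho> unfolding e_def by simp_all
  have c: "0 < ?c" using B \<rho> unfolding cfun_def by simp
  have ce: "(?c * e) powr a = B2 powr a / ?\<rho>" unfolding e_def a_def by (rule cfun_rho_powr) (use B \<rho> in auto)
  have v: "0 < ?v x" for x using m(1) m(3)[of x] by linarith
  have h_le1: "?h z \<le> 1" for z by (simp add: hfun_def split: prod.splits)
  show "(\<lambda>z. ennreal (?h z)) \<in> borel_measurable walk_space" using measurable_hfun by measurable
  show "1 \<le> ennreal (?h z)" if "1 < fst (snd z)" for z using that by (auto simp: hfun_def split: prod.splits)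
  show "step \<Delta> (\<lambda>z. ennreal (?h z)) z \<le> ennreal (?h z)" if "z \<notin> tilt_region u \<theta>s B1 B2 \<Delta>" for z
  proof -
    have "?h z = 1" using that h_le1[of z] by (simp add: tilt_region_def)
    moreover have "step \<Delta> (\<lambda>z. ennreal (?h z)) z \<le> step \<Delta> (\<lambda>_. 1) z"
      by (intro step_mono) (simp add: h_le1)
    ultimately show ?thesis by (simp add: step_const)
  qed
  show "ennreal (harmonic z) * step \<Delta> (\<lambda>z. ennreal (1 / harmonic z) * ennreal (?h z)) z \<le> ennreal (?h z)"
    if "z \<in> tilt_region u \<theta>s B1 B2 \<Delta>" for z
  proof -
    obtain s d x where z: "z = (s, d, x)" by (cases z) auto
    have hz1: "?h (s, d, x) < 1" using that by (simp add: tilt_region_def z)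
    then have d: "d < 1" by (auto simp: hfun_def split: if_splits)
    define A where "A = ?c powr a * exp (a * s) * (\<Delta> / (1 - d)) powr a"
    have A: "0 < A" using c \<Delta> d by (simp add: A_def)
    have hz: "?h (s, d, x) = A * u \<theta>s x * ?v x"
      using hz1 d unfolding hfun_def A_def a_def by (auto simp: min_def split: if_splits)
    define C1 where "C1 = exp (- \<theta>s * s) * (A / (1 - e) powr a)"
    define C2 where "C2 = exp (- \<theta>s * s) * (A * ?\<rho> / B2 powr a / m)"
    have C: "0 \<le> C1" "0 \<le> C2" using A e B \<rho> m(1) by (simp_all add: C1_def C2_def)
    have pointwise: "?h (move \<Delta> z y p) / harmonic (move \<Delta> z y p) \<le>
        C1 * (exp ((\<theta>s - ?\<rho>) * \<gamma> y (fst p)) * ?v y) + C2 * (lam y (snd p) powr a * exp ((\<theta>s - ?\<rho>) * \<gamma> y (fst p)))"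
      for y p
    proof -
      define g where "g = \<gamma> y (fst p)"
      define l where "l = lam y (snd p)"
      have l: "0 \<le> l" unfolding l_def by (rule lam_nonneg)
      have mv: "move \<Delta> z y p = (s + g, d + \<Delta> * l * exp (s + g), y)" by (simp add: move_def z g_def l_def)
      have harm: "harmonic (move \<Delta> z y p) = exp (\<theta>s * s) * exp (\<theta>s * g) * u \<theta>s y"
        unfolding mv by (simp add: harmonic_def exp_add distrib_left)
      have uy: "0 < u \<theta>s y" by (rule u_\<theta>s_pos)
      have exp_a: "exp (a * g) = exp (\<theta>s * g) * exp ((\<theta>s - ?\<rho>) * g)"
        unfolding a_\<theta> by (simp add: exp_add[symmetric] algebra_simps)
      have nn: "0 \<le> C1 * (exp ((\<theta>s - ?\<rho>) * g) * ?v y)" "0 \<le> C2 * (l powr a * exp ((\<theta>s - ?\<rho>) * g))"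
        using C v[of y] by (simp_all add: less_imp_le)
      show ?thesis
      \<comment> \<open>A small jump leaves at least the proportion \<open>1 - e\<close> of the remaining distance; for a large one \<open>?h \<le> 1\<close> is multiplied by a power of a number that is at least 1.\<close>
      proof (cases "\<Delta> * l * exp (s + g) \<le> (1 - d) * e")
        case True
        let ?d' = "d + \<Delta> * l * exp (s + g)"
        have d': "(1 - d) * (1 - e) \<le> 1 - ?d'" using True by (simp add: algebra_simps)
        have pos: "0 < (1 - d) * (1 - e)" using d e by simp
        have d'1: "?d' < 1" using d' pos by linarith
        have "?h (s + g, ?d', y) \<le> ?c powr a * exp (a * (s + g)) * (\<Delta> / (1 - ?d')) powr a * u \<theta>s y * ?v y"
          using d'1 by (simp add: hfun_def a_def)
        also have "\<dots> \<le> ?c powr a * exp (a * (s + g)) * (\<Delta> / ((1 - d) * (1 - e))) powr a * u \<theta>s y * ?v y"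
          using d' pos \<Delta> a uy v[of y] d'1
          by (intro mult_right_mono mult_left_mono powr_mono2 divide_left_mono) (auto simp: less_imp_le)
        also have "(\<Delta> / ((1 - d) * (1 - e))) powr a = (\<Delta> / (1 - d)) powr a / (1 - e) powr a"
          using \<Delta> d e by (simp add: powr_divide powr_mult)
        also have "?c powr a * exp (a * (s + g)) * ((\<Delta> / (1 - d)) powr a / (1 - e) powr a) * u \<theta>s y * ?v y
            = (A / (1 - e) powr a) * exp (a * g) * u \<theta>s y * ?v y"
          by (simp add: A_def exp_add distrib_left)
        finally have "?h (move \<Delta> z y p) / harmonic (move \<Delta> z y p)
            \<le> (A / (1 - e) powr a) * exp (a * g) * u \<theta>s y * ?v y / harmonic (move \<Delta> z y p)"
          unfolding mv by (rule divide_right_mono) (simp add: harmonic_pos less_imp_le)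
        also have "\<dots> = C1 * (exp ((\<theta>s - ?\<rho>) * g) * ?v y)"
          unfolding harm exp_a C1_def using uy by (simp add: exp_minus field_simps)
        finally show ?thesis using nn unfolding g_def l_def by linarith
      next
        case False
        then have big: "1 \<le> \<Delta> * l * exp (s + g) / ((1 - d) * e)" using d e by (simp add: field_simps)
        have "?h (move \<Delta> z y p) \<le> (\<Delta> * l * exp (s + g) / ((1 - d) * e)) powr a"
          using h_le1[of "move \<Delta> z y p"] ge_one_powr_ge_zero[OF big, of a] a by linarith
        also have "\<Delta> * l * exp (s + g) / ((1 - d) * e) = (?c * (\<Delta> / (1 - d)) * (l * exp s * exp g)) / (?c * e)"
          using c d e by (simp add: exp_add field_simps)
        also have "\<dots> powr a = (?c * (\<Delta> / (1 - d)) * (l * exp s * exp g)) powr a * (?\<rho> / B2 powr a)"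
          using c \<Delta> d e l by (subst powr_divide) (simp_all add: ce)
        also have "(?c * (\<Delta> / (1 - d)) * (l * exp s * exp g)) powr a = A * (l powr a * exp (a * g))"
        proof -
          define Q where "Q = \<Delta> / (1 - d)"
          have "0 < Q" using \<Delta> d by (simp add: Q_def)
          moreover have "exp t powr a = exp (a * t)" for t by (simp add: powr_def)
          ultimately show ?thesis
            unfolding A_def Q_def[symmetric] using c l by (simp add: powr_mult ac_simps)
        qed
        finally have "?h (move \<Delta> z y p) / harmonic (move \<Delta> z y p)
            \<le> A * (l powr a * exp (a * g)) * (?\<rho> / B2 powr a) / harmonic (move \<Delta> z y p)"
          by (rule divide_right_mono) (simp add: harmonic_pos less_imp_le)
        also have "\<dots> = exp (- \<theta>s * s) * (A * ?\<rho> / B2 powr a) * (l powr a * exp ((\<theta>s - ?\<rho>) * g)) / u \<theta>s y"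
          unfolding harm exp_a using uy by (simp add: exp_minus field_simps)
        also have "\<dots> \<le> exp (- \<theta>s * s) * (A * ?\<rho> / B2 powr a) * (l powr a * exp ((\<theta>s - ?\<rho>) * g)) / m"
          using m(1) m(2)[of y] A \<rho> by (intro divide_left_mono) (auto simp: mult_pos_pos uy intro!: mult_nonneg_nonneg)
        also have "\<dots> = C2 * (l powr a * exp ((\<theta>s - ?\<rho>) * g))" by (simp add: C2_def)
        finally show ?thesis using nn unfolding g_def l_def by linarith
      qed
    qed
    let ?E1 = "\<Sum>y\<in>UNIV. ennreal (K x y) * (\<integral>\<^sup>+p. ennreal (exp ((\<theta>s - ?\<rho>) * \<gamma> y (fst p)) * ?v y) \<partial>\<nu>)"
    let ?E2 = "\<Sum>y\<in>UNIV. ennreal (K x y) * (\<integral>\<^sup>+p. ennreal (lam y (snd p) powr a * exp ((\<theta>s - ?\<rho>) * \<gamma> y (fst p))) \<partial>\<nu>)"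
    have "step \<Delta> (\<lambda>z. ennreal (1 / harmonic z) * ennreal (?h z)) z
        \<le> (\<Sum>y\<in>UNIV. ennreal (K x y) * (\<integral>\<^sup>+p. ennreal C1 * ennreal (exp ((\<theta>s - ?\<rho>) * \<gamma> y (fst p)) * ?v y)
          + ennreal C2 * ennreal (lam y (snd p) powr a * exp ((\<theta>s - ?\<rho>) * \<gamma> y (fst p))) \<partial>\<nu>))"
      unfolding step_def z snd_conv
    proof (intro sum_mono mult_left_mono nn_integral_mono)
      fix y p
      let ?z = "move \<Delta> (s, d, x) y p"
      have "ennreal (1 / harmonic ?z) * ennreal (?h ?z) = ennreal (?h ?z / harmonic ?z)"
        by (subst ennreal_mult'[symmetric]) (simp_all add: harmonic_pos less_imp_le)
      also have "\<dots> \<le> ennreal (C1 * (exp ((\<theta>s - ?\<rho>) * \<gamma> y (fst p)) * ?v y) + C2 * (lam y (snd p) powr a * exp ((\<theta>s - ?\<rho>) * \<gamma> y (fst p))))"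
        by (rule ennreal_leI[OF pointwise[unfolded z]])
      also have "\<dots> = ennreal C1 * ennreal (exp ((\<theta>s - ?\<rho>) * \<gamma> y (fst p)) * ?v y)
          + ennreal C2 * ennreal (lam y (snd p) powr a * exp ((\<theta>s - ?\<rho>) * \<gamma> y (fst p)))"
        using C v[of y] by (simp add: ennreal_mult less_imp_le)
      finally show "ennreal (1 / harmonic ?z) * ennreal (?h ?z) \<le> ennreal C1 * ennreal (exp ((\<theta>s - ?\<rho>) * \<gamma> y (fst p)) * ?v y)
          + ennreal C2 * ennreal (lam y (snd p) powr a * exp ((\<theta>s - ?\<rho>) * \<gamma> y (fst p)))" .
    qed simp
    also have "\<dots> = ennreal C1 * ?E1 + ennreal C2 * ?E2"
      by (simp add: nn_integral_add nn_integral_cmult distrib_left sum.distrib sum_distrib_left mult.left_commute)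
    also have "?E1 = ennreal (r * ?v x)"
      by (rule step_exponential[OF fin less_imp_le[OF v] eig])
    also have "ennreal C1 * ennreal (r * ?v x) + ennreal C2 * ?E2 \<le> ennreal C1 * ennreal (r * ?v x) + ennreal C2 * ennreal b2"
      using b2(2)[of x] unfolding a_def by (intro add_left_mono mult_left_mono) auto
    also have "\<dots> = ennreal (C1 * (r * ?v x) + C2 * b2)"
      using C r v[of x] b2(1) by (simp add: ennreal_mult less_imp_le)
    finally have "ennreal (harmonic z) * step \<Delta> (\<lambda>z. ennreal (1 / harmonic z) * ennreal (?h z)) z
        \<le> ennreal (harmonic z) * ennreal (C1 * (r * ?v x) + C2 * b2)"
      by (rule mult_left_mono) simp
    also have "\<dots> = ennreal (harmonic z * (C1 * (r * ?v x) + C2 * b2))"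
      by (subst ennreal_mult') (simp_all add: harmonic_pos less_imp_le)
    also have "\<dots> \<le> ennreal (?h z)"
    proof (rule ennreal_leI)
      have "exp (\<theta>s * s) * exp (- \<theta>s * s) = 1" by (simp add: exp_minus)
      then have "harmonic z * (C1 * (r * ?v x) + C2 * b2)
          = A * u \<theta>s x * (r / (1 - e) powr a * ?v x + b2 * ?\<rho> / B2 powr a * (1 / m))"
        unfolding harmonic_def z C1_def C2_def by (simp add: algebra_simps mult.left_commute)
      also have "\<dots> \<le> A * u \<theta>s x * (r / (1 - e) powr a * ?v x + b2 * ?\<rho> / B2 powr a * (1 / m\<^sup>2 * ?v x))"
      proof -
        \<comment> \<open>This produces the missing factor \<open>?v x\<close> of \<open>?h\<close> in the second term.\<close>
        have "1 / m = 1 / m\<^sup>2 * m" using m(1) by (simp add: power2_eq_square)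
        also have "\<dots> \<le> 1 / m\<^sup>2 * ?v x" using m(3)[of x] by (intro mult_left_mono) simp_all
        finally show ?thesis
          using A u_\<theta>s_pos[of x] b2(1) \<rho> by (intro mult_left_mono add_left_mono) (auto simp: less_imp_le)
      qed
      also have "\<dots> = A * u \<theta>s x * ?v x * (1 / m\<^sup>2 * b2 * ?\<rho> / B2 powr a + r / (1 - e) powr a)"
        by (simp add: algebra_simps)
      also have "\<dots> \<le> A * u \<theta>s x * ?v x * 1"
        using selection A u_\<theta>s_pos[of x] v[of x] unfolding a_def e_def
        by (intro mult_left_mono) (auto simp: less_imp_le)
      finally show "harmonic z * (C1 * (r * ?v x) + C2 * b2) \<le> ?h z" by (simp add: hz z)
    qed
    finally show ?thesis .
  qed
qed

end

section \<open>Potentials and ruin\<close>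

context nominal_kernel begin

lemma step_sum:
  "finite I \<Longrightarrow> (\<And>i. i \<in> I \<Longrightarrow> f i \<in> borel_measurable walk_space) \<Longrightarrow>
    step \<Delta> (\<lambda>z. \<Sum>i\<in>I. f i z) z = (\<Sum>i\<in>I. step \<Delta> (f i) z)"
proof (induction I rule: finite_induct)
  case empty
  then show ?case by (simp add: step_const)
next
  case (insert i I)
  have "(\<lambda>z. \<Sum>i\<in>I. f i z) \<in> borel_measurable walk_space"
    by (intro borel_measurable_sum insert.prems) simp
  then have "step \<Delta> (\<lambda>z. f i z + (\<Sum>i\<in>I. f i z)) z = step \<Delta> (f i) z + (\<Sum>i\<in>I. step \<Delta> (f i) z)"
    using insert by (subst step_add) auto
  then show ?case using insert.hyps by simp
qed

lemma step_suminf: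
  assumes [measurable]: "\<And>n. f n \<in> borel_measurable walk_space"
  shows "step \<Delta> (\<lambda>z. \<Sum>n. f n z) z = (\<Sum>n. step \<Delta> (f n) z)"
proof -
  have "step \<Delta> (\<lambda>z. SUP N. \<Sum>n<N. f n z) z = (SUP N. step \<Delta> (\<lambda>z. \<Sum>n<N. f n z) z)"
    by (intro step_SUP incseq_SucI le_funI) simp_all
  then show ?thesis by (simp add: suminf_eq_SUP step_sum)
qed

text \<open>
The expected sum of \<open>f\<close> along the first \<open>n\<close> states of the nominal chain.
\<close>

definition potential :: "real \<Rightarrow> nat \<Rightarrow> (real \<times> real \<times> 's \<Rightarrow> ennreal) \<Rightarrow> real \<times> real \<times> 's \<Rightarrow> ennreal" where
  "potential \<Delta> n f z = (\<Sum>i<n. (step \<Delta> ^^ i) f z)"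

lemma measurable_potential [measurable (raw)]:
  "f \<in> borel_measurable walk_space \<Longrightarrow> potential \<Delta> n f \<in> borel_measurable walk_space"
  unfolding potential_def[abs_def] by (intro borel_measurable_sum measurable_funpow_step)

lemma potential_0 [simp]: "potential \<Delta> 0 f z = 0"
  by (simp add: potential_def)

lemma potential_Suc:
  assumes [measurable]: "f \<in> borel_measurable walk_space"
  shows "potential \<Delta> (Suc n) f z = f z + step \<Delta> (potential \<Delta> n f) z"
  unfolding potential_def[abs_def] sum.lessThan_Suc_shift by (subst step_sum) simp_all

lemma potential_mono: "(\<And>z. f z \<le> g z) \<Longrightarrow> potential \<Delta> n f z \<le> potential \<Delta> n g z"
  unfolding potential_def by (intro sum_mono funpow_step_mono)

text \<open>
A nonnegative function whose expected decrease in one step is at least \<open>f\<close> bounds the total of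
all \<open>f\<close> collected along the way.
\<close>

lemma potential_le_superharmonic:
  assumes f: "f \<in> borel_measurable walk_space" and super: "\<And>z. step \<Delta> g z + f z \<le> g z"
  shows "potential \<Delta> n f z \<le> g z"
proof (induction n arbitrary: z)
  case (Suc n)
  have "potential \<Delta> (Suc n) f z \<le> f z + step \<Delta> g z"
    unfolding potential_Suc[OF f] by (intro add_left_mono step_mono Suc)
  also have "\<dots> \<le> g z" using super[of z] by (simp add: add.commute)
  finally show ?case .
qed simp

lemma le_potential_subharmonic:
  assumes f: "f \<in> borel_measurable walk_space" and g: "g \<in> borel_measurable walk_space"
    and sub: "\<And>z. g z \<le> step \<Delta> g z + f z"
  shows "g z \<le> potential \<Delta> n f z + (step \<Delta> ^^ n) g z"
proof (induction n arbitrary: z)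
  case (Suc n)
  note f [measurable] g [measurable]
  have "g z \<le> step \<Delta> g z + f z" by (rule sub)
  also have "\<dots> \<le> step \<Delta> (\<lambda>z. potential \<Delta> n f z + (step \<Delta> ^^ n) g z) z + f z"
    by (intro add_right_mono step_mono Suc)
  also have "\<dots> = potential \<Delta> (Suc n) f z + (step \<Delta> ^^ Suc n) g z"
    by (simp add: potential_Suc step_add ac_simps)
  finally show ?case .
qed simp

text \<open>
A potential is largest on the support of its charge: off the support it is an average of its
values one step later, exactly like the superharmonic function \<open>\<Psi>\<close>. The set \<open>S\<close> confines the
comparison to states that the chain does not leave.
\<close>

lemma potential_maximum_principle:
  assumes f: "f \<in> borel_measurable walk_space" and \<Psi>: "\<Psi> \<in> borel_measurable walk_space"
    and closed: "\<And>z y p. z \<in> S \<Longrightarrow> move \<Delta> z y p \<in> S"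
    and super: "\<And>z. z \<in> S \<Longrightarrow> step \<Delta> \<Psi> z \<le> \<Psi> z"
    and supp: "\<And>z n. z \<in> S \<Longrightarrow> f z \<noteq> 0 \<Longrightarrow> potential \<Delta> n f z \<le> c * \<Psi> z"
    and z: "z \<in> S"
  shows "potential \<Delta> n f z \<le> c * \<Psi> z"
  using z
proof (induction n arbitrary: z)
  case (Suc n)
  show ?case
  proof (cases "f z = 0")
    case True
    then have "potential \<Delta> (Suc n) f z = step \<Delta> (potential \<Delta> n f) z" by (simp add: potential_Suc[OF f])
    also have "\<dots> \<le> step \<Delta> (\<lambda>z. c * \<Psi> z) z" by (intro step_mono Suc.IH closed Suc.prems)
    also have "\<dots> = c * step \<Delta> \<Psi> z" by (rule step_cmult[OF \<Psi>])
    also have "\<dots> \<le> c * \<Psi> z" by (intro mult_left_mono super Suc.prems) simp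
    finally show ?thesis .
  qed (use supp Suc.prems in blast)
qed simp

lemma measurable_hit [measurable]: "hit \<Delta> \<in> borel_measurable walk_space"
  unfolding hit_def[abs_def] by (intro borel_measurable_SUP measurable_funpow_step measurable_ruin) simp

lemma incseq_funpow_step_ruin: "0 \<le> \<Delta> \<Longrightarrow> incseq (\<lambda>n. (step \<Delta> ^^ n) ruin)"
proof (rule incseq_SucI, rule le_funI)
  fix n z assume "0 \<le> \<Delta>"
  then show "(step \<Delta> ^^ n) ruin z \<le> (step \<Delta> ^^ Suc n) ruin z"
    unfolding funpow_step_Suc by (intro funpow_step_mono ruin_le_step)
qed

lemma step_hit: "0 \<le> \<Delta> \<Longrightarrow> step \<Delta> (hit \<Delta>) z = hit \<Delta> z"
proof -
  assume \<Delta>: "0 \<le> \<Delta>"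
  have "step \<Delta> (hit \<Delta>) z = (SUP n. (step \<Delta> ^^ Suc n) ruin z)"
    unfolding hit_def[abs_def] using incseq_funpow_step_ruin[OF \<Delta>]
    by (subst step_SUP) (simp_all add: measurable_funpow_step)
  also have "\<dots> = hit \<Delta> z"
    unfolding hit_def
  proof (rule antisym)
    show "(SUP n. (step \<Delta> ^^ Suc n) ruin z) \<le> (SUP n. (step \<Delta> ^^ n) ruin z)"
      by (rule SUP_mono) blast
    show "(SUP n. (step \<Delta> ^^ n) ruin z) \<le> (SUP n. (step \<Delta> ^^ Suc n) ruin z)"
      using incseq_SucD[OF incseq_funpow_step_ruin[OF \<Delta>]] by (intro SUP_mono) (auto simp: le_fun_def simp del: funpow.simps split_paired_All)
  qed
  finally show ?thesis .
qed

lemma ruin_le_hit: "ruin z \<le> hit \<Delta> z"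
  unfolding hit_def by (rule SUP_upper2[of 0]) simp_all

end

section \<open>Renewal estimates under the exponential change of measure\<close>

text \<open>
The constants are parameters, so that all bounds derived from them are visibly independent of
\<open>\<Delta>\<close>. The function \<open>v\<close> is the eigenvector at \<open>\<theta> - \<delta>\<close>, with eigenvalue
\<open>q < 1\<close>: under the change of measure by \<open>w\<close> this expresses that the walk drifts upwards.
A finite moment at \<open>\<theta> + \<delta>\<close> controls jumps across the band.
\<close>

locale cramer_walk = nominal_kernel K \<nu> \<gamma> lam
  for K :: "'s::finite \<Rightarrow> 's \<Rightarrow> real" and \<nu> \<gamma> lam +
  fixes \<theta> \<delta> q lo hi C :: real and u v :: "'s \<Rightarrow> real"
  assumes \<delta>: "0 < \<delta>" and q: "0 \<le> q" "q < 1" and C: "0 \<le> C"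
    and u: "0 < u x" and lo: "0 < lo" and v: "lo * u x \<le> v x" "v x \<le> hi * u x"
    and tilt_0: "(\<Sum>y\<in>UNIV. ennreal (K x y) * (\<integral>\<^sup>+p. ennreal (exp (\<theta> * \<gamma> y (fst p)) * u y) \<partial>\<nu>)) = ennreal (u x)"
    and tilt_down: "(\<Sum>y\<in>UNIV. ennreal (K x y) * (\<integral>\<^sup>+p. ennreal (exp ((\<theta> - \<delta>) * \<gamma> y (fst p)) * v y) \<partial>\<nu>)) = ennreal (q * v x)"
    and tilt_up: "(\<Sum>y\<in>UNIV. ennreal (K x y) * (\<integral>\<^sup>+p. ennreal (exp ((\<theta> + \<delta>) * \<gamma> y (fst p)) * u y) \<partial>\<nu>)) \<le> ennreal (C * u x)"
begin

definition w :: "real \<times> real \<times> 's \<Rightarrow> real" where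
  "w z = exp (\<theta> * fst z) * u (snd (snd z))"

lemma v_pos: "0 < v x"
  using mult_pos_pos[OF lo u[of x]] v(1)[of x] by linarith

lemma hi_ge: "lo \<le> hi"
proof -
  have "lo * u undefined \<le> hi * u undefined" using v by (rule order_trans)
  then show ?thesis using u[of undefined] by simp
qed

lemma w_pos: "0 < w z"
  unfolding w_def using u by simp

lemma measurable_exponential:
  fixes f :: "'s \<Rightarrow> real"
  shows "(\<lambda>z. exp (t * (fst z - b)) * f (snd (snd z))) \<in> borel_measurable walk_space"
proof -
  have [measurable]: "(\<lambda>z. f (snd (snd z))) \<in> borel_measurable walk_space"
    by (rule measurable_fun_state)
  show ?thesis by measurable
qed

lemma measurable_w [measurable]: "w \<in> borel_measurable walk_space"
  using measurable_exponential[of \<theta> 0 u] by (simp add: w_def[abs_def])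

lemma step_exp_shift:
  assumes f: "\<And>x. 0 \<le> f x"
  shows "step \<Delta> (\<lambda>z. ennreal (exp (t * (fst z - b)) * f (snd (snd z)))) z
    = ennreal (exp (t * (fst z - b))) * (\<Sum>y\<in>UNIV. ennreal (K (snd (snd z)) y) * (\<integral>\<^sup>+p. ennreal (exp (t * \<gamma> y (fst p)) * f y) \<partial>\<nu>))"
proof -
  have eq: "ennreal (exp (t * (fst (move \<Delta> z y p) - b)) * f (snd (snd (move \<Delta> z y p))))
      = ennreal (exp (t * (fst z - b))) * ennreal (exp (t * \<gamma> y (fst p)) * f y)" for y p
  proof -
    have "exp (t * (fst z + \<gamma> y (fst p) - b)) = exp (t * (fst z - b)) * exp (t * \<gamma> y (fst p))"
      by (simp add: exp_add[symmetric] algebra_simps)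
    then show ?thesis using f by (subst ennreal_mult[symmetric]) (simp_all add: move_def)
  qed
  show ?thesis unfolding step_def eq
    by (simp add: nn_integral_cmult sum_distrib_left mult.left_commute)
qed

text \<open>
The eigenfunction at \<open>\<theta> - \<delta>\<close>, scaled so that it is comparable with \<open>w\<close> at level \<open>b\<close>; relative
to \<open>w\<close> it decays exponentially above \<open>b\<close>.
\<close>

definition down :: "real \<Rightarrow> real \<times> real \<times> 's \<Rightarrow> real" where
  "down b z = exp (\<delta> * b) * (exp ((\<theta> - \<delta>) * fst z) * v (snd (snd z)))"

lemma down_w: "down b z = exp (- \<delta> * (fst z - b)) * (v (snd (snd z)) / u (snd (snd z))) * w z"
proof -
  have "exp (\<delta> * b) * exp ((\<theta> - \<delta>) * fst z) = exp (- \<delta> * (fst z - b)) * exp (\<theta> * fst z)"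
    by (simp add: exp_add[symmetric] algebra_simps)
  then show ?thesis using u[of "snd (snd z)"] by (simp add: down_def w_def)
qed

lemma down_le: "down b z \<le> exp (- \<delta> * (fst z - b)) * hi * w z"
  unfolding down_w using u[of "snd (snd z)"] v(2) w_pos[of z]
  by (intro mult_right_mono mult_left_mono) (auto simp: pos_divide_le_eq less_imp_le)

lemma down_ge: "exp (- \<delta> * (fst z - b)) * lo * w z \<le> down b z"
  unfolding down_w using u[of "snd (snd z)"] v(1) w_pos[of z]
  by (intro mult_right_mono mult_left_mono) (auto simp: pos_le_divide_eq less_imp_le)

lemma down_nonneg: "0 \<le> down b z"
  unfolding down_def using v_pos by (simp add: less_imp_le)

lemma measurable_down [measurable]: "down b \<in> borel_measurable walk_space"
proof -
  have "(\<lambda>z. exp ((\<theta> - \<delta>) * fst z) * v (snd (snd z))) \<in> borel_measurable walk_space"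
    using measurable_exponential[of "\<theta> - \<delta>" 0 v] by simp
  then show ?thesis unfolding down_def[abs_def] by measurable
qed

lemma step_w: "step \<Delta> (\<lambda>z. ennreal (w z)) z = ennreal (w z)"
proof -
  have "step \<Delta> (\<lambda>z. ennreal (exp (\<theta> * (fst z - 0)) * u (snd (snd z)))) z
      = ennreal (exp (\<theta> * (fst z - 0))) * ennreal (u (snd (snd z)))"
    by (subst step_exp_shift[OF less_imp_le[OF u]]) (simp only: tilt_0)
  also have "\<dots> = ennreal (w z)" by (subst ennreal_mult'[symmetric]) (simp_all add: w_def)
  finally show ?thesis by (simp add: w_def)
qed

lemma step_down: "step \<Delta> (\<lambda>z. ennreal (down b z)) z = ennreal (q * down b z)"
proof -
  have down: "ennreal (exp (\<delta> * b)) * ennreal (exp ((\<theta> - \<delta>) * (fst z - 0)) * v (snd (snd z))) = ennreal (down b z)" for z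
    unfolding down_def diff_0_right by (rule ennreal_mult'[symmetric]) simp
  have "step \<Delta> (\<lambda>z. ennreal (exp (\<delta> * b)) * ennreal (exp ((\<theta> - \<delta>) * (fst z - 0)) * v (snd (snd z)))) z
      = ennreal (exp (\<delta> * b)) * step \<Delta> (\<lambda>z. ennreal (exp ((\<theta> - \<delta>) * (fst z - 0)) * v (snd (snd z)))) z"
    by (rule step_cmult[OF measurable_compose[OF measurable_exponential measurable_ennreal]])
  also have "step \<Delta> (\<lambda>z. ennreal (exp ((\<theta> - \<delta>) * (fst z - 0)) * v (snd (snd z)))) z
      = ennreal (exp ((\<theta> - \<delta>) * (fst z - 0))) * ennreal (q * v (snd (snd z)))"
    by (subst step_exp_shift[OF less_imp_le[OF v_pos]]) (simp only: tilt_down)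
  also have "\<dots> = ennreal q * ennreal (exp ((\<theta> - \<delta>) * (fst z - 0)) * v (snd (snd z)))"
    using q v_pos[of "snd (snd z)"] by (simp add: ennreal_mult[symmetric] less_imp_le mult.left_commute)
  also have "ennreal (exp (\<delta> * b)) * \<dots> = ennreal q * ennreal (down b z)"
    by (simp only: down[symmetric] mult.left_commute)
  finally show ?thesis using q down_nonneg[of b z] by (simp only: down ennreal_mult)
qed

text \<open>
As a minimum of two superharmonic functions it is superharmonic. Its one-step decrease is of the
order of \<open>w\<close> just above level \<open>b\<close> and exponentially small, relative to \<open>w\<close>, far away from \<open>b\<close>.
Hence it detects visits to the neighbourhood of \<open>b\<close>.
\<close>

definition barrier :: "real \<Rightarrow> real \<times> real \<times> 's \<Rightarrow> real" where
  "barrier b z = min (down b z) (hi * w z)"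

lemma down_pos: "0 < down b z"
  unfolding down_def using v_pos by simp

lemma hi_pos: "0 < hi"
  using lo hi_ge by simp

lemma barrier_nonneg: "0 \<le> barrier b z"
  unfolding barrier_def using down_pos[of b z] hi_pos w_pos[of z] by (simp add: less_imp_le)

lemma measurable_barrier [measurable]: "barrier b \<in> borel_measurable walk_space"
  unfolding barrier_def[abs_def] by measurable

lemma step_barrier_le_down: "step \<Delta> (\<lambda>z. ennreal (barrier b z)) z \<le> ennreal (q * down b z)"
  unfolding step_down[of \<Delta> b z, symmetric] by (intro step_mono ennreal_leI) (simp add: barrier_def)

lemma step_barrier_le_w: "step \<Delta> (\<lambda>z. ennreal (barrier b z)) z \<le> ennreal (hi * w z)"
proof -
  have "step \<Delta> (\<lambda>z. ennreal (barrier b z)) z \<le> step \<Delta> (\<lambda>z. ennreal hi * ennreal (w z)) z"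
    using hi_pos w_pos by (intro step_mono) (simp add: ennreal_mult[symmetric] less_imp_le barrier_def)
  also have "\<dots> = ennreal hi * ennreal (w z)" by (subst step_cmult) (simp_all add: step_w)
  finally show ?thesis using hi_pos w_pos[of z] by (simp add: ennreal_mult less_imp_le)
qed

text \<open>
A lower bound for the one-step decrease of the barrier, relative to \<open>w\<close>, on the unit window above
its level.
\<close>

definition \<kappa> :: real where "\<kappa> = (1 - q) * exp (- \<delta>) * lo"

lemma \<kappa>_pos: "0 < \<kappa>"
  unfolding \<kappa>_def using q lo by simp

definition window :: "real \<Rightarrow> real \<times> real \<times> 's \<Rightarrow> ennreal" where
  "window b z = (if b \<le> fst z \<and> fst z \<le> b + 1 then ennreal (w z) else 0)"

lemma measurable_window [measurable]: "window b \<in> borel_measurable walk_space"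
  unfolding window_def[abs_def] by measurable

definition majorant :: "real \<Rightarrow> real \<times> real \<times> 's \<Rightarrow> ennreal" where
  "majorant b z = ennreal (1 / \<kappa>) * ennreal (barrier b z)"

lemma measurable_majorant [measurable]: "majorant b \<in> borel_measurable walk_space"
  unfolding majorant_def[abs_def] by measurable

lemma majorant_le: "majorant b z \<le> ennreal (hi / \<kappa> * w z)"
  unfolding majorant_def using \<kappa>_pos barrier_nonneg[of b z]
  by (subst ennreal_mult[symmetric]) (auto intro!: ennreal_leI divide_right_mono simp: barrier_def less_imp_le)

text \<open>
On the window the barrier coincides with \<open>down b\<close>, which shrinks by the factor \<open>q\<close>; the
decrease \<open>(1 - q) * down b\<close> dominates \<open>\<kappa> * w\<close> there. So the number of visits to any window of
unit length is bounded, weighted by \<open>w\<close>, uniformly in the window.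
\<close>

lemma majorant_superharmonic: "step \<Delta> (majorant b) z + window b z \<le> majorant b z"
proof -
  have "step \<Delta> (\<lambda>z. ennreal (barrier b z)) z + ennreal \<kappa> * window b z \<le> ennreal (barrier b z)"
  proof (cases "b \<le> fst z \<and> fst z \<le> b + 1")
    case True
    have d: "down b z \<le> hi * w z"
    proof -
      have "exp (- \<delta> * (fst z - b)) \<le> 1" using True \<delta> by simp
      then have "exp (- \<delta> * (fst z - b)) * hi * w z \<le> 1 * hi * w z"
        using hi_pos w_pos[of z] by (intro mult_right_mono) (auto simp: less_imp_le)
      then show ?thesis using down_le[of b z] by simp
    qed
    have "exp (- \<delta>) \<le> exp (- \<delta> * (fst z - b))" using True \<delta> by (simp add: mult_left_le)
    then have "\<kappa> * w z \<le> (1 - q) * (exp (- \<delta> * (fst z - b)) * lo * w z)"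
      unfolding \<kappa>_def mult.assoc using q lo w_pos[of z]
      by (intro mult_left_mono mult_right_mono) (auto simp: less_imp_le)
    also have "\<dots> \<le> (1 - q) * down b z" using down_ge[of z b] q by (intro mult_left_mono) auto
    finally have *: "q * down b z + \<kappa> * w z \<le> barrier b z" using d by (simp add: barrier_def algebra_simps)
    have "step \<Delta> (\<lambda>z. ennreal (barrier b z)) z + ennreal \<kappa> * window b z \<le> ennreal (q * down b z) + ennreal (\<kappa> * w z)"
      using True step_barrier_le_down[of \<Delta> b z] \<kappa>_pos by (simp add: window_def ennreal_mult' less_imp_le)
    also have "\<dots> = ennreal (q * down b z + \<kappa> * w z)"
      using q down_pos[of b z] \<kappa>_pos w_pos[of z] by (simp add: less_imp_le)
    also have "\<dots> \<le> ennreal (barrier b z)" by (rule ennreal_leI[OF *])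
    finally show ?thesis .
  next
    case False
    have "q * down b z \<le> down b z" using q down_pos[of b z] by (simp add: mult_left_le_one_le)
    then have "step \<Delta> (\<lambda>z. ennreal (barrier b z)) z \<le> ennreal (down b z)"
      using step_barrier_le_down[of \<Delta> b z] by (meson ennreal_leI order_trans)
    then have "step \<Delta> (\<lambda>z. ennreal (barrier b z)) z \<le> ennreal (barrier b z)"
      using step_barrier_le_w[of \<Delta> b z] by (simp add: barrier_def min_def)
    moreover have "window b z = 0" using False unfolding window_def by (simp only: if_False)
    ultimately show ?thesis by simp
  qed
  then have "ennreal (1 / \<kappa>) * (step \<Delta> (\<lambda>z. ennreal (barrier b z)) z + ennreal \<kappa> * window b z) \<le> majorant b z"
    unfolding majorant_def by (rule mult_left_mono) simp
  moreover have "ennreal (1 / \<kappa>) * (ennreal \<kappa> * t) = t" for t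
    using \<kappa>_pos by (simp add: mult.assoc[symmetric] ennreal_mult[symmetric] less_imp_le)
  moreover have "step \<Delta> (majorant b) z = ennreal (1 / \<kappa>) * step \<Delta> (\<lambda>z. ennreal (barrier b z)) z"
    unfolding majorant_def[abs_def] by (rule step_cmult) measurable
  ultimately show ?thesis by (simp add: distrib_left)
qed

text \<open>
Above \<open>b\<close> the barrier itself is exponentially small relative to \<open>w\<close>. Below \<open>b\<close> it equals a multiple of the harmonic function
\<open>w\<close> unless one step leads above the place where the minimum switches, which is unlikely by the
moment at \<open>\<theta> + \<delta>\<close>.
\<close>

lemma barrier_nearly_harmonic:
  "ennreal (barrier b z) \<le> step \<Delta> (\<lambda>z. ennreal (barrier b z)) z
     + ennreal (max hi (hi\<^sup>2 / lo * C) * exp (- \<delta> * \<bar>fst z - b\<bar>) * w z)"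
proof (cases "b \<le> fst z")
  case True
  have "barrier b z \<le> exp (- \<delta> * \<bar>fst z - b\<bar>) * hi * w z"
    using down_le[of b z] True by (simp add: barrier_def min.coboundedI1)
  also have "\<dots> \<le> max hi (hi\<^sup>2 / lo * C) * exp (- \<delta> * \<bar>fst z - b\<bar>) * w z"
    using w_pos[of z] by (simp add: mult.commute mult_right_mono less_imp_le)
  finally show ?thesis by (intro add_increasing ennreal_leI) auto
next
  case False
  define up where "up z = exp ((\<theta> + \<delta>) * (fst z - b)) * u (snd (snd z))" for z :: "real \<times> real \<times> 's"
  define a where "a = exp (\<theta> * b)"
  have up_w: "a * up z = exp (\<delta> * (fst z - b)) * w z" for z
    unfolding up_def w_def a_def by (simp add: exp_add[symmetric] algebra_simps)
  have up_meas [measurable]: "up \<in> borel_measurable walk_space"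
    unfolding up_def[abs_def] by (rule measurable_exponential)
  have up_nonneg: "0 \<le> up z" for z unfolding up_def using u[of "snd (snd z)"] by simp
  have step_up: "step \<Delta> (\<lambda>z. ennreal (up z)) z \<le> ennreal (C * up z)"
  proof -
    have "step \<Delta> (\<lambda>z. ennreal (up z)) z \<le> ennreal (exp ((\<theta> + \<delta>) * (fst z - b))) * ennreal (C * u (snd (snd z)))"
      unfolding up_def by (subst step_exp_shift[OF less_imp_le[OF u]]) (rule mult_left_mono[OF tilt_up], simp)
    also have "\<dots> = ennreal (C * up z)"
      by (subst ennreal_mult'[symmetric]) (simp_all add: up_def mult.left_commute)
    finally show ?thesis .
  qed
  have a: "0 < a" by (simp add: a_def)
  have pointwise: "hi * w z \<le> barrier b z + hi\<^sup>2 / lo * (a * up z)" for z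
  proof (cases "down b z \<le> hi * w z")
    case True
    have "exp (- \<delta> * (fst z - b)) * lo * w z \<le> hi * w z" using True down_ge[of z b] by simp
    then have "exp (- \<delta> * (fst z - b)) * lo \<le> hi" using w_pos[of z] by simp
    then have "exp (\<delta> * (fst z - b)) * (exp (- \<delta> * (fst z - b)) * lo) \<le> exp (\<delta> * (fst z - b)) * hi"
      by (rule mult_left_mono) simp
    then have "lo \<le> exp (\<delta> * (fst z - b)) * hi" by (simp add: mult.assoc[symmetric] exp_add[symmetric])
    then have "hi / lo * lo * w z \<le> hi / lo * (exp (\<delta> * (fst z - b)) * hi) * w z"
      using lo hi_pos w_pos[of z] by (intro mult_right_mono mult_left_mono) (auto simp: less_imp_le)
    then have "hi * w z \<le> hi\<^sup>2 / lo * (a * up z)"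
      unfolding up_w using lo by (simp add: power2_eq_square ac_simps)
    then show ?thesis using barrier_nonneg[of b z] by linarith
  next
    case False
    then have "barrier b z = hi * w z" by (simp add: barrier_def)
    then show ?thesis using up_nonneg[of z] lo a by (simp add: less_imp_le)
  qed
  have "ennreal (barrier b z) \<le> ennreal hi * ennreal (w z)"
    using hi_pos w_pos[of z] by (simp add: ennreal_mult[symmetric] less_imp_le barrier_def)
  also have "\<dots> = step \<Delta> (\<lambda>z. ennreal hi * ennreal (w z)) z"
    by (subst step_cmult) (simp_all add: step_w)
  also have "\<dots> \<le> step \<Delta> (\<lambda>z. ennreal (barrier b z) + ennreal (hi\<^sup>2 / lo * a) * ennreal (up z)) z"
  proof (rule step_mono)
    fix y p
    let ?z = "move \<Delta> z y p"
    have "ennreal hi * ennreal (w ?z) = ennreal (hi * w ?z)"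
      using hi_pos w_pos[of ?z] by (simp add: ennreal_mult less_imp_le)
    also have "\<dots> \<le> ennreal (barrier b ?z + hi\<^sup>2 / lo * a * up ?z)"
      using pointwise[of ?z] by (intro ennreal_leI) (simp add: mult.assoc)
    also have "\<dots> = ennreal (barrier b ?z) + ennreal (hi\<^sup>2 / lo * a) * ennreal (up ?z)"
    proof -
      have "0 \<le> hi\<^sup>2 / lo * a" using lo a by simp
      then have "ennreal (hi\<^sup>2 / lo * a * up ?z) = ennreal (hi\<^sup>2 / lo * a) * ennreal (up ?z)"
        by (rule ennreal_mult[OF _ up_nonneg])
      moreover have "0 \<le> hi\<^sup>2 / lo * a * up ?z" using up_nonneg[of ?z] lo a by simp
      ultimately show ?thesis using barrier_nonneg[of b ?z] by simp
    qed
    finally show "ennreal hi * ennreal (w ?z) \<le> ennreal (barrier b ?z) + ennreal (hi\<^sup>2 / lo * a) * ennreal (up ?z)" .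
  qed
  also have "\<dots> = step \<Delta> (\<lambda>z. ennreal (barrier b z)) z + ennreal (hi\<^sup>2 / lo * a) * step \<Delta> (\<lambda>z. ennreal (up z)) z"
    by (simp add: step_add step_cmult)
  also have "\<dots> \<le> step \<Delta> (\<lambda>z. ennreal (barrier b z)) z + ennreal (hi\<^sup>2 / lo * a) * ennreal (C * up z)"
    by (intro add_left_mono mult_left_mono step_up) simp
  also have "ennreal (hi\<^sup>2 / lo * a) * ennreal (C * up z) = ennreal (hi\<^sup>2 / lo * C * (a * up z))"
    using up_nonneg[of z] lo a C by (subst ennreal_mult[symmetric]) (simp_all add: ac_simps less_imp_le)
  also have "\<dots> \<le> ennreal (max hi (hi\<^sup>2 / lo * C) * exp (- \<delta> * \<bar>fst z - b\<bar>) * w z)"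
  proof -
    have "- \<delta> * \<bar>fst z - b\<bar> = \<delta> * (fst z - b)" using False by (simp add: algebra_simps)
    moreover have "hi\<^sup>2 / lo * C * (exp (\<delta> * (fst z - b)) * w z)
        \<le> max hi (hi\<^sup>2 / lo * C) * (exp (\<delta> * (fst z - b)) * w z)"
      using w_pos[of z] by (intro mult_right_mono) (simp_all add: less_imp_le)
    ultimately show ?thesis
      unfolding up_w by (intro ennreal_leI) (simp only: mult.assoc)
  qed
  finally show ?thesis by (simp add: add_left_mono)
qed

lemma funpow_step_barrier: "(step \<Delta> ^^ n) (\<lambda>z. ennreal (barrier b z)) z \<le> ennreal (q ^ n * down b z)"
proof (induction n arbitrary: z)
  case 0
  then show ?case by (simp add: barrier_def ennreal_leI)
next
  case (Suc n)
  have "(step \<Delta> ^^ Suc n) (\<lambda>z. ennreal (barrier b z)) z \<le> step \<Delta> (\<lambda>z. ennreal (q ^ n) * ennreal (down b z)) z"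
    using Suc q down_pos by (simp add: step_mono ennreal_mult less_imp_le)
  also have "\<dots> = ennreal (q ^ n) * ennreal (q * down b z)" by (subst step_cmult) (simp_all add: step_down)
  also have "\<dots> = ennreal (q ^ Suc n * down b z)"
    using q down_pos[of b z] by (simp add: ennreal_mult[symmetric] less_imp_le ac_simps)
  finally show ?case .
qed

end

context cramer_walk begin

definition band :: "real \<Rightarrow> nat \<Rightarrow> real \<times> real \<times> 's \<Rightarrow> ennreal" where
  "band b J z = (if \<bar>fst z - b\<bar> \<le> real J then ennreal (w z) else 0)"

lemma measurable_band [measurable]: "band b J \<in> borel_measurable walk_space"
  unfolding band_def[abs_def] by measurable

lemma potential_band_le: "potential \<Delta> n (band b J) z \<le> ennreal (real (2 * J + 1) * (hi / \<kappa>) * w z)"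
proof -
  let ?W = "\<lambda>z. \<Sum>k<2 * J + 1. window (b - real J + real k) z"
  let ?majorant = "\<lambda>z. \<Sum>k<2 * J + 1. majorant (b - real J + real k) z"
  have "band b J z \<le> ?W z" for z
  proof (cases "\<bar>fst z - b\<bar> \<le> real J")
    case True
    define k where "k = nat \<lfloor>fst z - (b - real J)\<rfloor>"
    have "0 \<le> fst z - (b - real J)" "fst z - (b - real J) \<le> real (2 * J)" using True by auto
    then have k: "real k \<le> fst z - (b - real J)" "fst z - (b - real J) < real k + 1" "k < 2 * J + 1"
      unfolding k_def by linarith+
    then have "band b J z = window (b - real J + real k) z"
      using True by (simp add: band_def window_def)
    also have "\<dots> \<le> ?W z" using k(3) by (intro member_le_sum) auto
    finally show ?thesis .
  qed (simp add: band_def)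
  then have "potential \<Delta> n (band b J) z \<le> potential \<Delta> n ?W z" by (rule potential_mono)
  also have "\<dots> \<le> ?majorant z"
  proof (rule potential_le_superharmonic)
    show "step \<Delta> ?majorant z + ?W z \<le> ?majorant z" for z
    proof -
      have "step \<Delta> ?majorant z + ?W z = (\<Sum>k<2 * J + 1. step \<Delta> (majorant (b - real J + real k)) z + window (b - real J + real k) z)"
        by (subst step_sum) (simp_all add: sum.distrib)
      then show ?thesis by (simp only:) (intro sum_mono majorant_superharmonic)
    qed
  qed measurable
  also have "\<dots> \<le> (\<Sum>k<2 * J + 1. ennreal (hi / \<kappa> * w z))" by (intro sum_mono majorant_le)
  also have "\<dots> = ennreal (real (2 * J + 1) * (hi / \<kappa>) * w z)"
    using hi_pos \<kappa>_pos w_pos[of z] by (simp add: ennreal_of_nat_eq_real_of_nat ennreal_mult[symmetric] less_imp_le mult.assoc del: of_nat_Suc)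
  finally show ?thesis .
qed

text \<open>
A superposition of unit windows at distance at least \<open>J\<close> from \<open>b\<close>, with weights that dominate the
exponential decay.
\<close>

definition tail :: "real \<Rightarrow> nat \<Rightarrow> real \<times> real \<times> 's \<Rightarrow> ennreal" where
  "tail b J z = (\<Sum>j. ennreal (exp (- \<delta> * real (J + j))) *
     (window (b + real (J + j)) z + window (b - real (J + j) - 1) z))"

lemma measurable_tail [measurable]: "tail b J \<in> borel_measurable walk_space"
  unfolding tail_def[abs_def] by measurable

lemma potential_tail_le:
  "potential \<Delta> n (tail b J) z \<le> ennreal (2 * (hi / \<kappa>) * (exp (- \<delta> * real J) / (1 - exp (- \<delta>))) * w z)"
proof -
  let ?c = "\<lambda>j. ennreal (exp (- \<delta> * real (J + j)))"
  let ?majorant = "\<lambda>z. \<Sum>j. ?c j * (majorant (b + real (J + j)) z + majorant (b - real (J + j) - 1) z)"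
  have "potential \<Delta> n (tail b J) z \<le> ?majorant z"
  proof (rule potential_le_superharmonic)
    fix z
    have "step \<Delta> ?majorant z = (\<Sum>j. ?c j * (step \<Delta> (majorant (b + real (J + j))) z + step \<Delta> (majorant (b - real (J + j) - 1)) z))"
      by (subst step_suminf) (simp_all add: step_cmult step_add)
    then have "step \<Delta> ?majorant z + tail b J z = (\<Sum>j. ?c j * ((step \<Delta> (majorant (b + real (J + j))) z + window (b + real (J + j)) z)
        + (step \<Delta> (majorant (b - real (J + j) - 1)) z + window (b - real (J + j) - 1) z)))"
      unfolding tail_def by (simp add: suminf_add distrib_left ac_simps)
    also have "\<dots> \<le> ?majorant z"
      by (intro suminf_le mult_left_mono add_mono majorant_superharmonic) auto
    finally show "step \<Delta> ?majorant z + tail b J z \<le> ?majorant z" .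
  qed measurable
  also have "\<dots> \<le> (\<Sum>j. ?c j * (ennreal (hi / \<kappa> * w z) + ennreal (hi / \<kappa> * w z)))"
    by (intro suminf_le mult_left_mono add_mono majorant_le) auto
  also have "\<dots> = (\<Sum>j. ennreal ((2 * (hi / \<kappa>) * w z) * (exp (- \<delta> * real J) * exp (- \<delta>) ^ j)))"
  proof (intro suminf_cong)
    fix j
    have "exp (- \<delta> * real (J + j)) = exp (- \<delta> * real J) * exp (- \<delta>) ^ j"
      by (simp add: exp_of_nat_mult[symmetric] exp_add[symmetric] algebra_simps)
    then show "?c j * (ennreal (hi / \<kappa> * w z) + ennreal (hi / \<kappa> * w z))
        = ennreal ((2 * (hi / \<kappa>) * w z) * (exp (- \<delta> * real J) * exp (- \<delta>) ^ j))"
      using hi_pos \<kappa>_pos w_pos[of z]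
      by (simp add: ennreal_plus[symmetric] ennreal_mult[symmetric] less_imp_le mult.commute del: ennreal_plus)
  qed
  also have "\<dots> = ennreal (2 * (hi / \<kappa>) * (exp (- \<delta> * real J) / (1 - exp (- \<delta>))) * w z)"
  proof (rule suminf_ennreal_eq)
    show "0 \<le> (2 * (hi / \<kappa>) * w z) * (exp (- \<delta> * real J) * exp (- \<delta>) ^ j)" for j
      using hi_pos \<kappa>_pos w_pos[of z] by (simp add: less_imp_le)
    have "(\<lambda>j. exp (- \<delta>) ^ j) sums (1 / (1 - exp (- \<delta>)))" using \<delta> by (intro geometric_sums) simp
    from sums_mult[OF sums_mult[OF this]]
    show "(\<lambda>j. (2 * (hi / \<kappa>) * w z) * (exp (- \<delta> * real J) * exp (- \<delta>) ^ j))
        sums (2 * (hi / \<kappa>) * (exp (- \<delta> * real J) / (1 - exp (- \<delta>))) * w z)"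
      by (rule back_subst) simp
  qed
  finally show ?thesis .
qed

lemma exponential_decay_le_band_tail:
  "ennreal (exp (- \<delta> * \<bar>fst z - b\<bar>) * w z) \<le> band b J z + tail b J z"
proof (cases "\<bar>fst z - b\<bar> \<le> real J")
  case True
  have "exp (- \<delta> * \<bar>fst z - b\<bar>) * w z \<le> 1 * w z"
    using \<delta> w_pos[of z] by (intro mult_right_mono) (auto simp: less_imp_le)
  then show ?thesis using True by (intro add_increasing2) (simp_all add: band_def ennreal_leI)
next
  case False
  define j where "j = nat \<lfloor>\<bar>fst z - b\<bar> - real J\<rfloor>"
  have j: "real (J + j) \<le> \<bar>fst z - b\<bar>" "\<bar>fst z - b\<bar> \<le> real (J + j) + 1"
    using False unfolding j_def by linarith+
  have "ennreal (w z) \<le> window (b + real (J + j)) z + window (b - real (J + j) - 1) z"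
    using j by (cases "b \<le> fst z") (auto simp: window_def abs_if split: if_splits)
  moreover have "exp (- \<delta> * \<bar>fst z - b\<bar>) \<le> exp (- \<delta> * real (J + j))"
    using j(1) \<delta> by simp
  ultimately have "ennreal (exp (- \<delta> * \<bar>fst z - b\<bar>)) * ennreal (w z)
      \<le> ennreal (exp (- \<delta> * real (J + j))) * (window (b + real (J + j)) z + window (b - real (J + j) - 1) z)"
    by (intro mult_mono ennreal_leI) auto
  also have "\<dots> = (\<Sum>j\<in>{j}. ennreal (exp (- \<delta> * real (J + j))) * (window (b + real (J + j)) z + window (b - real (J + j) - 1) z))"
    by simp
  also have "\<dots> \<le> tail b J z"
    unfolding tail_def by (intro sum_le_suminf) auto
  finally show ?thesis using w_pos[of z] by (intro add_increasing) (simp_all add: ennreal_mult less_imp_le)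
qed

text \<open>
The constant in the bound for the one-step decrease of the barrier.
\<close>

definition defect :: real where "defect = max hi (hi\<^sup>2 / lo * C)"

lemma defect_pos: "0 < defect"
  using hi_pos by (simp add: defect_def)

text \<open>
Started far below \<open>b\<close>, the barrier equals \<open>hi * w\<close>; it tends to zero along the chain, because it
is below \<open>down b\<close>. All of it has to be lost on the way, and the loss far away from \<open>b\<close> is at most
a quarter if \<open>J\<close> is large. Hence a fixed part is lost inside the band.
\<close>

lemma potential_band_ge:
  obtains J where "\<And>b \<Delta> d x. hi \<le> exp (\<delta> * b) * lo \<Longrightarrow>
    \<exists>n. ennreal (hi / (2 * defect) * u x) \<le> potential \<Delta> n (band b J) (0, d, x)"
proof -
  let ?t = "\<lambda>J. defect * (2 * (hi / \<kappa>) * (exp (- \<delta> * real J) / (1 - exp (- \<delta>))))"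
  \<comment> \<open>The width \<open>J\<close> does not depend on \<open>b\<close>, whereas the number of steps \<open>n\<close> chosen later does.\<close>
  have "(\<lambda>J. exp (- \<delta>) ^ J) \<longlonglongrightarrow> 0" using \<delta> by (intro LIMSEQ_power_zero) simp
  then have "(\<lambda>J. defect * (2 * (hi / \<kappa>) * (exp (- \<delta>) ^ J / (1 - exp (- \<delta>))))) \<longlonglongrightarrow> defect * (2 * (hi / \<kappa>) * (0 / (1 - exp (- \<delta>))))"
    using \<delta> by (intro tendsto_intros) auto
  moreover have "exp (- \<delta>) ^ J = exp (- \<delta> * real J)" for J
    by (simp add: exp_of_nat_mult[symmetric] mult.commute)
  ultimately have "?t \<longlonglongrightarrow> 0" by simp
  then have "eventually (\<lambda>J. ?t J < hi / 4) sequentially" by (rule order_tendstoD(2)) (use hi_pos in simp)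
  then obtain J where J: "?t J < hi / 4" by (auto simp: eventually_sequentially)
  show ?thesis
  proof (rule that)
    fix b \<Delta> d :: real and x :: 's assume b: "hi \<le> exp (\<delta> * b) * lo"
    let ?z = "(0 :: real, d, x)"
    have wz: "w ?z = u x" by (simp add: w_def)
    have "(\<lambda>n. q ^ n * exp (\<delta> * b)) \<longlonglongrightarrow> 0 * exp (\<delta> * b)"
      using q by (intro tendsto_intros LIMSEQ_power_zero) simp
    then have "eventually (\<lambda>n. q ^ n * exp (\<delta> * b) < 1 / 4) sequentially" by (rule order_tendstoD(2)) simp
    then obtain n where n: "q ^ n * exp (\<delta> * b) < 1 / 4" by (auto simp: eventually_sequentially)
    let ?P = "potential \<Delta> n (band b J) ?z"
    let ?f = "\<lambda>z. ennreal (defect * exp (- \<delta> * \<bar>fst z - b\<bar>) * w z)"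
    have f_meas: "?f \<in> borel_measurable walk_space" by measurable
    have "barrier b ?z = hi * u x"
    proof -
      have "hi * u x \<le> exp (\<delta> * b) * lo * u x" using b u[of x] by (intro mult_right_mono) (auto simp: less_imp_le)
      also have "\<dots> \<le> exp (\<delta> * b) * v x" using v(1)[of x] by (simp add: mult.assoc)
      finally show ?thesis by (simp add: barrier_def down_def w_def)
    qed
    then have "ennreal (hi * u x) \<le> potential \<Delta> n ?f ?z + (step \<Delta> ^^ n) (\<lambda>z. ennreal (barrier b z)) ?z"
      using le_potential_subharmonic[OF f_meas, of "\<lambda>z. ennreal (barrier b z)" \<Delta> ?z n] barrier_nearly_harmonic[of b _ \<Delta>]
      unfolding defect_def[symmetric] by simp
    also have "\<dots> \<le> ennreal defect * (?P + potential \<Delta> n (tail b J) ?z) + ennreal (q ^ n * down b ?z)"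
    proof (rule add_mono[OF _ funpow_step_barrier])
      have "potential \<Delta> n ?f ?z \<le> potential \<Delta> n (\<lambda>z. ennreal defect * (band b J z + tail b J z)) ?z"
      proof (rule potential_mono)
        fix z
        have "?f z = ennreal defect * ennreal (exp (- \<delta> * \<bar>fst z - b\<bar>) * w z)"
          using defect_pos w_pos[of z] by (simp add: ennreal_mult less_imp_le mult.assoc)
        also have "\<dots> \<le> ennreal defect * (band b J z + tail b J z)"
          by (intro mult_left_mono exponential_decay_le_band_tail) simp
        finally show "?f z \<le> ennreal defect * (band b J z + tail b J z)" .
      qed
      also have "\<dots> = ennreal defect * (?P + potential \<Delta> n (tail b J) ?z)"
      proof -
        have "(step \<Delta> ^^ i) (\<lambda>z. ennreal defect * (band b J z + tail b J z)) z
            = ennreal defect * ((step \<Delta> ^^ i) (band b J) z + (step \<Delta> ^^ i) (tail b J) z)" for i z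
        proof (induction i arbitrary: z)
          case (Suc i)
          have "(step \<Delta> ^^ Suc i) (\<lambda>z. ennreal defect * (band b J z + tail b J z)) z
            = step \<Delta> (\<lambda>z. ennreal defect * ((step \<Delta> ^^ i) (band b J) z + (step \<Delta> ^^ i) (tail b J) z)) z"
            by (simp add: Suc[abs_def] cong: step_cong)
          then show ?case by (simp add: step_cmult step_add measurable_funpow_step)
        qed simp
        then show ?thesis unfolding potential_def by (simp add: sum_distrib_left[symmetric] sum.distrib)
      qed
      finally show "potential \<Delta> n ?f ?z \<le> ennreal defect * (?P + potential \<Delta> n (tail b J) ?z)" .
    qed
    also have "\<dots> \<le> ennreal defect * (?P + ennreal (2 * (hi / \<kappa>) * (exp (- \<delta> * real J) / (1 - exp (- \<delta>))) * u x)) + ennreal (hi / 4 * u x)"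
    proof (intro add_mono mult_left_mono order_refl ennreal_leI)
      show "potential \<Delta> n (tail b J) ?z \<le> ennreal (2 * (hi / \<kappa>) * (exp (- \<delta> * real J) / (1 - exp (- \<delta>))) * u x)"
        using potential_tail_le[of \<Delta> n b J ?z] unfolding wz .
      have "q ^ n * down b ?z \<le> q ^ n * (exp (\<delta> * b) * hi * u x)"
        using down_le[of b ?z] q wz by (intro mult_left_mono) simp_all
      also have "\<dots> \<le> 1 / 4 * (hi * u x)"
        using mult_right_mono[OF less_imp_le[OF n], of "hi * u x"] hi_pos u[of x] by (simp add: mult.assoc less_imp_le)
      finally show "q ^ n * down b ?z \<le> hi / 4 * u x" by simp
    qed simp
    also have "\<dots> \<le> ennreal defect * ?P + ennreal (hi / 2 * u x)"
    proof -
      have "1 - exp (- \<delta>) > 0" using \<delta> by simp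
      then have "ennreal defect * ennreal (2 * (hi / \<kappa>) * (exp (- \<delta> * real J) / (1 - exp (- \<delta>))) * u x) = ennreal (?t J * u x)"
        using defect_pos hi_pos \<kappa>_pos u[of x] by (subst ennreal_mult[symmetric]) (simp_all add: less_imp_le mult.assoc)
      also have "\<dots> \<le> ennreal (hi / 4 * u x)"
        using J u[of x] by (intro ennreal_leI mult_right_mono) (simp_all add: less_imp_le)
      finally have "ennreal defect * (?P + ennreal (2 * (hi / \<kappa>) * (exp (- \<delta> * real J) / (1 - exp (- \<delta>))) * u x)) + ennreal (hi / 4 * u x)
          \<le> (ennreal defect * ?P + ennreal (hi / 4 * u x)) + ennreal (hi / 4 * u x)"
        unfolding distrib_left by (intro add_mono order_refl)
      also have "\<dots> = ennreal defect * ?P + ennreal (hi / 2 * u x)"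
        using hi_pos u[of x] by (simp add: add.assoc ennreal_plus[symmetric] less_imp_le del: ennreal_plus)
      finally show ?thesis .
    qed
    \<comment> \<open>A quarter of \<open>hi * u x\<close> has gone to the tail and a quarter to the remainder after \<open>n\<close> steps.\<close>
    finally have main: "ennreal (hi * u x) \<le> ennreal defect * ?P + ennreal (hi / 2 * u x)" .
    have "ennreal (hi / (2 * defect) * u x) \<le> ?P"
    proof (cases ?P)
      case (real p)
      then have "ennreal (hi * u x) \<le> ennreal (defect * p + hi / 2 * u x)"
        using main defect_pos hi_pos u[of x] by (simp add: ennreal_mult less_imp_le)
      moreover have "0 \<le> defect * p + hi / 2 * u x" using defect_pos hi_pos u[of x] real by (simp add: less_imp_le)
      ultimately have "hi * u x \<le> defect * p + hi / 2 * u x" by (simp add: ennreal_le_iff)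
      then have "hi / (2 * defect) * u x \<le> p" using defect_pos by (simp add: field_simps)
      then show ?thesis using real by (simp add: ennreal_leI)
    qed simp
    then show "\<exists>n. ennreal (hi / (2 * defect) * u x) \<le> potential \<Delta> n (band b J) (0, d, x)" by blast
  qed
qed

text \<open>
The maximum principle with charge \<open>w\<close> on the band around \<open>b = ln (1 / \<Delta>) + A + J\<close> and
with \<open>\<Psi> = hit \<Delta>\<close>. On the band \<open>w\<close> has order \<open>\<Delta> powr (- \<theta>)\<close> and ruin has probability at least \<open>p\<close>, so
the potential, which is bounded below at the start, is at most of order
\<open>\<Delta> powr (- \<theta>) * hit \<Delta>\<close>.
\<close>

theorem hit_ge_powr:
  assumes \<theta>: "0 < \<theta>" and p: "0 < p"
    and near: "\<And>\<Delta> s d x. 0 < \<Delta> \<Longrightarrow> 0 \<le> d \<Longrightarrow> ln (1 / \<Delta>) + A \<le> s \<Longrightarrow> ennreal p \<le> hit \<Delta> (s, d, x)"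
  obtains c where "0 < c" "\<forall>\<^sub>F \<Delta> in at_right 0. ennreal (c * \<Delta> powr \<theta>) \<le> hit \<Delta> (0, 0, x)"
proof -
  obtain J where J: "\<And>b \<Delta> d x. hi \<le> exp (\<delta> * b) * lo \<Longrightarrow>
      \<exists>n. ennreal (hi / (2 * defect) * u x) \<le> potential \<Delta> n (band b J) (0, d, x)"
    using potential_band_ge by blast
  define U where "U = Max (range u)"
  have U: "u y \<le> U" for y unfolding U_def by (rule Max_ge) auto
  have U_pos: "0 < U" using U[of x] u[of x] by linarith
  define M0 where "M0 = real (2 * J + 1) * (hi / \<kappa>) * U * exp (\<theta> * (A + 2 * real J))"
  have M0: "0 < M0" unfolding M0_def using hi_pos \<kappa>_pos U_pos by simp
  define c where "c = hi / (2 * defect) * u x * p / M0"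
  have c: "0 < c" unfolding c_def using hi_pos defect_pos u[of x] p M0 by simp
  have bound: "ennreal (c * \<Delta> powr \<theta>) \<le> hit \<Delta> (0, 0, x)"
    if \<Delta>: "0 < \<Delta>" and b: "hi \<le> exp (\<delta> * (ln (1 / \<Delta>) + A + real J)) * lo" for \<Delta>
  proof -
    let ?b = "ln (1 / \<Delta>) + A + real J"
    let ?S = "{z :: real \<times> real \<times> 's. 0 \<le> fst (snd z)}"
    let ?M = "M0 * \<Delta> powr (- \<theta>)"
    have M: "0 < ?M" using M0 \<Delta> by simp
    obtain n where n: "ennreal (hi / (2 * defect) * u x) \<le> potential \<Delta> n (band ?b J) (0, 0, x)"
      using J[OF b] by blast
    also have "\<dots> \<le> ennreal (?M / p) * hit \<Delta> (0, 0, x)"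
    proof (rule potential_maximum_principle[where S="?S"])
      show "move \<Delta> z y q \<in> ?S" if "z \<in> ?S" for z y q
        using that move_distance[of \<Delta> z y q] \<Delta> by (auto intro: order_trans)
      show "step \<Delta> (hit \<Delta>) z \<le> hit \<Delta> z" for z using step_hit[of \<Delta> z] \<Delta> by simp
      fix z n assume z: "z \<in> ?S" "band ?b J z \<noteq> 0"
      then have s: "\<bar>fst z - ?b\<bar> \<le> real J" by (auto simp: band_def split: if_splits)
      have "w z \<le> exp (\<theta> * (?b + real J)) * U"
        unfolding w_def using s \<theta> U[of "snd (snd z)"] u[of "snd (snd z)"] by (intro mult_mono) (auto simp: less_imp_le)
      also have "exp (\<theta> * (?b + real J)) = exp (\<theta> * (A + 2 * real J)) * \<Delta> powr (- \<theta>)"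
        using \<Delta> by (simp add: powr_def exp_add[symmetric] ln_div algebra_simps)
      finally have "real (2 * J + 1) * (hi / \<kappa>) * w z \<le> real (2 * J + 1) * (hi / \<kappa>) * (exp (\<theta> * (A + 2 * real J)) * \<Delta> powr (- \<theta>) * U)"
        using hi_pos \<kappa>_pos by (intro mult_left_mono) (auto simp: less_imp_le)
      also have "\<dots> = ?M" by (simp add: M0_def)
      finally have "potential \<Delta> n (band ?b J) z \<le> ennreal ?M"
        using potential_band_le[of \<Delta> n ?b J z] by (meson ennreal_leI order_trans)
      also have "ennreal ?M = ennreal (?M / p) * ennreal p"
        using M p by (simp add: ennreal_mult[symmetric])
      also have "ennreal p \<le> hit \<Delta> z"
        using near[OF \<Delta>, of "fst (snd z)" "fst z" "snd (snd z)"] z s by (simp add: abs_le_iff)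
      finally show "potential \<Delta> n (band ?b J) z \<le> ennreal (?M / p) * hit \<Delta> z"
        by (simp add: mult_left_mono)
    qed (use measurable_hit in simp_all)
    finally have *: "ennreal (hi / (2 * defect) * u x) \<le> ennreal (?M / p) * hit \<Delta> (0, 0, x)" .
    have "ennreal (c * \<Delta> powr \<theta>) = ennreal (p / ?M) * ennreal (hi / (2 * defect) * u x)"
      using M0 p hi_pos defect_pos u[of x] \<Delta>
      by (subst ennreal_mult[symmetric]) (simp_all add: c_def powr_minus field_simps less_imp_le)
    also have "\<dots> \<le> ennreal (p / ?M) * (ennreal (?M / p) * hit \<Delta> (0, 0, x))" by (intro mult_left_mono *) simp
    also have "\<dots> = hit \<Delta> (0, 0, x)"
      using M0 \<Delta> p by (simp add: mult.assoc[symmetric] ennreal_mult[symmetric] less_imp_le)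
    finally show ?thesis .
  qed
  have "\<forall>\<^sub>F \<Delta> in at_right 0. hi < exp (\<delta> * (ln (1 / \<Delta>) + A + real J)) * lo"
  proof -
    have "filterlim (\<lambda>\<Delta>. exp (\<delta> * (ln (1 / \<Delta>) + A + real J)) * lo) at_top (at_right 0)"
      using \<delta> lo by real_asymp
    then show ?thesis by (simp add: filterlim_at_top_dense)
  qed
  moreover have "\<forall>\<^sub>F \<Delta> in at_right (0 :: real). 0 < \<Delta>" by (simp add: eventually_at_right_less)
  ultimately have "\<forall>\<^sub>F \<Delta> in at_right 0. ennreal (c * \<Delta> powr \<theta>) \<le> hit \<Delta> (0, 0, x)"
    by eventually_elim (rule bound, simp_all add: less_imp_le)
  with c show ?thesis by (rule that)
qed

end

context nominal_kernel begin

section \<open>Ruin from high levels\<close>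

text \<open>
From \<open>x\<close>, at levels above \<open>ln (1 / \<Delta>)\<close> up to a constant, ruin has probability bounded below. At
that level a jump \<open>\<Delta> * l * exp s\<close> with fixed positive \<open>l\<close> is comparable with the distance 1.
\<close>

definition escapes :: "'s \<Rightarrow> bool" where
  "escapes x \<longleftrightarrow> (\<exists>A p. 0 < p \<and> (\<forall>\<Delta> s d. 0 < \<Delta> \<longrightarrow> 0 \<le> d \<longrightarrow> ln (1 / \<Delta>) + A \<le> s \<longrightarrow> ennreal p \<le> hit \<Delta> (s, d, x)))"

lemma step_ge_single: "ennreal (K (snd (snd z)) y) * (\<integral>\<^sup>+p. f (move \<Delta> z y p) \<partial>\<nu>) \<le> step \<Delta> f z"
  unfolding step_def by (intro member_le_sum) auto

lemma step_ge_event: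
  assumes E: "E \<in> sets \<nu>" and "\<And>p. p \<in> E \<Longrightarrow> ennreal c \<le> f (move \<Delta> z y p)" and c: "0 \<le> c"
  shows "ennreal (K (snd (snd z)) y * (c * measure \<nu> E)) \<le> step \<Delta> f z"
proof -
  have "ennreal (K (snd (snd z)) y * (c * measure \<nu> E)) = ennreal (K (snd (snd z)) y) * (\<integral>\<^sup>+p. ennreal c * indicator E p \<partial>\<nu>)"
    using E c K_nonneg by (simp add: nn_integral_cmult_indicator noise.emeasure_eq_measure ennreal_mult)
  also have "\<dots> \<le> ennreal (K (snd (snd z)) y) * (\<integral>\<^sup>+p. f (move \<Delta> z y p) \<partial>\<nu>)"
    using assms(2) by (intro mult_left_mono nn_integral_mono) (auto simp: indicator_def)
  also have "\<dots> \<le> step \<Delta> f z" by (rule step_ge_single)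
  finally show ?thesis .
qed

lemma escapes_base:
  assumes K: "0 < K x y" and \<epsilon>: "0 < \<epsilon>"
    and pos: "0 < measure \<nu> {p \<in> space \<nu>. \<epsilon> < lam y (snd p) * exp (\<gamma> y (fst p))}"
  shows "escapes x"
  unfolding escapes_def
proof (intro exI conjI allI impI)
  let ?E = "{p \<in> space \<nu>. \<epsilon> < lam y (snd p) * exp (\<gamma> y (fst p))}"
  show "0 < K x y * (1 * measure \<nu> ?E)" using K pos by simp
  fix \<Delta> s d :: real assume \<Delta>: "0 < \<Delta>" and d: "0 \<le> d" and s: "ln (1 / \<Delta>) + - ln \<epsilon> \<le> s"
  have E: "?E \<in> sets \<nu>" by measurable
  have "ln (1 / (\<Delta> * \<epsilon>)) \<le> s" using s \<Delta> \<epsilon> by (simp add: ln_div ln_mult)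
  then have "exp (ln (1 / (\<Delta> * \<epsilon>))) \<le> exp s" by simp
  then have big: "1 / (\<Delta> * \<epsilon>) \<le> exp s" using \<Delta> \<epsilon> by simp
  have "ennreal (K (snd (snd (s, d, x))) y * (1 * measure \<nu> ?E)) \<le> step \<Delta> (hit \<Delta>) (s, d, x)"
  proof (rule step_ge_event[OF E])
    fix p assume "p \<in> ?E"
    then have l: "\<epsilon> < lam y (snd p) * exp (\<gamma> y (fst p))" by simp
    have "1 = 1 / (\<Delta> * \<epsilon>) * (\<Delta> * \<epsilon>)" using \<Delta> \<epsilon> by simp
    also have "\<dots> \<le> exp s * (\<Delta> * \<epsilon>)" using big \<Delta> \<epsilon> by (intro mult_right_mono) auto
    also have "\<dots> < exp s * (\<Delta> * (lam y (snd p) * exp (\<gamma> y (fst p))))" using l \<Delta> by simp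
    finally have "1 < fst (snd (move \<Delta> (s, d, x) y p))" using d by (simp add: move_def exp_add ac_simps)
    then show "ennreal 1 \<le> hit \<Delta> (move \<Delta> (s, d, x) y p)"
      using ruin_le_hit[of "move \<Delta> (s, d, x) y p" \<Delta>] by (simp add: ruin_def)
  qed simp
  then show "ennreal (K x y * (1 * measure \<nu> ?E)) \<le> hit \<Delta> (s, d, x)" using step_hit[of \<Delta>] \<Delta> by simp
qed

text \<open>
One transition lowers the level by more than some constant only with probability less than 1.
\<close>

lemma escapes_predecessor:
  assumes K: "0 < K x y" and y: "escapes y"
  shows "escapes x"
proof -
  obtain A p where p: "0 < p" and A: "\<And>\<Delta> s d. 0 < \<Delta> \<Longrightarrow> 0 \<le> d \<Longrightarrow> ln (1 / \<Delta>) + A \<le> s \<Longrightarrow> ennreal p \<le> hit \<Delta> (s, d, y)"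
    using y unfolding escapes_def by blast
  let ?E = "\<lambda>B. {q \<in> space \<nu>. - real B \<le> \<gamma> y (fst q)}"
  have E: "?E B \<in> sets \<nu>" for B by measurable
  have "(\<lambda>B. measure \<nu> (?E B)) \<longlonglongrightarrow> measure \<nu> (\<Union>B. ?E B)"
    using E by (intro noise.finite_Lim_measure_incseq) (auto simp: incseq_def)
  moreover have "(\<Union>B. ?E B) = space \<nu>"
  proof -
    have "\<exists>B. - real B \<le> \<gamma> y (fst q)" for q using real_arch_simple[of "- \<gamma> y (fst q)"] by (auto simp: minus_le_iff)
    then show ?thesis by auto
  qed
  ultimately have "(\<lambda>B. measure \<nu> (?E B)) \<longlonglongrightarrow> 1" using noise.prob_space by simp
  then have "eventually (\<lambda>B. 0 < measure \<nu> (?E B)) sequentially" by (rule order_tendstoD(1)) simp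
  then obtain B where B: "0 < measure \<nu> (?E B)" by (auto simp: eventually_sequentially)
  show ?thesis
    unfolding escapes_def
  proof (intro exI conjI allI impI)
    show "0 < K x y * (p * measure \<nu> (?E B))" using K p B by simp
    fix \<Delta> s d :: real assume \<Delta>: "0 < \<Delta>" and d: "0 \<le> d" and s: "ln (1 / \<Delta>) + (A + real B) \<le> s"
    have "ennreal (K (snd (snd (s, d, x))) y * (p * measure \<nu> (?E B))) \<le> step \<Delta> (hit \<Delta>) (s, d, x)"
    proof (rule step_ge_event[OF E])
      fix q assume "q \<in> ?E B"
      then show "ennreal p \<le> hit \<Delta> (move \<Delta> (s, d, x) y q)"
        using s d \<Delta> unfolding move_def by (intro A) (auto simp: lam_nonneg)
    qed (use p in simp)
    then show "ennreal (K x y * (p * measure \<nu> (?E B))) \<le> hit \<Delta> (s, d, x)" using step_hit[of \<Delta>] \<Delta> by simp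
  qed
qed

lemma uniform_escape:
  assumes "\<And>x. escapes x"
  obtains A p where "0 < p" "\<And>\<Delta> s d x. 0 < \<Delta> \<Longrightarrow> 0 \<le> d \<Longrightarrow> ln (1 / \<Delta>) + A \<le> s \<Longrightarrow> ennreal p \<le> hit \<Delta> (s, d, x)"
proof -
  have "\<forall>x. \<exists>A p. 0 < p \<and> (\<forall>\<Delta> s d. 0 < \<Delta> \<longrightarrow> 0 \<le> d \<longrightarrow> ln (1 / \<Delta>) + A \<le> s \<longrightarrow> ennreal p \<le> hit \<Delta> (s, d, x))"
    using assms unfolding escapes_def by blast
  then obtain A p where p: "\<And>x. 0 < p x"
    and A: "\<And>x \<Delta> s d. 0 < \<Delta> \<Longrightarrow> 0 \<le> d \<Longrightarrow> ln (1 / \<Delta>) + A x \<le> s \<Longrightarrow> ennreal (p x) \<le> hit \<Delta> (s, d, x)"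
    by metis
  show ?thesis
  proof (rule that)
    show "0 < Min (range p)" using p by (subst Min_gr_iff) auto
    fix \<Delta> s d :: real and x assume \<Delta>: "0 < \<Delta>" and d: "0 \<le> d" and s: "ln (1 / \<Delta>) + Max (range A) \<le> s"
    have "A x \<le> Max (range A)" by (rule Max_ge) auto
    with s have "ln (1 / \<Delta>) + A x \<le> s" by linarith
    then have "ennreal (p x) \<le> hit \<Delta> (s, d, x)" by (rule A[OF \<Delta> d])
    moreover have "Min (range p) \<le> p x" by (rule Min_le) auto
    ultimately show "ennreal (Min (range p)) \<le> hit \<Delta> (s, d, x)" by (meson ennreal_leI order_trans)
  qed
qed

lemma hit_eq_0_if_no_jumps:
  assumes null: "\<And>y. AE p in \<nu>. lam y (snd p) = 0" and z: "fst (snd z) \<le> 1"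
  shows "hit \<Delta> z = 0"
proof -
  have "(step \<Delta> ^^ n) ruin z = 0" for n
    using z
  proof (induction n arbitrary: z)
    case (Suc n)
    have "(\<integral>\<^sup>+p. (step \<Delta> ^^ n) ruin (move \<Delta> z y p) \<partial>\<nu>) = (\<integral>\<^sup>+p. 0 \<partial>\<nu>)" for y
      using null[of y] Suc by (intro nn_integral_cong_AE) (auto elim!: eventually_mono simp: move_def)
    then have "step \<Delta> ((step \<Delta> ^^ n) ruin) z = 0"
      unfolding step_def[of \<Delta> "(step \<Delta> ^^ n) ruin" z] by simp
    then show ?case by simp
  qed (simp add: ruin_def)
  then show ?thesis by (simp add: hit_def)
qed

lemma reachable_if_funpow_step_pos:
  assumes "(step \<Delta> ^^ n) (\<lambda>z. if snd (snd z) = y then 1 else 0) z \<noteq> 0"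
  shows "(snd (snd z), y) \<in> {(x, y). 0 < K x y}\<^sup>*"
  using assms
proof (induction n arbitrary: z)
  case 0
  then show ?case by (simp split: if_splits)
next
  case (Suc n)
  let ?f = "(step \<Delta> ^^ n) (\<lambda>z. if snd (snd z) = y then 1 else 0)"
  have "step \<Delta> ?f z \<noteq> 0" using Suc.prems by simp
  then obtain y' where nz: "ennreal (K (snd (snd z)) y') * (\<integral>\<^sup>+p. ?f (move \<Delta> z y' p) \<partial>\<nu>) \<noteq> 0"
    unfolding step_def[of \<Delta> ?f z] by (meson sum.neutral)
  then have y': "K (snd (snd z)) y' \<noteq> 0" by auto
  have "\<exists>p. ?f (move \<Delta> z y' p) \<noteq> 0"
  proof (rule ccontr)
    assume "\<nexists>p. ?f (move \<Delta> z y' p) \<noteq> 0"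
    then have "?f (move \<Delta> z y' p) = 0" for p by blast
    with nz show False by simp
  qed
  then obtain p where "?f (move \<Delta> z y' p) \<noteq> 0" ..
  from Suc.IH[OF this] have "(y', y) \<in> {(x, y). 0 < K x y}\<^sup>*" by (simp add: move_def)
  moreover have "0 < K (snd (snd z)) y'" using y' K_nonneg[of "snd (snd z)" y'] by linarith
  ultimately show ?case by (auto intro: converse_rtrancl_into_rtrancl)
qed

text \<open>
A state with positive jumps has a predecessor, from which ruin is possible in one step; every
state leads to that predecessor.
\<close>

lemma escapes_all:
  assumes reach: "\<And>x y. (x, y) \<in> {(x, y). 0 < K x y}\<^sup>*"
    and jump: "\<not> (AE p in \<nu>. lam y (snd p) = 0)"
  shows "escapes x"
proof -
  \<comment> \<open>The events that a jump, including the factor from the simultaneous increment of the level, exceeds \<open>1 / (n + 1)\<close>.\<close>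
  let ?E = "\<lambda>n. {p \<in> space \<nu>. 1 / real (Suc n) < lam y (snd p) * exp (\<gamma> y (fst p))}"
  have E: "?E n \<in> sets \<nu>" for n by measurable
  have "\<exists>n. 0 < measure \<nu> (?E n)"
  proof (rule ccontr)
    assume "\<not> ?thesis"
    then have "measure \<nu> (?E n) = 0" for n by (simp add: not_less measure_le_0_iff)
    then have "AE p in \<nu>. p \<notin> ?E n" for n
      using E[of n] by (intro AE_not_in) (simp add: null_sets_def noise.emeasure_eq_measure)
    then have "AE p in \<nu>. \<forall>n. p \<notin> ?E n" by (simp add: AE_all_countable)
    then have "AE p in \<nu>. lam y (snd p) = 0"
    proof eventually_elim
      fix p assume *: "\<forall>n. p \<notin> ?E n"
      show "lam y (snd p) = 0"
      proof (rule ccontr)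
        assume "lam y (snd p) \<noteq> 0"
        then have "0 < lam y (snd p) * exp (\<gamma> y (fst p))" using lam_nonneg[of y "snd p"] by simp
        then obtain n where "inverse (real (Suc n)) < lam y (snd p) * exp (\<gamma> y (fst p))"
          using reals_Archimedean by blast
        with * show False by (auto simp: inverse_eq_divide)
      qed
    qed
    with jump show False by contradiction
  qed
  then obtain n where n: "0 < measure \<nu> (?E n)" ..
  have "\<exists>x. 0 < K x y"
  proof -
    have "\<exists>y'. 0 < K y y'"
    proof (rule ccontr)
      assume "\<not> ?thesis"
      then have "K y y' = 0" for y' using K_nonneg[of y y'] by (metis less_eq_real_def)
      then show False using K_stochastic[of y] by simp
    qed
    then obtain y' where "(y, y') \<in> {(x, y). 0 < K x y}" by auto
    then have "(y, y) \<in> {(x, y). 0 < K x y}\<^sup>+" by (rule rtrancl_into_trancl2) (rule reach)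
    then show ?thesis by (auto dest: tranclD2)
  qed
  then obtain x' where x': "0 < K x' y" ..
  have base: "escapes x'" by (rule escapes_base[OF x' _ n]) simp
  show ?thesis using reach[of x x']
  proof (induction rule: converse_rtrancl_induct)
    case base
    show ?case by (rule \<open>escapes x'\<close>)
  next
    case (step a b)
    then show ?case by (intro escapes_predecessor[of a b]) auto
  qed
qed

end

section \<open>Identification of the ruin probability and of the one-step moments\<close>

context nominal_model begin

lemma measurable_chain_increments:
  "(\<lambda>\<omega>. \<gamma> (X (Suc n) \<omega>) (\<xi> (Suc n) \<omega>)) \<in> borel_measurable (P x)"
  "(\<lambda>\<omega>. lam (X (Suc n) \<omega>) (\<eta> (Suc n) \<omega>)) \<in> borel_measurable (P x)"
proof -
  have G: "(\<lambda>\<omega>. (\<xi> (Suc n) \<omega>, \<eta> (Suc n) \<omega>)) \<in> P x \<rightarrow>\<^sub>M borel" by (rule noise_measurable) simp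
  then have [measurable]: "\<xi> (Suc n) \<in> borel_measurable (P x)" "\<eta> (Suc n) \<in> borel_measurable (P x)"
    unfolding borel_prod[symmetric] by (auto dest: measurable_fst' measurable_snd' simp: comp_def)
  have "(\<lambda>\<omega>. \<gamma> y (\<xi> (Suc n) \<omega>)) \<in> borel_measurable (P x)" "(\<lambda>\<omega>. lam y (\<eta> (Suc n) \<omega>)) \<in> borel_measurable (P x)" for y
    by (rule measurable_compose[OF _ \<gamma>_measurable], simp, rule measurable_compose[OF _ lam_measurable], simp)
  then show "(\<lambda>\<omega>. \<gamma> (X (Suc n) \<omega>) (\<xi> (Suc n) \<omega>)) \<in> borel_measurable (P x)"
    "(\<lambda>\<omega>. lam (X (Suc n) \<omega>) (\<eta> (Suc n) \<omega>)) \<in> borel_measurable (P x)"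
    using X_measurable by (auto intro: measurable_compose_countable[where f="\<lambda>y \<omega>. \<gamma> y (\<xi> (Suc n) \<omega>)"]
       measurable_compose_countable[where f="\<lambda>y \<omega>. lam y (\<eta> (Suc n) \<omega>)"])
qed

lemma measurable_walk: "walk \<gamma> X \<xi> n \<in> borel_measurable (P x)"
  by (induction n) (auto intro!: borel_measurable_add measurable_chain_increments)

lemma measurable_perpetuity: "perpetuity \<gamma> lam X \<xi> \<eta> \<Delta> n \<in> borel_measurable (P x)"
proof (induction n)
  case (Suc n)
  note measurable_walk[measurable] measurable_chain_increments(2)[measurable] Suc[measurable]
  show ?case unfolding perpetuity.simps by measurable
qed simp

text \<open>
Since jumps are nonnegative, ruin by time \<open>n\<close> is an event about the state at time \<open>n\<close> alone.
\<close>

theorem hit_prob_eq_hit: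
  assumes \<Delta>: "0 \<le> \<Delta>"
  shows "ennreal (hit_prob P \<gamma> lam X \<xi> \<eta> x \<Delta>) = hit \<Delta> (0, 0, x)"
proof -
  interpret prob_space "P x" by (rule prob_space_P)
  let ?D = "perpetuity \<gamma> lam X \<xi> \<eta> \<Delta>"
  let ?A = "\<lambda>n. {\<omega> \<in> space (P x). 1 < ?D n \<omega>}"
  have A: "?A n \<in> sets (P x)" for n using measurable_perpetuity by measurable
  have inc: "incseq ?A"
    using \<Delta> lam_nonneg by (intro incseq_SucI) (auto intro: less_le_trans)
  have law: "emeasure (P x) (?A n) = (step \<Delta> ^^ n) ruin (0, 0, x)" for n
  proof -
    have "emeasure (P x) (?A n) = (\<integral>\<^sup>+\<omega>. ruin (chain_state \<Delta> n \<omega>) \<partial>P x)"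
    proof -
      have "(\<integral>\<^sup>+\<omega>. ruin (chain_state \<Delta> n \<omega>) \<partial>P x) = (\<integral>\<^sup>+\<omega>. indicator (?A n) \<omega> \<partial>P x)"
        by (intro nn_integral_cong) (simp add: indicator_def ruin_def chain_state_def)
      then show ?thesis by (simp only: nn_integral_indicator[OF A])
    qed
    then show ?thesis by (simp add: nn_integral_chain_state)
  qed
  have "ennreal (hit_prob P \<gamma> lam X \<xi> \<eta> x \<Delta>) = emeasure (P x) (\<Union>n. ?A n)"
    unfolding hit_prob_def passage_time_less_top_iff emeasure_eq_measure
    by (intro arg_cong[where f="\<lambda>A. ennreal (prob A)"]) auto
  also have "\<dots> = (SUP n. emeasure (P x) (?A n))"
    using A inc by (intro SUP_emeasure_incseq[symmetric]) auto
  finally show ?thesis by (simp only: law hit_def)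
qed

text \<open>
The jump is recovered from the state after one step with \<open>\<Delta> = 1\<close> as \<open>d * exp (- s)\<close>.
\<close>

lemma nn_integral_first_step:
  assumes [measurable]: "(\<lambda>(a, b). F a b) \<in> borel_measurable (borel \<Otimes>\<^sub>M borel)"
  shows "(\<integral>\<^sup>+\<omega>. F (\<gamma> (X 1 \<omega>) (\<xi> 1 \<omega>)) (lam (X 1 \<omega>) (\<eta> 1 \<omega>)) \<partial>P x)
    = (\<Sum>y\<in>UNIV. ennreal (K x y) * (\<integral>\<^sup>+p. F (\<gamma> y (fst p)) (lam y (snd p)) \<partial>\<nu>))"
proof -
  define f where "f z = F (fst z) (fst (snd z) * exp (- fst z))" for z :: "real \<times> real \<times> 's"
  have "(\<lambda>z :: real \<times> real \<times> 's. (fst z, fst (snd z) * exp (- fst z))) \<in> walk_space \<rightarrow>\<^sub>M borel \<Otimes>\<^sub>M borel"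
    by measurable
  from measurable_compose[OF this assms] have f: "f \<in> borel_measurable walk_space"
    by (simp add: f_def[abs_def])
  have e: "exp t * exp (- t) = 1" for t :: real by (simp add: exp_minus)
  have "(\<integral>\<^sup>+\<omega>. F (\<gamma> (X 1 \<omega>) (\<xi> 1 \<omega>)) (lam (X 1 \<omega>) (\<eta> 1 \<omega>)) \<partial>P x) = (\<integral>\<^sup>+\<omega>. f (chain_state 1 1 \<omega>) \<partial>P x)"
    by (simp add: f_def chain_state_def mult.assoc e)
  also have "\<dots> = step 1 f (0, 0, x)" using nn_integral_chain_state[OF f, where \<Delta>=1 and n=1 and x=x] by simp
  finally show ?thesis by (simp add: step_def f_def move_def mult.assoc e)
qed

end

section \<open>Asymptotics of the parameters\<close>

lemma chi_finite_between:
  assumes "chi_finite \<nu> \<gamma> a" "chi_finite \<nu> \<gamma> b" "a \<le> t" "t \<le> b"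
    and \<gamma>: "\<And>x. (\<lambda>p. \<gamma> x (fst p)) \<in> borel_measurable \<nu>"
  shows "chi_finite \<nu> \<gamma> t"
  unfolding chi_finite_def split_beta
proof
  fix x
  have int: "integrable \<nu> (\<lambda>p. exp (a * \<gamma> x (fst p)) + exp (b * \<gamma> x (fst p)))"
    using assms(1,2) unfolding chi_finite_def split_beta by (intro Bochner_Integration.integrable_add) auto
  note \<gamma>[measurable]
  show "integrable \<nu> (\<lambda>p. exp (t * \<gamma> x (fst p)))"
  proof (rule Bochner_Integration.integrable_bound[OF int])
    show "AE p in \<nu>. norm (exp (t * \<gamma> x (fst p))) \<le> norm (exp (a * \<gamma> x (fst p)) + exp (b * \<gamma> x (fst p)))"
    proof (rule AE_I2)
      fix p
      have "t * \<gamma> x (fst p) \<le> a * \<gamma> x (fst p) \<or> t * \<gamma> x (fst p) \<le> b * \<gamma> x (fst p)"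
        using assms(3,4) by (cases "0 \<le> \<gamma> x (fst p)") (auto intro: mult_right_mono mult_right_mono_neg)
      then have "exp (t * \<gamma> x (fst p)) \<le> exp (a * \<gamma> x (fst p)) \<or> exp (t * \<gamma> x (fst p)) \<le> exp (b * \<gamma> x (fst p))"
        by simp
      moreover have "0 < exp (a * \<gamma> x (fst p))" "0 < exp (b * \<gamma> x (fst p))" by simp_all
      ultimately have "exp (t * \<gamma> x (fst p)) \<le> exp (a * \<gamma> x (fst p)) + exp (b * \<gamma> x (fst p))" by linarith
      then show "norm (exp (t * \<gamma> x (fst p))) \<le> norm (exp (a * \<gamma> x (fst p)) + exp (b * \<gamma> x (fst p)))" by simp
    qed
  qed measurable
qed

lemma rho_tendsto_0: "(rho \<longlongrightarrow> 0) (at_right 0)"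
  unfolding rho_def[abs_def] by real_asymp

lemma eventually_rho_small:
  assumes "0 < r"
  shows "\<forall>\<^sub>F \<Delta> in at_right 0. 0 < \<Delta> \<and> \<Delta> < 1 \<and> 0 < rho \<Delta> \<and> rho \<Delta> < r"
proof -
  have "\<forall>\<^sub>F \<Delta> in at_right (0 :: real). \<Delta> \<in> {0<..<1}" by (rule eventually_at_right_real) simp
  moreover have "\<forall>\<^sub>F \<Delta> in at_right 0. rho \<Delta> < r" using assms by (rule order_tendstoD(2)[OF rho_tendsto_0])
  ultimately show ?thesis by eventually_elim (auto simp: rho_def ln_div)
qed

lemma powr_rho: "0 < \<Delta> \<Longrightarrow> \<Delta> < 1 \<Longrightarrow> \<Delta> powr rho \<Delta> = exp (- 1)"
  by (simp add: powr_def rho_def ln_div)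

lemma eventually_cfun_ge_1:
  assumes "0 < \<theta>s" "0 < B1" "0 < B2"
  shows "\<forall>\<^sub>F \<Delta> in at_right 0. 1 \<le> cfun \<theta>s B1 B2 \<Delta>"
proof -
  have "\<forall>\<^sub>F \<Delta> in at_right 0. 0 < \<Delta> \<and> \<Delta> < 1 \<and> 0 < rho \<Delta> \<and> rho \<Delta> < min (min 1 \<theta>s) (B2 / B1)"
    using assms by (intro eventually_rho_small) simp
  then show ?thesis
  proof eventually_elim
    fix \<Delta> assume *: "0 < \<Delta> \<and> \<Delta> < 1 \<and> 0 < rho \<Delta> \<and> rho \<Delta> < min (min 1 \<theta>s) (B2 / B1)"
    have "(B2 / B1) powr (- 1) \<le> rho \<Delta> powr (- 1)"
      using * by (intro powr_mono2') auto
    also have "\<dots> \<le> rho \<Delta> powr (- (1 + 1 / (2 * \<theta>s - rho \<Delta>)))"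
      using * by (intro powr_mono') auto
    finally have "(B2 / B1) * (B2 / B1) powr (- 1) \<le> cfun \<theta>s B1 B2 \<Delta>"
      unfolding cfun_def using assms by (intro mult_left_mono) auto
    then show "1 \<le> cfun \<theta>s B1 B2 \<Delta>" using assms by (simp add: powr_minus)
  qed
qed

text \<open>
For \<open>rho \<Delta> < \<theta>s\<close> the exponent \<open>1 / (2 * \<theta>s - rho \<Delta>)\<close> is below \<open>1 / \<theta>s\<close>, so \<open>cfun\<close> is at most a
fixed power of \<open>ln (1 / \<Delta>)\<close>.
\<close>

lemma cfun_subpolynomial:
  assumes "0 < \<theta>s" "0 < B1" "0 < B2" "0 < \<epsilon>"
  shows "\<forall>\<^sub>F \<Delta> in at_right 0. cfun \<theta>s B1 B2 \<Delta> powr (2 * \<theta>s) * \<Delta> powr \<epsilon> \<le> 1"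
proof -
  have lim: "((\<lambda>\<Delta>. ((B2 / B1) * (ln (1 / \<Delta>)) powr (1 + 1 / \<theta>s)) powr (2 * \<theta>s) * \<Delta> powr \<epsilon>) \<longlongrightarrow> 0) (at_right 0)"
  proof -
    have "((\<lambda>\<Delta>. (ln (1 / \<Delta>)) powr ((1 + 1 / \<theta>s) * (2 * \<theta>s)) * \<Delta> powr \<epsilon>) \<longlongrightarrow> 0) (at_right 0)"
      using assms by real_asymp
    then have "((\<lambda>\<Delta>. (B2 / B1) powr (2 * \<theta>s) * ((ln (1 / \<Delta>)) powr ((1 + 1 / \<theta>s) * (2 * \<theta>s)) * \<Delta> powr \<epsilon>)) \<longlongrightarrow> (B2 / B1) powr (2 * \<theta>s) * 0) (at_right 0)"
      by (intro tendsto_intros)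
    moreover have "(B2 / B1 * L powr k) powr t * D = (B2 / B1) powr t * (L powr (k * t) * D)" for L k t D :: real
      using assms by (subst powr_mult) (simp_all add: powr_powr mult.assoc)
    ultimately show ?thesis by (simp only: mult_zero_right)
  qed
  have "\<forall>\<^sub>F \<Delta> in at_right 0. ((B2 / B1) * (ln (1 / \<Delta>)) powr (1 + 1 / \<theta>s)) powr (2 * \<theta>s) * \<Delta> powr \<epsilon> < 1"
    by (rule order_tendstoD(2)[OF lim]) simp
  moreover have "\<forall>\<^sub>F \<Delta> in at_right 0. 0 < \<Delta> \<and> \<Delta> < 1 \<and> 0 < rho \<Delta> \<and> rho \<Delta> < min 1 \<theta>s"
    using assms by (intro eventually_rho_small) simp
  ultimately show ?thesis
  proof eventually_elim
    fix \<Delta> assume 1: "((B2 / B1) * (ln (1 / \<Delta>)) powr (1 + 1 / \<theta>s)) powr (2 * \<theta>s) * \<Delta> powr \<epsilon> < 1"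
      and 2: "0 < \<Delta> \<and> \<Delta> < 1 \<and> 0 < rho \<Delta> \<and> rho \<Delta> < min 1 \<theta>s"
    have "1 / (2 * \<theta>s - rho \<Delta>) \<le> 1 / \<theta>s" using 2 assms by (intro divide_left_mono) auto
    then have "rho \<Delta> powr (- (1 + 1 / (2 * \<theta>s - rho \<Delta>))) \<le> rho \<Delta> powr (- (1 + 1 / \<theta>s))"
      using 2 by (intro powr_mono') auto
    also have "\<dots> = (ln (1 / \<Delta>)) powr (1 + 1 / \<theta>s)"
    proof -
      have "(1 / L) powr (- k) = L powr k" if "0 < L" for L k :: real
        using that by (simp add: powr_divide powr_minus)
      moreover have "0 < ln (1 / \<Delta>)" using 2 by (simp add: rho_def)
      ultimately show ?thesis unfolding rho_def by blast
    qed
    finally have "cfun \<theta>s B1 B2 \<Delta> \<le> (B2 / B1) * (ln (1 / \<Delta>)) powr (1 + 1 / \<theta>s)"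
      unfolding cfun_def using assms by (intro mult_left_mono) auto
    then have "cfun \<theta>s B1 B2 \<Delta> powr (2 * \<theta>s) \<le> ((B2 / B1) * (ln (1 / \<Delta>)) powr (1 + 1 / \<theta>s)) powr (2 * \<theta>s)"
      using assms 2 by (intro powr_mono2) (auto simp: cfun_def)
    then have "cfun \<theta>s B1 B2 \<Delta> powr (2 * \<theta>s) * \<Delta> powr \<epsilon>
        \<le> ((B2 / B1) * (ln (1 / \<Delta>)) powr (1 + 1 / \<theta>s)) powr (2 * \<theta>s) * \<Delta> powr \<epsilon>"
      by (rule mult_right_mono) simp
    with 1 show "cfun \<theta>s B1 B2 \<Delta> powr (2 * \<theta>s) * \<Delta> powr \<epsilon> \<le> 1" by linarith
  qed
qed

text \<open>
The correction \<open>rho \<Delta>\<close> in the exponent of \<open>\<Delta>\<close> costs only a factor \<open>exp 1\<close>, by \<open>powr_rho\<close>, so \<open>E\<close> is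
at most of order \<open>(\<Delta> powr \<theta>s)^2\<close> up to a power of \<open>cfun\<close>, while \<open>\<phi>\<close> is at least of order \<open>\<Delta> powr \<theta>s\<close>.
\<close>

lemma second_moment_asymptotics:
  fixes E \<phi> :: "real \<Rightarrow> real"
  assumes \<theta>s: "0 < \<theta>s" and B: "0 < B1" "0 < B2" and M: "0 < M" and c: "0 < c"
    and E_nonneg: "\<And>\<Delta>. 0 \<le> E \<Delta>"
    and E: "\<forall>\<^sub>F \<Delta> in at_right 0. E \<Delta> \<le> M * (cfun \<theta>s B1 B2 \<Delta> * \<Delta>) powr (2 * \<theta>s - rho \<Delta>)"
    and \<phi>: "\<forall>\<^sub>F \<Delta> in at_right 0. c * \<Delta> powr \<theta>s \<le> \<phi> \<Delta>"
    and \<phi>_le: "\<And>\<Delta>. \<phi> \<Delta> \<le> 1"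
  shows "(\<lambda>\<Delta>. sqrt (E \<Delta>) / \<phi> \<Delta>) \<in> O[at_right 0](\<lambda>\<Delta>. cfun \<theta>s B1 B2 \<Delta> powr (2 * \<theta>s))"
    and "0 < \<epsilon> \<Longrightarrow> E \<in> O[at_right 0](\<lambda>\<Delta>. \<phi> \<Delta> powr (2 - \<epsilon>))"
proof -
  let ?C = "cfun \<theta>s B1 B2"
  have "\<forall>\<^sub>F \<Delta> in at_right 0. 0 < \<Delta> \<and> \<Delta> < 1 \<and> 0 < rho \<Delta> \<and> rho \<Delta> < \<theta>s"
    using \<theta>s by (intro eventually_rho_small) simp
  with eventually_cfun_ge_1[OF \<theta>s B] E
  have bound: "\<forall>\<^sub>F \<Delta> in at_right 0. 0 < \<Delta> \<and> \<Delta> < 1 \<and> 1 \<le> ?C \<Delta> \<and> E \<Delta> \<le> M * exp 1 * (?C \<Delta> powr (2 * \<theta>s) * (\<Delta> powr \<theta>s)\<^sup>2)"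
  proof eventually_elim
    fix \<Delta> assume 1: "1 \<le> ?C \<Delta>" and 2: "E \<Delta> \<le> M * (?C \<Delta> * \<Delta>) powr (2 * \<theta>s - rho \<Delta>)"
      and 3: "0 < \<Delta> \<and> \<Delta> < 1 \<and> 0 < rho \<Delta> \<and> rho \<Delta> < \<theta>s"
    have "\<Delta> powr (2 * \<theta>s - rho \<Delta>) = exp 1 * (\<Delta> powr \<theta>s)\<^sup>2"
      using 3 by (simp add: powr_diff powr_rho exp_minus power2_eq_square powr_add[symmetric] divide_inverse mult.commute)
    then have "(?C \<Delta> * \<Delta>) powr (2 * \<theta>s - rho \<Delta>) = ?C \<Delta> powr (2 * \<theta>s - rho \<Delta>) * (exp 1 * (\<Delta> powr \<theta>s)\<^sup>2)"
      using 1 3 by (simp add: powr_mult)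
    also have "\<dots> \<le> ?C \<Delta> powr (2 * \<theta>s) * (exp 1 * (\<Delta> powr \<theta>s)\<^sup>2)"
      using 1 3 by (intro mult_right_mono powr_mono) auto
    finally have "M * (?C \<Delta> * \<Delta>) powr (2 * \<theta>s - rho \<Delta>) \<le> M * (?C \<Delta> powr (2 * \<theta>s) * (exp 1 * (\<Delta> powr \<theta>s)\<^sup>2))"
      using M by (intro mult_left_mono) auto
    with 1 2 3 show "0 < \<Delta> \<and> \<Delta> < 1 \<and> 1 \<le> ?C \<Delta> \<and> E \<Delta> \<le> M * exp 1 * (?C \<Delta> powr (2 * \<theta>s) * (\<Delta> powr \<theta>s)\<^sup>2)"
      by (simp add: ac_simps)
  qed
  show "(\<lambda>\<Delta>. sqrt (E \<Delta>) / \<phi> \<Delta>) \<in> O[at_right 0](\<lambda>\<Delta>. ?C \<Delta> powr (2 * \<theta>s))"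
  proof (rule bigoI[where c="sqrt (M * exp 1) / c"])
    show "\<forall>\<^sub>F \<Delta> in at_right 0. norm (sqrt (E \<Delta>) / \<phi> \<Delta>) \<le> sqrt (M * exp 1) / c * norm (?C \<Delta> powr (2 * \<theta>s))"
      using bound \<phi>
    proof eventually_elim
      fix \<Delta> assume 1: "0 < \<Delta> \<and> \<Delta> < 1 \<and> 1 \<le> ?C \<Delta> \<and> E \<Delta> \<le> M * exp 1 * (?C \<Delta> powr (2 * \<theta>s) * (\<Delta> powr \<theta>s)\<^sup>2)"
        and 2: "c * \<Delta> powr \<theta>s \<le> \<phi> \<Delta>"
      let ?D = "\<Delta> powr \<theta>s"
      have D: "0 < ?D" using 1 by simp
      have \<phi>_pos: "0 < \<phi> \<Delta>" using 2 D c by (meson less_le_trans mult_pos_pos)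
      have C1: "1 \<le> ?C \<Delta> powr (2 * \<theta>s)" using 1 \<theta>s by (simp add: ge_one_powr_ge_zero)
      have "sqrt (E \<Delta>) \<le> sqrt (M * exp 1 * ((?C \<Delta> powr (2 * \<theta>s))\<^sup>2 * ?D\<^sup>2))"
      proof (rule real_sqrt_le_mono)
        \<comment> \<open>The sharper bound has the square root of this power; squaring is generous since \<open>?C \<Delta> \<ge> 1\<close>.\<close>
        have "?C \<Delta> powr (2 * \<theta>s) \<le> (?C \<Delta> powr (2 * \<theta>s))\<^sup>2"
          using mult_left_mono[OF C1, of "?C \<Delta> powr (2 * \<theta>s)"] by (simp add: power2_eq_square)
        then have "M * exp 1 * (?C \<Delta> powr (2 * \<theta>s) * ?D\<^sup>2) \<le> M * exp 1 * ((?C \<Delta> powr (2 * \<theta>s))\<^sup>2 * ?D\<^sup>2)"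
          using M by (intro mult_left_mono mult_right_mono) auto
        with 1 show "E \<Delta> \<le> M * exp 1 * ((?C \<Delta> powr (2 * \<theta>s))\<^sup>2 * ?D\<^sup>2)" by linarith
      qed
      also have "\<dots> = sqrt (M * exp 1) * (?C \<Delta> powr (2 * \<theta>s) * ?D)"
        using C1 D by (simp add: real_sqrt_mult)
      finally have "sqrt (E \<Delta>) / \<phi> \<Delta> \<le> sqrt (M * exp 1) * (?C \<Delta> powr (2 * \<theta>s) * ?D) / (c * ?D)"
        using 2 c D M by (intro frac_le) auto
      also have "\<dots> = sqrt (M * exp 1) / c * ?C \<Delta> powr (2 * \<theta>s)" using D by simp
      finally show "norm (sqrt (E \<Delta>) / \<phi> \<Delta>) \<le> sqrt (M * exp 1) / c * norm (?C \<Delta> powr (2 * \<theta>s))"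
        using E_nonneg[of \<Delta>] \<phi>_pos by simp
    qed
  qed
  assume \<epsilon>: "0 < \<epsilon>"
  \<comment> \<open>For large \<open>\<epsilon>\<close> the exponent \<open>2 - \<epsilon>\<close> may be negative; since \<open>\<phi> \<le> 1\<close>, small \<open>\<epsilon>\<close> suffice.\<close>
  define e where "e = min \<epsilon> 1"
  have e: "0 < e" "e \<le> \<epsilon>" "e \<le> 1" using \<epsilon> by (auto simp: e_def)
  have "\<forall>\<^sub>F \<Delta> in at_right 0. ?C \<Delta> powr (2 * \<theta>s) * \<Delta> powr (\<theta>s * e) \<le> 1"
    using \<theta>s B e by (intro cfun_subpolynomial) auto
  with bound \<phi> show "E \<in> O[at_right 0](\<lambda>\<Delta>. \<phi> \<Delta> powr (2 - \<epsilon>))"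
  proof (intro bigoI[where c="M * exp 1 / c powr (2 - e)"], eventually_elim)
    fix \<Delta> assume 1: "0 < \<Delta> \<and> \<Delta> < 1 \<and> 1 \<le> ?C \<Delta> \<and> E \<Delta> \<le> M * exp 1 * (?C \<Delta> powr (2 * \<theta>s) * (\<Delta> powr \<theta>s)\<^sup>2)"
      and 2: "c * \<Delta> powr \<theta>s \<le> \<phi> \<Delta>" and 3: "?C \<Delta> powr (2 * \<theta>s) * \<Delta> powr (\<theta>s * e) \<le> 1"
    let ?D = "\<Delta> powr \<theta>s"
    have D: "0 < ?D" using 1 by simp
    have \<phi>_pos: "0 < \<phi> \<Delta>" using 2 D c by (meson less_le_trans mult_pos_pos)
    have "(\<Delta> powr \<theta>s)\<^sup>2 = \<Delta> powr (\<theta>s * e) * ?D powr (2 - e)"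
      by (simp add: power2_eq_square powr_powr powr_add[symmetric] algebra_simps)
    then have "E \<Delta> \<le> M * exp 1 * ((?C \<Delta> powr (2 * \<theta>s) * \<Delta> powr (\<theta>s * e)) * ?D powr (2 - e))"
      using 1 by (simp add: mult.assoc)
    also have "\<dots> \<le> M * exp 1 * (1 * ?D powr (2 - e))"
      using M 3 by (intro mult_left_mono mult_right_mono) auto
    also have "\<dots> = M * exp 1 / c powr (2 - e) * (c * ?D) powr (2 - e)"
      using c D by (simp add: powr_mult)
    also have "\<dots> \<le> M * exp 1 / c powr (2 - e) * \<phi> \<Delta> powr (2 - e)"
      using M c D e 2 by (intro mult_left_mono powr_mono2) auto
    also have "\<dots> \<le> M * exp 1 / c powr (2 - e) * \<phi> \<Delta> powr (2 - \<epsilon>)"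
      using M c \<phi>_pos \<phi>_le[of \<Delta>] e by (intro mult_left_mono powr_mono') auto
    finally show "norm (E \<Delta>) \<le> M * exp 1 / c powr (2 - e) * norm (\<phi> \<Delta> powr (2 - \<epsilon>))"
      using E_nonneg[of \<Delta>] by simp
  qed
qed

section \<open>Efficiency of the estimator\<close>

context tilted_sampler begin

text \<open>
On a finite state space all positive functions are comparable, which provides the constants.
\<close>

lemma cramer_walk_exists:
  assumes \<delta>: "0 < \<delta>" and fin: "chi_finite \<nu> \<gamma> (\<theta>s - \<delta>)" "chi_finite \<nu> \<gamma> (\<theta>s + \<delta>)"
    and v: "\<And>x. 0 < v x" and q: "0 \<le> q" "q < 1"
    and eig: "\<And>x. (\<Sum>y\<in>UNIV. Qmat K \<nu> \<gamma> (\<theta>s - \<delta>) x y * v y) = q * v x"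
  shows "\<exists>lo hi C. cramer_walk K \<nu> \<gamma> lam \<theta>s \<delta> q lo hi C (u \<theta>s) v"
proof -
  let ?ratio = "\<lambda>x. v x / u \<theta>s x"
  define T where "T x = (\<Sum>y\<in>UNIV. Qmat K \<nu> \<gamma> (\<theta>s + \<delta>) x y * u \<theta>s y)" for x
  have T: "0 \<le> T x" for x
    unfolding T_def Qmat_def using K_nonneg u_\<theta>s_pos by (intro sum_nonneg) (simp add: less_imp_le)
  let ?lo = "Min (range ?ratio)" and ?hi = "Max (range ?ratio)" and ?C = "Max (range (\<lambda>x. T x / u \<theta>s x))"
  have "0 < ?lo" using v u_\<theta>s_pos by (subst Min_gr_iff) auto
  moreover have "?lo * u \<theta>s x \<le> v x" for x
  proof -
    have "?lo \<le> ?ratio x" by (rule Min_le) auto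
    then show ?thesis using u_\<theta>s_pos[of x] by (simp add: pos_le_divide_eq)
  qed
  moreover have "v x \<le> ?hi * u \<theta>s x" for x
  proof -
    have "?ratio x \<le> ?hi" by (rule Max_ge) auto
    then show ?thesis by (simp only: pos_divide_le_eq[OF u_\<theta>s_pos])
  qed
  moreover have C: "T x \<le> ?C * u \<theta>s x" for x
  proof -
    have "T x / u \<theta>s x \<le> ?C" by (rule Max_ge) auto
    then show ?thesis by (simp only: pos_divide_le_eq[OF u_\<theta>s_pos])
  qed
  moreover have "0 \<le> ?C"
  proof -
    have "0 \<le> T undefined / u \<theta>s undefined" using T u_\<theta>s_pos by (simp add: less_imp_le)
    also have "\<dots> \<le> ?C" by (rule Max_ge) auto
    finally show ?thesis .
  qed
  moreover have "(\<Sum>y\<in>UNIV. ennreal (K x y) * (\<integral>\<^sup>+p. ennreal (exp (\<theta>s * \<gamma> y (fst p)) * u \<theta>s y) \<partial>\<nu>)) = ennreal (u \<theta>s x)" for x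
    using step_exponential[OF chi_finite_\<theta>s less_imp_le[OF u_\<theta>s_pos], where r=1 and x=x] eigenvector_\<theta>s by simp
  moreover have "(\<Sum>y\<in>UNIV. ennreal (K x y) * (\<integral>\<^sup>+p. ennreal (exp ((\<theta>s - \<delta>) * \<gamma> y (fst p)) * v y) \<partial>\<nu>)) = ennreal (q * v x)" for x
    by (rule step_exponential[OF fin(1) less_imp_le[OF v] eig])
  moreover have "(\<Sum>y\<in>UNIV. ennreal (K x y) * (\<integral>\<^sup>+p. ennreal (exp ((\<theta>s + \<delta>) * \<gamma> y (fst p)) * u \<theta>s y) \<partial>\<nu>)) \<le> ennreal (?C * u \<theta>s x)" for x
  proof -
    have "(\<Sum>y\<in>UNIV. ennreal (K x y) * (\<integral>\<^sup>+p. ennreal (exp ((\<theta>s + \<delta>) * \<gamma> y (fst p)) * u \<theta>s y) \<partial>\<nu>))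
        = (\<Sum>y\<in>UNIV. ennreal (Qmat K \<nu> \<gamma> (\<theta>s + \<delta>) x y * u \<theta>s y))"
      using K_nonneg u_\<theta>s_pos
      by (simp add: ennreal_mult nn_integral_multc nn_integral_exp_increment[OF fin(2)] Qmat_def less_imp_le mult.assoc)
    also have "\<dots> = ennreal (T x)"
      unfolding T_def using K_nonneg u_\<theta>s_pos by (intro sum_ennreal) (simp add: Qmat_def less_imp_le)
    finally show ?thesis using C[of x] by (simp add: ennreal_leI)
  qed
  ultimately have "cramer_walk K \<nu> \<gamma> lam \<theta>s \<delta> q ?lo ?hi ?C (u \<theta>s) v"
    using \<delta> q u_\<theta>s_pos nominal_kernel_axioms
    by (intro cramer_walk.intro cramer_walk_axioms.intro)
  then show ?thesis by blast
qed

end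

theorem theorem3:
  fixes P :: "'s::finite \<Rightarrow> 'w measure"
    and X :: "nat \<Rightarrow> 'w \<Rightarrow> 's"
    and \<xi> \<eta> :: "nat \<Rightarrow> 'w \<Rightarrow> real"
    and K :: "'s \<Rightarrow> 's \<Rightarrow> real"
    and \<nu> :: "(real \<times> real) measure"
    and \<gamma> lam :: "'s \<Rightarrow> real \<Rightarrow> real"
    and W :: "'s \<Rightarrow> real \<Rightarrow> real measure"
    and u :: "real \<Rightarrow> 's \<Rightarrow> real"
    and x0 :: 's
    and \<theta>s \<mu> b0 b1 b2 B1 B2 :: real
  assumes model: "nominal_model P X \<xi> \<eta> K \<nu> \<gamma> lam"
    and irreducible: "\<And>x y. \<exists>n. measure (P x) {\<omega> \<in> space (P x). X n \<omega> = y} > 0"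
    and mgf: "\<exists>N. open N \<and> 0 \<in> N \<and>
          (SUP (x, \<theta>)\<in>UNIV \<times> N. \<integral>\<^sup>+(a, b). ennreal (exp (\<theta> * \<gamma> x a)) \<partial>\<nu>) < \<infinity>"
    and cramer: "0 < \<theta>s" "psi K \<nu> \<gamma> \<theta>s = 0" "\<exists>\<theta>>\<theta>s. psi K \<nu> \<gamma> \<theta> < \<infinity>"
    and lam_moments: "\<And>\<alpha>. 0 < \<alpha> \<Longrightarrow>
          (SUP x. \<integral>\<^sup>+\<omega>. ennreal (lam (X 1 \<omega>) (\<eta> 1 \<omega>) powr \<alpha>) \<partial>P x) < \<infinity>"
    and eigenvectors: "perron_eigenvectors K \<nu> \<gamma> u"
    and u_continuous: "\<And>x. continuous_on {0<..\<theta>s} (\<lambda>\<theta>. u \<theta> x)"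
    and b0: "0 < 1 / (INF (\<theta>, x)\<in>{0<..<\<theta>s} \<times> UNIV. u \<theta> x)\<^sup>2"
            "1 / (INF (\<theta>, x)\<in>{0<..<\<theta>s} \<times> UNIV. u \<theta> x)\<^sup>2 \<le> b0"
    and \<mu>: "((\<lambda>\<theta>. psi_real K \<nu> \<gamma> \<theta>) has_real_derivative \<mu>) (at \<theta>s)" "0 < \<mu>"
    and b1: "0 < b1"
            "\<And>\<delta>. \<delta> \<in> {0<..<\<theta>s} \<Longrightarrow> exp (psi_real K \<nu> \<gamma> (\<theta>s - \<delta>)) \<le> 1 - \<delta> * \<mu> + b1 * \<delta>\<^sup>2"
    and b2: "0 < b2"
            "(SUP (x, \<delta>)\<in>UNIV \<times> {0<..<\<theta>s}. \<integral>\<^sup>+\<omega>. ennreal (lam (X 1 \<omega>) (\<eta> 1 \<omega>) powr (2 * \<theta>s - \<delta>)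
                 * exp ((\<theta>s - \<delta>) * \<gamma> (X 1 \<omega>) (\<xi> 1 \<omega>))) \<partial>P x) \<le> ennreal b2"
    and B: "0 < B1" "0 < B2"
    and selection: "\<forall>\<^sub>F \<Delta> in at_right 0.
          rho \<Delta> \<in> {0<..<\<theta>s} \<and> B1 * rho \<Delta> < 1 \<and>
          b0 * b2 * rho \<Delta> / B2 powr (2 * \<theta>s - rho \<Delta>)
            + (1 - rho \<Delta> * \<mu> + b1 * (rho \<Delta>)\<^sup>2) / (1 - B1 * rho \<Delta>) powr (2 * \<theta>s - rho \<Delta>) \<le> 1"
    and cond_law: "regular_cond_law \<nu> \<gamma> lam W"
  defines "\<phi> \<equiv> hit_prob P \<gamma> lam X \<xi> \<eta> x0"
    and "R \<equiv> alg_law K \<nu> \<gamma> lam W u \<theta>s B1 B2 x0"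
  shows "(\<forall>\<^sub>F \<Delta> in at_right 0. integrable (R \<Delta>) (\<lambda>\<tau>. (estimator \<tau>)\<^sup>2)) \<and>
         (\<lambda>\<Delta>. coeff_of_variation (R \<Delta>) estimator)
            \<in> O[at_right 0](\<lambda>\<Delta>. cfun \<theta>s B1 B2 \<Delta> powr (2 * \<theta>s)) \<and>
         (\<forall>\<Delta>>0. rho \<Delta> \<in> {0<..<\<theta>s} \<longrightarrow> has_bochner_integral (R \<Delta>) estimator (\<phi> \<Delta>)) \<and>
         (\<forall>\<epsilon>>0. (\<lambda>\<Delta>. \<integral>\<tau>. (estimator \<tau>)\<^sup>2 \<partial>R \<Delta>) \<in> O[at_right 0](\<lambda>\<Delta>. \<phi> \<Delta> powr (2 - \<epsilon>)))"
proof -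
  interpret model: nominal_model P X \<xi> \<eta> K \<nu> \<gamma> lam by (rule model)
  have \<gamma>_meas: "(\<lambda>p. \<gamma> x (fst p)) \<in> borel_measurable \<nu>" for x
    by (rule model.measurable_increments(1))
  have fin_s: "chi_finite \<nu> \<gamma> \<theta>s" using cramer(2) by (auto simp: psi_def split: if_splits)
  have fin_0: "chi_finite \<nu> \<gamma> 0" unfolding chi_finite_def case_prod_unfold by simp
  have fin: "chi_finite \<nu> \<gamma> \<theta>" if "0 \<le> \<theta>" "\<theta> \<le> \<theta>s" for \<theta>
    using chi_finite_between[OF fin_0 fin_s that \<gamma>_meas] .
  obtain \<theta>' where \<theta>': "\<theta>s < \<theta>'" "chi_finite \<nu> \<gamma> \<theta>'"
    using cramer(3) by (auto simp: psi_def split: if_splits)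
  have u_pos: "0 < u \<theta> x" if "0 \<le> \<theta>" "\<theta> \<le> \<theta>s" for \<theta> x
    using eigenvectors fin[OF that] unfolding perron_eigenvectors_def by blast
  have eig: "(\<Sum>y\<in>UNIV. Qmat K \<nu> \<gamma> \<theta> x y * u \<theta> y) = exp (psi_real K \<nu> \<gamma> \<theta>) * u \<theta> x"
    if "0 \<le> \<theta>" "\<theta> \<le> \<theta>s" for \<theta> x
    using eigenvectors fin[OF that] unfolding perron_eigenvectors_def by blast
  have psi_s: "psi_real K \<nu> \<gamma> \<theta>s = 0" using cramer(2) by simp
  interpret S: tilted_sampler K \<nu> \<gamma> lam W u \<theta>s
  proof (intro tilted_sampler.intro tilted_sampler_axioms.intro)
    show "nominal_kernel K \<nu> \<gamma> lam" by (rule model.nominal_kernel_axioms)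
    show "(\<Sum>y\<in>UNIV. Qmat K \<nu> \<gamma> \<theta>s x y * u \<theta>s y) = u \<theta>s x" for x
      using eig[of \<theta>s x] cramer(1) psi_s by simp
  qed (use cond_law fin_s psi_s u_pos[of \<theta>s] cramer(1) in simp_all)

  define m where "m = (INF (\<theta>, x)\<in>{0<..<\<theta>s} \<times> UNIV. u \<theta> x)"
  have m_le: "m \<le> u \<theta> x" if "0 < \<theta>" "\<theta> < \<theta>s" for \<theta> x
  proof -
    have "bdd_below ((\<lambda>(\<theta>, x). u \<theta> x) ` ({0<..<\<theta>s} \<times> UNIV))"
      by (intro bdd_belowI[of _ 0]) (auto intro!: less_imp_le u_pos)
    then have "(INF (\<theta>, x)\<in>{0<..<\<theta>s} \<times> UNIV. u \<theta> x) \<le> (case (\<theta>, x) of (\<theta>, x) \<Rightarrow> u \<theta> x)"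
      using that by (intro cINF_lower) auto
    then show ?thesis by (simp add: m_def)
  qed
  have m_pos: "0 < m"
  proof -
    have "0 \<le> m"
      unfolding m_def using cramer(1) by (intro cINF_greatest) (auto intro!: less_imp_le u_pos)
    moreover have "m \<noteq> 0" using b0(1) unfolding m_def[symmetric] by auto
    ultimately show ?thesis by simp
  qed
  \<comment> \<open>Continuity up to \<open>\<theta>s\<close> extends the lower bound \<open>m\<close> to \<open>u \<theta>s\<close>, and bounds \<open>u (\<theta>s - rho \<Delta>) x0\<close> from above.\<close>
  have u_tendsto: "((\<lambda>\<Delta>. u (\<theta>s - rho \<Delta>) x) \<longlongrightarrow> u \<theta>s x) (at_right 0)" for x
  proof (rule continuous_on_tendsto_compose[OF u_continuous])
    show "((\<lambda>\<Delta>. \<theta>s - rho \<Delta>) \<longlongrightarrow> \<theta>s) (at_right 0)"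
      using tendsto_diff[OF tendsto_const rho_tendsto_0, of \<theta>s] by simp
    show "\<theta>s \<in> {0<..\<theta>s}" using cramer(1) by simp
    show "\<forall>\<^sub>F \<Delta> in at_right 0. \<theta>s - rho \<Delta> \<in> {0<..\<theta>s}"
      using eventually_rho_small[OF cramer(1)] by eventually_elim auto
  qed
  have m_le_s: "m \<le> u \<theta>s x" for x
  proof (rule tendsto_lowerbound[OF u_tendsto])
    show "\<forall>\<^sub>F \<Delta> in at_right 0. m \<le> u (\<theta>s - rho \<Delta>) x"
      using eventually_rho_small[OF cramer(1)] by eventually_elim (rule m_le, auto)
  qed simp

  have prob_R: "prob_space (R \<Delta>)" for \<Delta>
    unfolding R_def by (rule S.prob_space_sampler_law)
  have est_meas: "estimator \<in> borel_measurable (R \<Delta>)" for \<Delta>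
    unfolding R_def measurable_cong_sets[OF S.sets_sampler_law refl] by (rule measurable_estimator)
  have \<phi>_bounds: "0 \<le> \<phi> \<Delta>" "\<phi> \<Delta> \<le> 1" for \<Delta>
    unfolding \<phi>_def hit_prob_def by (simp_all add: prob_space.prob_le_1[OF model.prob_space_P])
  have \<phi>_hit: "ennreal (\<phi> \<Delta>) = model.hit \<Delta> (0, 0, x0)" if "0 < \<Delta>" for \<Delta>
    unfolding \<phi>_def using model.hit_prob_eq_hit that by simp
  have unbiased: "has_bochner_integral (R \<Delta>) estimator (\<phi> \<Delta>)" if "0 < \<Delta>" for \<Delta>
  proof (rule has_bochner_integral_nn_integral[OF est_meas])
    show "AE \<tau> in R \<Delta>. 0 \<le> estimator \<tau>" unfolding R_def by (rule S.AE_estimator_nonneg)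
    show "(\<integral>\<^sup>+\<tau>. ennreal (estimator \<tau>) \<partial>R \<Delta>) = ennreal (\<phi> \<Delta>)"
      unfolding R_def \<phi>_hit[OF that] using S.expectation_estimator that by simp
  qed (rule \<phi>_bounds)

  define E where "E \<Delta> = (\<integral>\<tau>. (estimator \<tau>)\<^sup>2 \<partial>R \<Delta>)" for \<Delta>
  have E_nonneg: "0 \<le> E \<Delta>" for \<Delta> unfolding E_def by simp
  have second_moment: "\<forall>\<^sub>F \<Delta> in at_right 0.
      (\<integral>\<^sup>+\<tau>. ennreal ((estimator \<tau>)\<^sup>2) \<partial>R \<Delta>) \<le> ennreal (hfun u \<theta>s B1 B2 \<Delta> (0, 0, x0))"
    using selection eventually_rho_small[OF cramer(1)]
  proof eventually_elim
    fix \<Delta>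
    assume sel: "rho \<Delta> \<in> {0<..<\<theta>s} \<and> B1 * rho \<Delta> < 1 \<and>
          b0 * b2 * rho \<Delta> / B2 powr (2 * \<theta>s - rho \<Delta>)
            + (1 - rho \<Delta> * \<mu> + b1 * (rho \<Delta>)\<^sup>2) / (1 - B1 * rho \<Delta>) powr (2 * \<theta>s - rho \<Delta>) \<le> 1"
      and \<Delta>: "0 < \<Delta> \<and> \<Delta> < 1 \<and> 0 < rho \<Delta> \<and> rho \<Delta> < \<theta>s"
    let ?r = "exp (psi_real K \<nu> \<gamma> (\<theta>s - rho \<Delta>))"
    let ?D = "(1 - B1 * rho \<Delta>) powr (2 * \<theta>s - rho \<Delta>)"
    show "(\<integral>\<^sup>+\<tau>. ennreal ((estimator \<tau>)\<^sup>2) \<partial>R \<Delta>) \<le> ennreal (hfun u \<theta>s B1 B2 \<Delta> (0, 0, x0))"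
      unfolding R_def
    proof (rule S.second_moment_sampler_le_hfun)
      show "chi_finite \<nu> \<gamma> (\<theta>s - rho \<Delta>)" using \<Delta> by (intro fin) auto
      show "(\<Sum>y\<in>UNIV. Qmat K \<nu> \<gamma> (\<theta>s - rho \<Delta>) x y * u (\<theta>s - rho \<Delta>) y) = ?r * u (\<theta>s - rho \<Delta>) x" for x
        using \<Delta> by (intro eig) auto
      show "m \<le> u (\<theta>s - rho \<Delta>) x" for x using \<Delta> by (intro m_le) auto
      show "(\<Sum>y\<in>UNIV. ennreal (K x y) * (\<integral>\<^sup>+p. ennreal (lam y (snd p) powr (2 * \<theta>s - rho \<Delta>)
          * exp ((\<theta>s - rho \<Delta>) * \<gamma> y (fst p))) \<partial>\<nu>)) \<le> ennreal b2" for x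
      proof -
        let ?F = "\<lambda>(x, \<delta>). \<integral>\<^sup>+\<omega>. ennreal (lam (X 1 \<omega>) (\<eta> 1 \<omega>) powr (2 * \<theta>s - \<delta>)
                 * exp ((\<theta>s - \<delta>) * \<gamma> (X 1 \<omega>) (\<xi> 1 \<omega>))) \<partial>P x"
        have "(\<lambda>(a, b). ennreal (b powr (2 * \<theta>s - rho \<Delta>) * exp ((\<theta>s - rho \<Delta>) * a))) \<in> borel_measurable (borel \<Otimes>\<^sub>M borel)"
          by measurable
        from model.nn_integral_first_step[OF this, of x]
        have "(\<Sum>y\<in>UNIV. ennreal (K x y) * (\<integral>\<^sup>+p. ennreal (lam y (snd p) powr (2 * \<theta>s - rho \<Delta>)
          * exp ((\<theta>s - rho \<Delta>) * \<gamma> y (fst p))) \<partial>\<nu>)) = ?F (x, rho \<Delta>)" by simp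
        also have "\<dots> \<le> (SUP (x, \<delta>)\<in>UNIV \<times> {0<..<\<theta>s}. ?F (x, \<delta>))"
          using SUP_upper[of "(x, rho \<Delta>)" "UNIV \<times> {0<..<\<theta>s}" ?F] \<Delta> by simp
        finally show ?thesis using b2(2) by simp
      qed
      have "1 / m\<^sup>2 * b2 * rho \<Delta> / B2 powr (2 * \<theta>s - rho \<Delta>) \<le> b0 * b2 * rho \<Delta> / B2 powr (2 * \<theta>s - rho \<Delta>)"
        using b0(2) b2(1) \<Delta> unfolding m_def[symmetric] by (intro divide_right_mono mult_right_mono) auto
      moreover have "?r / ?D \<le> (1 - rho \<Delta> * \<mu> + b1 * (rho \<Delta>)\<^sup>2) / ?D"
        using b1(2)[of "rho \<Delta>"] \<Delta> by (intro divide_right_mono) auto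
      ultimately show "1 / m\<^sup>2 * b2 * rho \<Delta> / B2 powr (2 * \<theta>s - rho \<Delta>) + ?r / ?D \<le> 1" using sel by linarith
    qed (use \<Delta> B sel m_pos m_le_s b2(1) in auto)
  qed
  have square_integrable: "\<forall>\<^sub>F \<Delta> in at_right 0. integrable (R \<Delta>) (\<lambda>\<tau>. (estimator \<tau>)\<^sup>2)"
    using second_moment
  proof eventually_elim
    fix \<Delta> assume "(\<integral>\<^sup>+\<tau>. ennreal ((estimator \<tau>)\<^sup>2) \<partial>R \<Delta>) \<le> ennreal (hfun u \<theta>s B1 B2 \<Delta> (0, 0, x0))"
    also have "\<dots> < \<infinity>" by simp
    finally show "integrable (R \<Delta>) (\<lambda>\<tau>. (estimator \<tau>)\<^sup>2)"
      using est_meas[of \<Delta>] by (intro integrableI_nonneg) auto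
  qed
  have cv_le: "\<forall>\<^sub>F \<Delta> in at_right 0. norm (coeff_of_variation (R \<Delta>) estimator) \<le> 1 * norm (sqrt (E \<Delta>) / \<phi> \<Delta>)"
    using square_integrable eventually_rho_small[OF cramer(1)]
  proof eventually_elim
    fix \<Delta> assume int: "integrable (R \<Delta>) (\<lambda>\<tau>. (estimator \<tau>)\<^sup>2)" and \<Delta>: "0 < \<Delta> \<and> \<Delta> < 1 \<and> 0 < rho \<Delta> \<and> rho \<Delta> < \<theta>s"
    interpret R: prob_space "R \<Delta>" by (rule prob_R)
    have mean: "integrable (R \<Delta>) estimator" "R.expectation estimator = \<phi> \<Delta>"
      using unbiased[of \<Delta>] \<Delta> by (auto simp: has_bochner_integral_iff)
    have "R.variance estimator \<le> E \<Delta>" unfolding R.variance_eq[OF mean(1) int] E_def by simp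
    then have "sqrt (R.variance estimator) / \<phi> \<Delta> \<le> sqrt (E \<Delta>) / \<phi> \<Delta>"
      using \<phi>_bounds(1)[of \<Delta>] by (intro divide_right_mono) auto
    then show "norm (coeff_of_variation (R \<Delta>) estimator) \<le> 1 * norm (sqrt (E \<Delta>) / \<phi> \<Delta>)"
      using R.variance_positive[of estimator] \<phi>_bounds(1)[of \<Delta>] E_nonneg[of \<Delta>]
      by (simp add: coeff_of_variation_def mean(2))
  qed
  have main: "(\<lambda>\<Delta>. sqrt (E \<Delta>) / \<phi> \<Delta>) \<in> O[at_right 0](\<lambda>\<Delta>. cfun \<theta>s B1 B2 \<Delta> powr (2 * \<theta>s)) \<and>
      (\<forall>\<epsilon>>0. E \<in> O[at_right 0](\<lambda>\<Delta>. \<phi> \<Delta> powr (2 - \<epsilon>)))"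
  \<comment> \<open>Without jumps there is no ruin, and both the estimator and the ruin probability vanish.\<close>
  proof (cases "\<forall>y. AE p in \<nu>. lam y (snd p) = 0")
    case True
    have "E \<Delta> = 0" if "0 < \<Delta>" for \<Delta>
    proof -
      have "model.hit \<Delta> (0, 0, x0) = 0" using True by (intro model.hit_eq_0_if_no_jumps) auto
      then have "(\<integral>\<^sup>+\<tau>. ennreal (estimator \<tau>) \<partial>R \<Delta>) = 0"
        unfolding R_def using S.expectation_estimator that by simp
      then have "AE \<tau> in R \<Delta>. ennreal (estimator \<tau>) = 0"
        using est_meas[of \<Delta>] by (subst (asm) nn_integral_0_iff_AE) simp_all
      moreover have "AE \<tau> in R \<Delta>. 0 \<le> estimator \<tau>" unfolding R_def by (rule S.AE_estimator_nonneg)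
      ultimately have "AE \<tau> in R \<Delta>. (estimator \<tau>)\<^sup>2 = 0" by eventually_elim auto
      then show ?thesis unfolding E_def using integral_cong_AE[of "\<lambda>\<tau>. (estimator \<tau>)\<^sup>2" "R \<Delta>" "\<lambda>_. 0"] est_meas[of \<Delta>] by simp
    qed
    then have "\<forall>\<^sub>F \<Delta> in at_right 0. E \<Delta> = 0"
      using eventually_at_right_less[of "0 :: real"] by (auto elim: eventually_mono)
    then show ?thesis
      by (auto intro!: bigoI[where c=1] elim: eventually_mono)
  next
    case False
    then obtain y where y: "\<not> (AE p in \<nu>. lam y (snd p) = 0)" by blast
    have reach: "(x, z) \<in> {(x, y). 0 < K x y}\<^sup>*" for x z
    proof -
      obtain n where n: "0 < measure (P x) {\<omega> \<in> space (P x). X n \<omega> = z}" using irreducible by blast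
      let ?f = "\<lambda>s. if snd (snd s) = z then 1 else 0 :: ennreal"
      have f: "?f \<in> borel_measurable walk_space"
        by (rule measurable_compose[OF measurable_walk_space_components(3)]) simp
      have sets: "{\<omega> \<in> space (P x). X n \<omega> = z} \<in> sets (P x)"
        using model.X_measurable by measurable
      have "(model.step 1 ^^ n) ?f (0, 0, x) = (\<integral>\<^sup>+\<omega>. ?f (model.chain_state 1 n \<omega>) \<partial>P x)"
        by (rule model.nn_integral_chain_state[OF f, symmetric])
      also have "\<dots> = (\<integral>\<^sup>+\<omega>. indicator {\<omega> \<in> space (P x). X n \<omega> = z} \<omega> \<partial>P x)"
        by (intro nn_integral_cong) (simp add: model.chain_state_def)
      also have "\<dots> = emeasure (P x) {\<omega> \<in> space (P x). X n \<omega> = z}" by (rule nn_integral_indicator[OF sets])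
      also have "\<dots> \<noteq> 0" using n by (auto simp: measure_def)
      finally show ?thesis using model.reachable_if_funpow_step_pos[where \<Delta>=1 and n=n and y=z and z="(0, 0, x)"] by simp
    qed
    obtain p A where p: "0 < p"
      and near: "\<And>\<Delta> s d x. 0 < \<Delta> \<Longrightarrow> 0 \<le> d \<Longrightarrow> ln (1 / \<Delta>) + A \<le> s \<Longrightarrow> ennreal p \<le> model.hit \<Delta> (s, d, x)"
    proof (rule model.uniform_escape[OF model.escapes_all[OF reach y]])
      fix A p
      assume "0 < p" "\<And>\<Delta> s d x. 0 < \<Delta> \<Longrightarrow> 0 \<le> d \<Longrightarrow> ln (1 / \<Delta>) + A \<le> s \<Longrightarrow> ennreal p \<le> model.hit \<Delta> (s, d, x)"
      then show thesis by (rule that)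
    qed
    \<comment> \<open>Below \<open>\<mu> / b1\<close> the quadratic bound makes the eigenvalue at \<open>\<theta>s - \<delta>\<close> less than 1; the other bounds keep \<open>\<theta>s - \<delta>\<close> and \<open>\<theta>s + \<delta>\<close> in the domain of finite moments.\<close>
    define \<delta> where "\<delta> = min (\<theta>s / 2) (min (\<theta>' - \<theta>s) (\<mu> / (2 * b1)))"
    have \<delta>: "0 < \<delta>" "\<delta> < \<theta>s" "\<delta> \<le> \<theta>' - \<theta>s" "\<delta> \<le> \<mu> / (2 * b1)"
      using cramer(1) \<theta>'(1) \<mu>(2) b1(1) by (auto simp: \<delta>_def min_def)
    let ?q = "exp (psi_real K \<nu> \<gamma> (\<theta>s - \<delta>))"
    have "b1 * \<delta> < \<mu>" using \<delta>(4) b1(1) \<mu>(2) by (simp add: field_simps)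
    then have "b1 * \<delta> * \<delta> < \<mu> * \<delta>" using \<delta>(1) by (rule mult_strict_right_mono)
    then have "b1 * \<delta>\<^sup>2 < \<delta> * \<mu>" by (simp add: power2_eq_square ac_simps)
    moreover have "?q \<le> 1 - \<delta> * \<mu> + b1 * \<delta>\<^sup>2" using b1(2)[of \<delta>] \<delta> by simp
    ultimately have q: "?q < 1" by linarith
    have "\<exists>lo hi C. cramer_walk K \<nu> \<gamma> lam \<theta>s \<delta> ?q lo hi C (u \<theta>s) (u (\<theta>s - \<delta>))"
    proof (rule S.cramer_walk_exists[OF \<delta>(1)])
      show "chi_finite \<nu> \<gamma> (\<theta>s - \<delta>)" using \<delta> by (intro fin) auto
      show "chi_finite \<nu> \<gamma> (\<theta>s + \<delta>)" using \<delta> by (intro chi_finite_between[OF fin_s \<theta>'(2) _ _ \<gamma>_meas]) auto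
      show "0 < u (\<theta>s - \<delta>) x" for x using \<delta> by (intro u_pos) auto
      show "(\<Sum>y\<in>UNIV. Qmat K \<nu> \<gamma> (\<theta>s - \<delta>) x y * u (\<theta>s - \<delta>) y) = ?q * u (\<theta>s - \<delta>) x" for x
        using \<delta> by (intro eig) auto
    qed (use q in auto)
    then obtain lo hi C where walk: "cramer_walk K \<nu> \<gamma> lam \<theta>s \<delta> ?q lo hi C (u \<theta>s) (u (\<theta>s - \<delta>))" by blast
    obtain c where c: "0 < c" and hit_c: "\<forall>\<^sub>F \<Delta> in at_right 0. ennreal (c * \<Delta> powr \<theta>s) \<le> model.hit \<Delta> (0, 0, x0)"
      by (rule cramer_walk.hit_ge_powr[OF walk cramer(1) p near])
    have \<phi>_ge: "\<forall>\<^sub>F \<Delta> in at_right 0. c * \<Delta> powr \<theta>s \<le> \<phi> \<Delta>"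
      using hit_c eventually_at_right_less[of "0 :: real"]
    proof eventually_elim
      fix \<Delta> :: real assume "ennreal (c * \<Delta> powr \<theta>s) \<le> model.hit \<Delta> (0, 0, x0)" "0 < \<Delta>"
      then have "ennreal (c * \<Delta> powr \<theta>s) \<le> ennreal (\<phi> \<Delta>)" by (simp add: \<phi>_hit)
      then show "c * \<Delta> powr \<theta>s \<le> \<phi> \<Delta>" using \<phi>_bounds(1)[of \<Delta>] by (simp add: ennreal_le_iff)
    qed
    define M where "M = u \<theta>s x0 * (u \<theta>s x0 + 1)"
    have us: "0 < u \<theta>s x0" by (rule S.u_\<theta>s_pos)
    then have M: "0 < M" by (simp add: M_def)
    have "\<forall>\<^sub>F \<Delta> in at_right 0. u (\<theta>s - rho \<Delta>) x0 < u \<theta>s x0 + 1"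
      by (rule order_tendstoD(2)[OF u_tendsto]) simp
    with second_moment eventually_rho_small[OF cramer(1)]
    have E_le: "\<forall>\<^sub>F \<Delta> in at_right 0. E \<Delta> \<le> M * (cfun \<theta>s B1 B2 \<Delta> * \<Delta>) powr (2 * \<theta>s - rho \<Delta>)"
    proof eventually_elim
      fix \<Delta>
      assume 1: "(\<integral>\<^sup>+\<tau>. ennreal ((estimator \<tau>)\<^sup>2) \<partial>R \<Delta>) \<le> ennreal (hfun u \<theta>s B1 B2 \<Delta> (0, 0, x0))"
        and 2: "0 < \<Delta> \<and> \<Delta> < 1 \<and> 0 < rho \<Delta> \<and> rho \<Delta> < \<theta>s"
        and 3: "u (\<theta>s - rho \<Delta>) x0 < u \<theta>s x0 + 1"
      let ?a = "2 * \<theta>s - rho \<Delta>" and ?c = "cfun \<theta>s B1 B2 \<Delta>"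
      have c_nonneg: "0 \<le> ?c" using B by (simp add: cfun_def)
      have "hfun u \<theta>s B1 B2 \<Delta> (0, 0, x0) \<le> ?c powr ?a * \<Delta> powr ?a * u \<theta>s x0 * u (\<theta>s - rho \<Delta>) x0"
        by (simp add: hfun_def)
      also have "\<dots> \<le> ?c powr ?a * \<Delta> powr ?a * u \<theta>s x0 * (u \<theta>s x0 + 1)"
        using 3 us by (intro mult_left_mono) auto
      also have "\<dots> = M * (?c * \<Delta>) powr ?a" using c_nonneg 2 by (simp add: powr_mult M_def)
      finally have h: "hfun u \<theta>s B1 B2 \<Delta> (0, 0, x0) \<le> M * (?c * \<Delta>) powr ?a" .
      have "E \<Delta> = enn2real (\<integral>\<^sup>+\<tau>. ennreal ((estimator \<tau>)\<^sup>2) \<partial>R \<Delta>)"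
        unfolding E_def using est_meas[of \<Delta>] by (intro integral_eq_nn_integral) auto
      also have "\<dots> \<le> M * (?c * \<Delta>) powr ?a"
        using order_trans[OF 1 ennreal_leI[OF h]] M by (intro enn2real_leI) auto
      finally show "E \<Delta> \<le> M * (?c * \<Delta>) powr ?a" .
    qed
    show ?thesis
      using second_moment_asymptotics[OF cramer(1) B M c E_nonneg E_le \<phi>_ge \<phi>_bounds(2)] by blast
  qed
  have "(\<lambda>\<Delta>. coeff_of_variation (R \<Delta>) estimator) \<in> O[at_right 0](\<lambda>\<Delta>. sqrt (E \<Delta>) / \<phi> \<Delta>)"
    by (rule bigoI[OF cv_le])
  then have "(\<lambda>\<Delta>. coeff_of_variation (R \<Delta>) estimator) \<in> O[at_right 0](\<lambda>\<Delta>. cfun \<theta>s B1 B2 \<Delta> powr (2 * \<theta>s))"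
    using main landau_o.big_trans by blast
  then show ?thesis
    using square_integrable unbiased main unfolding E_def by blast
qed

end
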